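(* Given a directed or undirected graph $G$ with $n$ vertices and $m$ edges, its vertices can be output in a breadth-first-search (BFS) order starting at a given vertex using $2n+o(n)$ bits of working space and $O(m+n)$ time.
   Context: Model: the input graph is stored in read-only memory as a standard adjacency list (for directed graphs, out-neighbour lists), output goes to write-only memory, and only the additional random-access workspace is counted, in bits; the workspace is a word RAM with words of $\Omega(\lg n)$ bits. As a standing assumption of the paper, the input graph is connected (so $m\ge n-1$). *)

theory Defs
  imports Complex_Main "HOL-Library.Landau_Symbols" "Graph_Theory.Graph_Theory"
begin

section \<open>Word RAM with read-only input and write-only output\<close>

text \<open>
  A machine with word length \<open>w\<close> has registers, a random-access workspace, a read-only input and a
  write-only output stream; all of them hold \<open>w\<close>-bit words, i.e. naturals below \<open>2 ^ w\<close>.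
  The type parameter of \<open>instr\<close> is the type of register names, so that \<open>instr_regs\<close> yields the
  registers that an instruction mentions. Jump targets are absolute positions in the program.
\<close>

datatype arith = Plus | Minus | Times | Quot | Rem | BAnd | BOr | BXor | ShiftL | ShiftR

datatype (instr_regs: 'r) instr =
    Const 'r nat
  | Arith arith 'r 'r 'r  \<comment> \<open>the target is the first register\<close>
  | Load 'r 'r            \<comment> \<open>\<open>Load a b\<close>: \<open>a\<close> receives the workspace word at address \<open>b\<close>\<close>
  | Store 'r 'r           \<comment> \<open>\<open>Store a b\<close>: the workspace word at address \<open>a\<close> becomes \<open>b\<close>\<close>
  | Read 'r 'r            \<comment> \<open>\<open>Read a b\<close>: \<open>a\<close> receives the input word at address \<open>b\<close>\<close>
  | Write 'r
  | Jump nat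
  | JumpLess 'r 'r nat
  | JumpEq 'r 'r nat
  | Halt

type_synonym program = "nat instr list"

text \<open>On words, every result is again below \<open>2 ^ w\<close>; division by zero follows the HOL convention.\<close>

fun arith_word :: "nat \<Rightarrow> arith \<Rightarrow> nat \<Rightarrow> nat \<Rightarrow> nat" where
  "arith_word w Plus x y = (x + y) mod 2 ^ w"
| "arith_word w Minus x y = (2 ^ w + x - y) mod 2 ^ w"
| "arith_word w Times x y = (x * y) mod 2 ^ w"
| "arith_word w Quot x y = x div y"
| "arith_word w Rem x y = x mod y"
| "arith_word w BAnd x y = Bit_Operations.and x y"
| "arith_word w BOr x y = Bit_Operations.or x y"
| "arith_word w BXor x y = Bit_Operations.xor x y"
| "arith_word w ShiftL x y = push_bit y x mod 2 ^ w"
| "arith_word w ShiftR x y = drop_bit y x"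

text \<open>Configurations: program counter, registers, workspace (of fixed size), output so far.\<close>

type_synonym config = "nat \<times> (nat \<Rightarrow> nat) \<times> nat list \<times> nat list"

text \<open>\<open>None\<close> means that there is no next configuration: the machine has halted, the program counter
  has left the program, or a nonexistent workspace or input address has been accessed.\<close>

fun step :: "nat \<Rightarrow> nat list \<Rightarrow> program \<Rightarrow> config \<Rightarrow> config option" where
  "step w inp P (pc, R, M, out) =
    (if pc < length P then
       (case P ! pc of
          Const a k \<Rightarrow> Some (pc + 1, R(a := k mod 2 ^ w), M, out)
        | Arith f a b c \<Rightarrow> Some (pc + 1, R(a := arith_word w f (R b) (R c)), M, out)
        | Load a b \<Rightarrow> (if R b < length M then Some (pc + 1, R(a := M ! R b), M, out) else None)
        | Store a b \<Rightarrow> (if R a < length M then Some (pc + 1, R, M[R a := R b], out) else None)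
        | Read a b \<Rightarrow> (if R b < length inp then Some (pc + 1, R(a := inp ! R b), M, out) else None)
        | Write a \<Rightarrow> Some (pc + 1, R, M, out @ [R a])
        | Jump l \<Rightarrow> Some (l, R, M, out)
        | JumpLess a b l \<Rightarrow> Some (if R a < R b then l else pc + 1, R, M, out)
        | JumpEq a b l \<Rightarrow> Some (if R a = R b then l else pc + 1, R, M, out)
        | Halt \<Rightarrow> None)
     else None)"

fun steps :: "nat \<Rightarrow> nat list \<Rightarrow> program \<Rightarrow> nat \<Rightarrow> config \<Rightarrow> config option" where
  "steps w inp P 0 c = Some c"
| "steps w inp P (Suc t) c = Option.bind (step w inp P c) (steps w inp P t)"

text \<open>From registers \<open>R\<close> and workspace \<open>M\<close>, the program reaches \<open>Halt\<close> after exactly \<open>t\<close>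
  instructions, having written \<open>out\<close>.\<close>

definition halts_with ::
    "nat \<Rightarrow> nat list \<Rightarrow> program \<Rightarrow> (nat \<Rightarrow> nat) \<Rightarrow> nat list \<Rightarrow> nat \<Rightarrow> nat list \<Rightarrow> bool" where
  "halts_with w inp P R M t out \<longleftrightarrow>
     (\<exists>pc R' M'. steps w inp P t (0, R, M, []) = Some (pc, R', M', out)
        \<and> pc < length P \<and> P ! pc = Halt)"

text \<open>Working space in bits, with a workspace of \<open>S\<close> words: the registers are counted as well.\<close>

definition space_bits :: "nat \<Rightarrow> program \<Rightarrow> nat \<Rightarrow> nat" where
  "space_bits w P S = (card (\<Union>i\<in>set P. instr_regs i) + S) * w"

text \<open>
  Started with arbitrary contents of the registers and of a workspace of \<open>S\<close> words, the program
  halts within \<open>T\<close> instructions, and its output satisfies \<open>Q\<close>.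
\<close>

definition computes_within ::
    "nat \<Rightarrow> nat list \<Rightarrow> program \<Rightarrow> nat \<Rightarrow> nat \<Rightarrow> (nat list \<Rightarrow> bool) \<Rightarrow> bool" where
  "computes_within w inp P S T Q \<longleftrightarrow>
     (\<forall>R M. (\<forall>a. R a < 2 ^ w) \<longrightarrow> length M = S \<longrightarrow> (\<forall>x\<in>set M. x < 2 ^ w) \<longrightarrow>
        (\<exists>t out. t \<le> T \<and> halts_with w inp P R M t out \<and> Q out))"


section \<open>Input graphs and adjacency lists\<close>

text \<open>
  An undirected graph is a symmetric digraph, as in the graph library; each pair of opposite arcs is
  one edge, which appears in the adjacency lists of both endpoints.
\<close>

definition graph_with_edges :: "nat pair_pre_digraph \<Rightarrow> nat \<Rightarrow> bool" where
  "graph_with_edges G m \<longleftrightarrow>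
     (pair_fin_digraph G \<and> m = card (parcs G)) \<or>
     (pair_pseudo_graph G \<and> m = card ((\<lambda>(u, v). {u, v}) ` parcs G))"

text \<open>\<open>linked_list inp p xs\<close>: the linked list starting at address \<open>p\<close> contains \<open>xs\<close>. A cell consists
  of an entry and, in the next word, the address of the next cell. The address 0 is the null pointer.\<close>

inductive linked_list :: "nat list \<Rightarrow> nat \<Rightarrow> nat list \<Rightarrow> bool" for inp where
  nil: "linked_list inp 0 []"
| cell: "0 < p \<Longrightarrow> Suc p < length inp \<Longrightarrow> linked_list inp (inp ! Suc p) xs
    \<Longrightarrow> linked_list inp p (inp ! p # xs)"

text \<open>
  Vertices are \<open>0, \<dots>, n - 1\<close>. The words 0 and 1 of the input contain \<open>n\<close> and the start vertex, and
  word \<open>v + 2\<close> is the head of the list of out-neighbours of \<open>v\<close>. The list cells may be anywhere,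
  and the neighbours come in any order. Every input address fits into a word.
\<close>

definition adjacency_list_input :: "nat \<Rightarrow> nat pair_pre_digraph \<Rightarrow> nat \<Rightarrow> nat list \<Rightarrow> bool" where
  "adjacency_list_input w G s inp \<longleftrightarrow>
     length inp \<le> 2 ^ w \<and> (\<forall>x\<in>set inp. x < 2 ^ w) \<and>
     card (pverts G) + 2 \<le> length inp \<and> inp ! 0 = card (pverts G) \<and> inp ! 1 = s \<and>
     (\<forall>v\<in>pverts G. \<exists>xs. linked_list inp (inp ! (v + 2)) xs \<and> distinct xs
        \<and> set xs = {u. (v, u) \<in> parcs G})"


section \<open>Breadth-first-search order\<close>

definition distance :: "'a pair_pre_digraph \<Rightarrow> 'a \<Rightarrow> 'a \<Rightarrow> ereal" where
  "distance G = wf_digraph.\<mu> (with_proj G) (\<lambda>_. 1)"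

text \<open>
  The search from \<open>s\<close> visits the vertices reachable from \<open>s\<close> (in an undirected connected graph, all
  vertices) level by level; within a level the order is arbitrary.
\<close>

definition bfs_order :: "'a pair_pre_digraph \<Rightarrow> 'a \<Rightarrow> 'a list \<Rightarrow> bool" where
  "bfs_order G s vs \<longleftrightarrow>
     distinct vs \<and> set vs = {v. s \<rightarrow>\<^sup>*\<^bsub>with_proj G\<^esub> v} \<and>
     sorted_wrt (\<lambda>u v. distance G s u \<le> distance G s v) vs"

end

theory Submission
  imports Defs "HOL-Real_Asymp.Real_Asymp"
begin

text \<open>
  The search keeps two bits for each vertex: unvisited, on the frontier of the current level, on the
  frontier of the next level, or done. To enumerate a frontier in time proportional to its size,
  vertices are grouped into chunks of \<open>t = o(log n)\<close> vertices and chunks into superblocks of \<open>t\<close>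
  chunks, with \<open>log n = o(t\<^sup>2)\<close>. A summary word for each superblock tells which of its chunks meet
  the frontier, and a stack contains the superblocks that meet it; the stack has \<open>O(n / t\<^sup>2)\<close> entries
  of \<open>O(log n)\<close> bits. The lowest set bit of a \<open>t\<close>-bit number is looked up in a table of \<open>2 ^ t\<close>
  entries. All arrays are packed into words, which wastes less than \<open>t\<close> bits in each word of the
  bitmaps, so that all but \<open>2 n\<close> bits are \<open>o(n)\<close>. Every step of the search decreases a potential
  that is linear in the size of the graph.
\<close>

section \<open>Structured programs for the word RAM\<close>

text \<open>A breadth-first order may list each level in any order, so a frontier can be an
  unordered set, and no queue of vertex names (about \<open>log n\<close> bits each) is needed. A
  vertex whose list is being scanned costs only one pointer into the read-only input. What has to be
  controlled is the time spent on looking for frontier vertices. Removal is lazy for this reason: a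
  visit touches neither summary nor stack, and a stale summary bit or stack entry is deleted only
  when it is met on top of the stack and nothing is found behind it. Every round of the main loop is
  then loop-free code of constant length, and a failed lookup is paid for by what it deletes. A
  single loop rule with a decreasing measure yields termination, correctness and the time bound
  together. Three obstacles shape the rest. The program is fixed and has to find the word length by
  itself. Intermediate results must not overflow, which fails for tiny words; hence the separate
  treatment of graphs with \<open>bitlen n < 32\<close>, where quadratic time is constant.\<close>

type_synonym state = "(nat \<Rightarrow> nat) \<times> nat list \<times> nat list"

datatype test = Lt nat nat | Eq nat nat

fun holds :: "test \<Rightarrow> state \<Rightarrow> bool" where
  "holds (Lt a b) (R, M, out) \<longleftrightarrow> R a < R b"
| "holds (Eq a b) (R, M, out) \<longleftrightarrow> R a = R b"

fun jump_if :: "test \<Rightarrow> nat \<Rightarrow> nat instr" where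
  "jump_if (Lt a b) l = JumpLess a b l"
| "jump_if (Eq a b) l = JumpEq a b l"

datatype com = Do "nat instr" | Seq com com (infixr \<open>;;\<close> 60) | Branch test com com | Loop test com

fun csize :: "com \<Rightarrow> nat" where
  "csize (Do i) = 1"
| "csize (c ;; d) = csize c + csize d"
| "csize (Branch b c d) = csize c + csize d + 2"
| "csize (Loop b c) = csize c + 3"

text \<open>Jump targets are absolute, so the position \<open>l\<close> of the code is a parameter.\<close>

fun compile :: "nat \<Rightarrow> com \<Rightarrow> program" where
  "compile l (Do i) = [i]"
| "compile l (c ;; d) = compile l c @ compile (l + csize c) d"
| "compile l (Branch b c d) =
     jump_if b (l + csize d + 2) # compile (l + 1) d @
     Jump (l + csize d + 2 + csize c) # compile (l + csize d + 2) c"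
| "compile l (Loop b c) =
     jump_if b (l + 2) # Jump (l + csize c + 3) # compile (l + 2) c @ [Jump l]"

lemma length_compile [simp]: "length (compile l c) = csize c"
  by (induction c arbitrary: l) auto

text \<open>Jumps and \<open>Halt\<close> have no effect here: they would leave the structured
  control flow, so that \<open>runs_Do\<close> makes no claim about them. In compiled code they come
  only from \<open>Branch\<close> and \<open>Loop\<close>, and \<open>Halt\<close> is appended at
  the end.\<close>

fun effect :: "nat \<Rightarrow> nat list \<Rightarrow> nat instr \<Rightarrow> state \<Rightarrow> state option" where
  "effect w inp (Const a k) (R, M, out) = Some (R(a := k mod 2 ^ w), M, out)"
| "effect w inp (Arith f a b c) (R, M, out) = Some (R(a := arith_word w f (R b) (R c)), M, out)"
| "effect w inp (Load a b) (R, M, out) =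
     (if R b < length M then Some (R(a := M ! R b), M, out) else None)"
| "effect w inp (Store a b) (R, M, out) =
     (if R a < length M then Some (R, M[R a := R b], out) else None)"
| "effect w inp (Read a b) (R, M, out) =
     (if R b < length inp then Some (R(a := inp ! R b), M, out) else None)"
| "effect w inp (Write a) (R, M, out) = Some (R, M, out @ [R a])"
| "effect w inp _ _ = None"

lemma step_effect:
  assumes "pc < length P" "effect w inp (P ! pc) \<sigma> = Some \<sigma>'"
  shows "step w inp P (pc, \<sigma>) = Some (pc + 1, \<sigma>')"
  using assms by (cases \<sigma>; cases "P ! pc") (auto split: if_splits)

lemma step_jump_if:
  assumes "pc < length P" "P ! pc = jump_if b l"
  shows "step w inp P (pc, \<sigma>) = Some (if holds b \<sigma> then l else pc + 1, \<sigma>)"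
  using assms by (cases \<sigma>; cases b) auto

lemma step_jump:
  assumes "pc < length P" "P ! pc = Jump l"
  shows "step w inp P (pc, \<sigma>) = Some (l, \<sigma>)"
  using assms by (cases \<sigma>) auto

declare step.simps [simp del]

section \<open>Timed total-correctness rules for compiled code\<close>

lemma steps_add: "steps w inp P (a + b) c = Option.bind (steps w inp P a c) (steps w inp P b)"
proof (induction a arbitrary: c)
  case (Suc a)
  then show ?case by (cases "step w inp P c") simp_all
qed simp

text \<open>Quantifying over the surrounding code \<open>us\<close> and \<open>vs\<close> makes the
  judgement independent of the position despite absolute jump targets. It is total: the end of the
  code is reached within \<open>T\<close> steps.\<close>

definition runs :: "nat \<Rightarrow> nat list \<Rightarrow> com \<Rightarrow> nat \<Rightarrow> (state \<Rightarrow> bool) \<Rightarrow> state \<Rightarrow> bool" where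
  "runs w inp c T Q \<sigma> \<longleftrightarrow> (\<forall>P l us vs. P = us @ compile l c @ vs \<longrightarrow> length us = l \<longrightarrow>
     (\<exists>t \<sigma>'. t \<le> T \<and> steps w inp P t (l, \<sigma>) = Some (l + csize c, \<sigma>') \<and> Q \<sigma>'))"

lemma runsI:
  assumes "\<And>P us vs. P = us @ compile (length us) c @ vs \<Longrightarrow>
    \<exists>t \<sigma>'. t \<le> T \<and> steps w inp P t (length us, \<sigma>) = Some (length us + csize c, \<sigma>') \<and> Q \<sigma>'"
  shows "runs w inp c T Q \<sigma>"
  using assms by (auto simp: runs_def)

lemma runsE:
  assumes "runs w inp c T Q \<sigma>" "P = us @ compile l c @ vs" "length us = l"
  obtains t \<sigma>' where "t \<le> T" "steps w inp P t (l, \<sigma>) = Some (l + csize c, \<sigma>')" "Q \<sigma>'"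
  using assms(1)[unfolded runs_def, rule_format, OF assms(2,3)] that by blast

lemma runs_weaken:
  assumes r: "runs w inp c T Q \<sigma>" and "T \<le> T'" and Q: "\<And>\<sigma>'. Q \<sigma>' \<Longrightarrow> Q' \<sigma>'"
  shows "runs w inp c T' Q' \<sigma>"
proof (rule runsI)
  fix P us vs assume P: "P = us @ compile (length us) c @ vs"
  obtain t \<sigma>' where "t \<le> T" "steps w inp P t (length us, \<sigma>) = Some (length us + csize c, \<sigma>')" "Q \<sigma>'"
    using runsE[OF r P refl] .
  then show "\<exists>t \<sigma>'. t \<le> T' \<and> steps w inp P t (length us, \<sigma>) = Some (length us + csize c, \<sigma>') \<and> Q' \<sigma>'"
    using \<open>T \<le> T'\<close> Q by (meson order_trans)
qed

lemma runs_Do: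
  assumes "effect w inp i \<sigma> = Some \<sigma>'" "Q \<sigma>'"
  shows "runs w inp (Do i) 1 Q \<sigma>"
proof (rule runsI)
  fix P us vs assume P: "P = us @ compile (length us) (Do i) @ vs"
  then have "step w inp P (length us, \<sigma>) = Some (length us + 1, \<sigma>')"
    using assms by (intro step_effect) auto
  then have "steps w inp P 1 (length us, \<sigma>) = Some (length us + csize (Do i), \<sigma>')"
    by simp
  then show "\<exists>t \<sigma>'. t \<le> 1 \<and> steps w inp P t (length us, \<sigma>) = Some (length us + csize (Do i), \<sigma>') \<and> Q \<sigma>'"
    using assms(2) by (intro exI[of _ 1] exI[of _ \<sigma>']) simp
qed

text \<open>The judgement about \<open>d\<close> is the postcondition of \<open>c\<close>. A chain
  of commands can thus be verified from its end without naming intermediate assertions.\<close>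

lemma runs_Seq:
  assumes "runs w inp c T (runs w inp d U Q) \<sigma>"
  shows "runs w inp (c ;; d) (T + U) Q \<sigma>"
proof (rule runsI)
  fix P us vs assume P: "P = us @ compile (length us) (c ;; d) @ vs"
  define l where "l = length us"
  have P1: "P = us @ compile l c @ (compile (l + csize c) d @ vs)"
    and P2: "P = (us @ compile l c) @ compile (l + csize c) d @ vs"
    using P by (simp_all add: l_def)
  obtain t \<sigma>' where t: "t \<le> T" "steps w inp P t (l, \<sigma>) = Some (l + csize c, \<sigma>')"
      "runs w inp d U Q \<sigma>'"
    using assms P1 by (rule runsE) (auto simp: l_def)
  obtain u \<sigma>'' where u: "u \<le> U"
      "steps w inp P u (l + csize c, \<sigma>') = Some (l + csize c + csize d, \<sigma>'')" "Q \<sigma>''"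
    using t(3) P2 by (rule runsE) (auto simp: l_def)
  have "steps w inp P (t + u) (l, \<sigma>) = Some (l + csize (c ;; d), \<sigma>'')"
    using t u by (simp add: steps_add add.assoc)
  then show "\<exists>t \<sigma>'. t \<le> T + U \<and>
      steps w inp P t (length us, \<sigma>) = Some (length us + csize (c ;; d), \<sigma>') \<and> Q \<sigma>'"
    using t(1) u(1,3) unfolding l_def by (meson add_mono)
qed

text \<open>The two extra steps are the test and the jump that skips the code of \<open>c\<close>,
  which is placed after that of \<open>d\<close>.\<close>

lemma runs_Branch:
  assumes "holds b \<sigma> \<Longrightarrow> runs w inp c T Q \<sigma>" "\<not> holds b \<sigma> \<Longrightarrow> runs w inp d T Q \<sigma>"
  shows "runs w inp (Branch b c d) (T + 2) Q \<sigma>"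
proof (rule runsI)
  fix P us vs assume P: "P = us @ compile (length us) (Branch b c d) @ vs"
  define l where "l = length us"
  note Pl = P[folded l_def]
  have j1: "step w inp P (l, \<sigma>) = Some (if holds b \<sigma> then l + csize d + 2 else l + 1, \<sigma>)"
    by (rule step_jump_if) (auto simp: P l_def)
  show "\<exists>t \<sigma>'. t \<le> T + 2 \<and>
      steps w inp P t (length us, \<sigma>) = Some (length us + csize (Branch b c d), \<sigma>') \<and> Q \<sigma>'"
  proof (cases "holds b \<sigma>")
    case True
    have "P = (us @ jump_if b (l + csize d + 2) # compile (l + 1) d @
        [Jump (l + csize d + 2 + csize c)]) @ compile (l + csize d + 2) c @ vs"
      using P by (simp add: l_def)
    with assms(1)[OF True] obtain t \<sigma>' where t: "t \<le> T"
        "steps w inp P t (l + csize d + 2, \<sigma>) = Some (l + csize d + 2 + csize c, \<sigma>')" "Q \<sigma>'"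
      by (rule runsE) (auto simp: l_def)
    have "steps w inp P (Suc t) (l, \<sigma>) = Some (l + csize (Branch b c d), \<sigma>')"
      using t True j1 by (simp add: algebra_simps)
    then show ?thesis using t unfolding l_def by (intro exI[of _ "Suc t"] exI[of _ \<sigma>']) auto
  next
    case False
    have P': "P = (us @ [jump_if b (l + csize d + 2)]) @ compile (l + 1) d @
        (Jump (l + csize d + 2 + csize c) # compile (l + csize d + 2) c @ vs)"
      using P by (simp add: l_def)
    with assms(2)[OF False] obtain t \<sigma>' where t: "t \<le> T"
        "steps w inp P t (l + 1, \<sigma>) = Some (l + 1 + csize d, \<sigma>')" "Q \<sigma>'"
      by (rule runsE) (auto simp: l_def)
    have "P ! (l + 1 + csize d) = Jump (l + csize d + 2 + csize c)" "l + 1 + csize d < length P"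
      unfolding P' by (simp_all add: l_def nth_append)
    then have "step w inp P (l + 1 + csize d, \<sigma>') = Some (l + csize (Branch b c d), \<sigma>')"
      using step_jump by (simp add: algebra_simps)
    then have "steps w inp P (Suc (t + 1)) (l, \<sigma>) = Some (l + csize (Branch b c d), \<sigma>')"
      using t False j1 unfolding steps.simps steps_add by simp
    then show ?thesis using t unfolding l_def by (intro exI[of _ "Suc (t + 1)"] exI[of _ \<sigma>']) auto
  qed
qed

text \<open>The index of the invariant bounds the remaining rounds. A round costs the body, the test
  and the jump back; leaving the loop costs the failed test and one jump.\<close>

lemma runs_Loop:
  assumes "I N \<sigma>"
    and body: "\<And>N \<sigma>. I N \<sigma> \<Longrightarrow> holds b \<sigma> \<Longrightarrow> runs w inp c T (\<lambda>\<sigma>'. \<exists>N'<N. I N' \<sigma>') \<sigma>"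
    and exit: "\<And>N \<sigma>. I N \<sigma> \<Longrightarrow> \<not> holds b \<sigma> \<Longrightarrow> Q \<sigma>"
  shows "runs w inp (Loop b c) (N * (T + 2) + 2) Q \<sigma>"
proof (rule runsI)
  fix P us vs assume P: "P = us @ compile (length us) (Loop b c) @ vs"
  define l where "l = length us"
  have P': "P = (us @ [jump_if b (l + 2), Jump (l + csize c + 3)]) @ compile (l + 2) c @
      (Jump l # vs)"
    using P by (simp add: l_def)
  have "\<exists>t \<sigma>'. t \<le> N * (T + 2) + 2 \<and> steps w inp P t (l, \<sigma>) = Some (l + csize (Loop b c), \<sigma>') \<and> Q \<sigma>'"
    using \<open>I N \<sigma>\<close>
  proof (induction N arbitrary: \<sigma> rule: less_induct)
    case (less N)
    have j1: "step w inp P (l, \<sigma>) = Some (if holds b \<sigma> then l + 2 else l + 1, \<sigma>)"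
      by (rule step_jump_if) (auto simp: P l_def)
    show ?case
    proof (cases "holds b \<sigma>")
      case True
      from body[OF less.prems True] P' obtain t \<sigma>' where t: "t \<le> T"
          "steps w inp P t (l + 2, \<sigma>) = Some (l + 2 + csize c, \<sigma>')" "\<exists>N'<N. I N' \<sigma>'"
        by (rule runsE) (auto simp: l_def)
      then obtain N' where N': "N' < N" "I N' \<sigma>'" by blast
      from less.IH[OF N'] obtain u \<sigma>'' where u: "u \<le> N' * (T + 2) + 2"
          "steps w inp P u (l, \<sigma>') = Some (l + csize (Loop b c), \<sigma>'')" "Q \<sigma>''" by blast
      have "P ! (l + 2 + csize c) = Jump l" "l + 2 + csize c < length P"
        unfolding P' by (simp_all add: l_def nth_append)
      from this(2,1) have "step w inp P (l + 2 + csize c, \<sigma>') = Some (l, \<sigma>')"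
        by (rule step_jump)
      then have "steps w inp P (Suc (t + Suc u)) (l, \<sigma>) = Some (l + csize (Loop b c), \<sigma>'')"
        using t u True j1 unfolding steps.simps steps_add by simp
      moreover have "Suc (t + Suc u) \<le> N * (T + 2) + 2"
      proof -
        have "(N' + 1) * (T + 2) \<le> N * (T + 2)" using N' by (intro mult_right_mono) auto
        then show ?thesis using t(1) u(1) by (simp add: algebra_simps)
      qed
      ultimately show ?thesis using u(3) by blast
    next
      case False
      have "P ! (l + 1) = Jump (l + csize c + 3)" "l + 1 < length P"
        unfolding P' by (simp_all add: l_def nth_append)
      then have "step w inp P (l + 1, \<sigma>) = Some (l + csize (Loop b c), \<sigma>)"
        using step_jump by simp
      then have "steps w inp P (Suc (Suc 0)) (l, \<sigma>) = Some (l + csize (Loop b c), \<sigma>)"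
        using False j1 by simp
      then show ?thesis using exit[OF less.prems False]
        by (intro exI[of _ "Suc (Suc 0)"] exI[of _ \<sigma>]) auto
    qed
  qed
  then show "\<exists>t \<sigma>'. t \<le> N * (T + 2) + 2 \<and>
      steps w inp P t (length us, \<sigma>) = Some (length us + csize (Loop b c), \<sigma>') \<and> Q \<sigma>'"
    unfolding l_def .
qed

lemma runs_halts_with:
  assumes "runs w inp c T (\<lambda>(R, M, out). Q out) (R, M, [])"
  shows "\<exists>t out. t \<le> T \<and> halts_with w inp (compile 0 c @ [Halt]) R M t out \<and> Q out"
proof -
  have "compile 0 c @ [Halt] = [] @ compile 0 c @ [Halt]" by simp
  with assms obtain t \<sigma>' where t: "t \<le> T"
      "steps w inp (compile 0 c @ [Halt]) t (0, R, M, []) = Some (0 + csize c, \<sigma>')"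
      "(\<lambda>(R, M, out). Q out) \<sigma>'"
    by (rule runsE) auto
  obtain R' M' out where [simp]: "\<sigma>' = (R', M', out)" by (cases \<sigma>')
  have "halts_with w inp (compile 0 c @ [Halt]) R M t out"
    unfolding halts_with_def using t(2)
    by (intro exI[of _ "csize c"] exI[of _ R'] exI[of _ M']) (simp add: nth_append)
  then show ?thesis using t by auto
qed

section \<open>Weakest preconditions of loop-free code\<close>

fun wp :: "nat \<Rightarrow> nat list \<Rightarrow> com \<Rightarrow> (state \<Rightarrow> bool) \<Rightarrow> state \<Rightarrow> bool" where
  "wp w inp (Do i) Q \<sigma> \<longleftrightarrow> (case effect w inp i \<sigma> of None \<Rightarrow> False | Some \<sigma>' \<Rightarrow> Q \<sigma>')"
| "wp w inp (c ;; d) Q \<sigma> \<longleftrightarrow> wp w inp c (wp w inp d Q) \<sigma>"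
| "wp w inp (Branch b c d) Q \<sigma> \<longleftrightarrow> (if holds b \<sigma> then wp w inp c Q \<sigma> else wp w inp d Q \<sigma>)"
| "wp w inp (Loop b c) Q \<sigma> \<longleftrightarrow> False"

lemma wp_mono: "wp w inp c Q \<sigma> \<Longrightarrow> (\<And>\<sigma>. Q \<sigma> \<Longrightarrow> Q' \<sigma>) \<Longrightarrow> wp w inp c Q' \<sigma>"
proof (induction c arbitrary: Q Q' \<sigma>)
  case (Seq c d)
  have "wp w inp c (wp w inp d Q') \<sigma>"
    by (rule Seq.IH(1)[OF Seq.prems(1)[unfolded wp.simps(2)] Seq.IH(2)[OF _ Seq.prems(2)]])
  then show ?case by simp
qed (auto split: option.splits if_splits)

text \<open>Loop-free code executes no instruction twice, so its size bounds its time. Loops are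
  excluded because their \<open>wp\<close> is \<open>False\<close>.\<close>

lemma runs_wp: "wp w inp c Q \<sigma> \<Longrightarrow> runs w inp c (csize c) Q \<sigma>"
proof (induction c arbitrary: Q \<sigma>)
  case (Do i)
  then show ?case by (auto intro: runs_Do[simplified] split: option.splits)
next
  case (Seq c d)
  have "runs w inp c (csize c) (runs w inp d (csize d) Q) \<sigma>"
    by (rule runs_weaken[OF Seq.IH(1) order_refl]) (use Seq in \<open>auto intro: wp_mono\<close>)
  then show ?case by (simp add: runs_Seq)
next
  case (Branch b c d)
  have "runs w inp (Branch b c d) (csize c + csize d + 2) Q \<sigma>"
  proof (rule runs_Branch)
    assume "holds b \<sigma>"
    with Branch.prems have "wp w inp c Q \<sigma>" by simp
    then show "runs w inp c (csize c + csize d) Q \<sigma>"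
      by (rule runs_weaken[OF Branch.IH(1)]) auto
  next
    assume "\<not> holds b \<sigma>"
    with Branch.prems have "wp w inp d Q \<sigma>" by simp
    then show "runs w inp d (csize c + csize d) Q \<sigma>"
      by (rule runs_weaken[OF Branch.IH(2)]) auto
  qed
  then show ?case by simp
qed simp

section \<open>Packed arrays\<close>

text \<open>As \<open>z\<close> has at most \<open>d\<close> bits, its shift by \<open>i * d\<close>
  touches only field \<open>i\<close>; every other field lies entirely below or above it.\<close>

lemma take_bit_drop_bit_xor_push_bit:
  fixes x z :: nat
  assumes "z < 2 ^ d"
  shows "take_bit d (drop_bit (j * d) (xor x (push_bit (i * d) z))) =
    (if i = j then xor (take_bit d (drop_bit (i * d) x)) z else take_bit d (drop_bit (j * d) x))"
proof -
  have z: "\<not> bit z m" if "d \<le> m" for m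
    using assms that by (metis bit_take_bit_iff linorder_not_less take_bit_nat_eq_self)
  have "bit (push_bit (i * d) z) (j * d + m) \<longleftrightarrow> i = j \<and> bit z m" if "m < d" for m
  proof -
    consider "i = j" | "i < j" | "j < i" by linarith
    then show ?thesis
    proof cases
      case 2
      then have "Suc i * d \<le> j * d" by (intro mult_right_mono) auto
      then have "d \<le> j * d + m - i * d" by simp
      then show ?thesis using z 2 by (simp add: bit_push_bit_iff)
    next
      case 3
      then have "Suc j * d \<le> i * d" by (intro mult_right_mono) auto
      then have "\<not> i * d \<le> j * d + m" using that by simp
      then show ?thesis using 3 by (simp add: bit_push_bit_iff)
    qed (auto simp: bit_push_bit_iff)
  qed
  note push = this
  show ?thesis
  proof (rule bit_eqI)
    fix m
    show "bit (take_bit d (drop_bit (j * d) (xor x (push_bit (i * d) z)))) m \<longleftrightarrow>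
      bit (if i = j then xor (take_bit d (drop_bit (i * d) x)) z else take_bit d (drop_bit (j * d) x)) m"
      using z[of m] push[of m]
      by (cases "m < d") (simp_all add: bit_take_bit_iff bit_drop_bit_eq bit_xor_iff)
  qed
qed

text \<open>An array of \<open>d\<close>-bit fields, \<open>q\<close> of them in each word, from address \<open>b\<close> on.\<close>

definition fld :: "nat list \<Rightarrow> nat \<Rightarrow> nat \<Rightarrow> nat \<Rightarrow> nat \<Rightarrow> nat" where
  "fld M b q d i = take_bit d (drop_bit (i mod q * d) (M ! (b + i div q)))"

text \<open>An update by xor needs no mask to erase the old field. Flipping one bit is the case
  \<open>z = 2 ^ j\<close>; replacing \<open>x\<close> by \<open>y\<close> is the case
  \<open>z = xor x y\<close>.\<close>

definition xor_fld :: "nat list \<Rightarrow> nat \<Rightarrow> nat \<Rightarrow> nat \<Rightarrow> nat \<Rightarrow> nat \<Rightarrow> nat list" where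
  "xor_fld M b q d i z =
     M[b + i div q := xor (M ! (b + i div q)) (push_bit (i mod q * d) z)]"

lemma length_xor_fld [simp]: "length (xor_fld M b q d i z) = length M"
  by (simp add: xor_fld_def)

lemma fld_less: "fld M b q d i < 2 ^ d"
  by (simp add: fld_def)

lemma fld_xor_fld:
  assumes "z < 2 ^ d" "b + i div q < length M"
  shows "fld (xor_fld M b q d i z) b q d = (fld M b q d)(i := xor (fld M b q d i) z)"
proof
  fix j
  consider "i div q \<noteq> j div q" | "i div q = j div q" "i mod q \<noteq> j mod q" | "i = j"
    by (metis div_mult_mod_eq)
  then show "fld (xor_fld M b q d i z) b q d j = ((fld M b q d)(i := xor (fld M b q d i) z)) j"
  proof cases
    case 1
    then show ?thesis by (auto simp: fld_def xor_fld_def)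
  next
    case 2
    then have "i \<noteq> j" by auto
    with 2 assms show ?thesis by (simp add: fld_def xor_fld_def take_bit_drop_bit_xor_push_bit del: take_bit_xor drop_bit_xor)
  next
    case 3
    with assms show ?thesis by (simp add: fld_def xor_fld_def take_bit_drop_bit_xor_push_bit del: take_bit_xor drop_bit_xor)
  qed
qed

lemma fld_xor_fld_other:
  assumes "b' + j div q' \<noteq> b + i div q"
  shows "fld (xor_fld M b q d i z) b' q' d' j = fld M b' q' d' j"
  using assms by (simp add: fld_def xor_fld_def)

text \<open>Removes the reductions modulo \<open>2 ^ w\<close> from the address arithmetic of
  \<open>get_fld\<close> and \<open>put_fld\<close>.\<close>

lemma fld_shift_less:
  fixes q d w z :: nat
  assumes "q * d \<le> w" "0 < q" "z < 2 ^ d"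
  shows "i mod q * d < 2 ^ w" "i mod q * d + d \<le> w" "push_bit (i mod q * d) z < 2 ^ w"
proof -
  have "Suc (i mod q) * d \<le> q * d" using assms(2) by (intro mult_right_mono) (auto simp: Suc_le_eq)
  then show le: "i mod q * d + d \<le> w" using assms(1) by simp
  then show "i mod q * d < 2 ^ w" by (meson add_leE le_less_trans less_exp)
  have "push_bit (i mod q * d) z < 2 ^ (i mod q * d) * 2 ^ d"
    using assms(3) by (simp add: push_bit_eq_mult)
  also have "\<dots> \<le> 2 ^ w" using le by (simp flip: power_add)
  finally show "push_bit (i mod q * d) z < 2 ^ w" .
qed

lemma xor_less_power:
  fixes x z :: nat
  assumes "x < 2 ^ d" "z < 2 ^ d"
  shows "xor x z < 2 ^ d"
  using assms by (simp flip: take_bit_nat_eq_self_iff)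

section \<open>Breadth-first search\<close>

definition level :: "'a rel \<Rightarrow> 'a \<Rightarrow> nat \<Rightarrow> 'a set" where
  "level E s i = {v. (s, v) \<in> E ^^ i \<and> (\<forall>j<i. (s, v) \<notin> E ^^ j)}"

lemma level_unique: "v \<in> level E s i \<Longrightarrow> v \<in> level E s j \<Longrightarrow> i = j"
  unfolding level_def by (metis (mono_tags, lifting) linorder_neqE_nat mem_Collect_eq)

lemma level_0: "level E s 0 = {s}"
  by (auto simp: level_def)

lemma relpow_level:
  assumes "(s, v) \<in> E ^^ i"
  obtains j where "j \<le> i" "v \<in> level E s j"
proof -
  define j where "j = (LEAST j. (s, v) \<in> E ^^ j)"
  have "(s, v) \<in> E ^^ j" "j \<le> i" "\<forall>l<j. (s, v) \<notin> E ^^ l"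
    unfolding j_def using assms by (auto intro: LeastI Least_le dest: not_less_Least)
  then show ?thesis using that by (auto simp: level_def)
qed

lemma Un_level: "(\<Union>i. level E s i) = E\<^sup>* `` {s}"
proof -
  have "\<exists>i. v \<in> level E s i" if "(s, v) \<in> E\<^sup>*" for v
    using that relpow_level unfolding rtrancl_power by metis
  moreover have "(s, v) \<in> E\<^sup>*" if "v \<in> level E s i" for v i
    using that unfolding rtrancl_power level_def by blast
  ultimately show ?thesis by blast
qed

text \<open>The last vertex but one of a shortest walk: if it were reachable in fewer than
  \<open>i\<close> steps, \<open>v\<close> would be reachable in fewer than
  \<open>Suc i\<close>.\<close>

lemma level_Suc_pred:
  assumes "v \<in> level E s (Suc i)"
  obtains u where "u \<in> level E s i" "(u, v) \<in> E"
proof -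
  obtain u where u: "(s, u) \<in> E ^^ i" "(u, v) \<in> E"
    using assms by (auto simp: level_def)
  have "(s, u) \<notin> E ^^ j" if "j < i" for j
  proof
    assume "(s, u) \<in> E ^^ j"
    then have "(s, v) \<in> E ^^ Suc j" using u(2) by (rule relpow_Suc_I)
    then show False using that assms unfolding level_def by blast
  qed
  then have "u \<in> level E s i" using u(1) by (simp add: level_def)
  then show ?thesis using u(2) that by blast
qed

lemma level_step:
  assumes "u \<in> level E s i" "(u, v) \<in> E"
  obtains j where "j \<le> Suc i" "v \<in> level E s j"
proof -
  have "(s, v) \<in> E ^^ Suc i" using assms by (auto simp: level_def)
  then show ?thesis using that by (rule relpow_level)
qed

text \<open>
  The vertices in \<open>out\<close> have been output, those in \<open>C\<close> are the rest of level \<open>l - 1\<close>, those in \<open>N\<close>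
  are the part of level \<open>l\<close> found so far, and \<open>pend\<close> are the neighbours of the last vertex of
  \<open>out\<close> that have not been looked at yet.
\<close>

definition bfs_inv ::
    "'a rel \<Rightarrow> 'a \<Rightarrow> nat \<Rightarrow> 'a list \<Rightarrow> 'a set \<Rightarrow> 'a set \<Rightarrow> 'a list \<Rightarrow> bool" where
  "bfs_inv E s l out C N pend \<longleftrightarrow>
     distinct out \<and>
     sorted_wrt (\<lambda>u v. \<exists>i j. u \<in> level E s i \<and> v \<in> level E s j \<and> i \<le> j) out \<and>
     (\<forall>v. v \<in> set out \<union> C \<longleftrightarrow> (\<exists>i<l. v \<in> level E s i)) \<and> set out \<inter> C = {} \<and>
     (\<forall>v\<in>C. \<exists>i. l = Suc i \<and> v \<in> level E s i) \<and>
     N \<subseteq> level E s l \<and> s \<in> set out \<union> C \<union> N \<and>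
     (\<forall>v\<in>set out. \<forall>u. (v, u) \<in> E \<longrightarrow> u \<in> set out \<union> C \<union> N \<union> set pend) \<and>
     (\<forall>v\<in>set pend. \<exists>i\<le>l. v \<in> level E s i)"

lemma bfs_invI:
  assumes "distinct out"
    "sorted_wrt (\<lambda>u v. \<exists>i j. u \<in> level E s i \<and> v \<in> level E s j \<and> i \<le> j) out"
    "\<And>v. v \<in> set out \<union> C \<longleftrightarrow> (\<exists>i<l. v \<in> level E s i)" "set out \<inter> C = {}"
    "\<And>v. v \<in> C \<Longrightarrow> \<exists>i. l = Suc i \<and> v \<in> level E s i"
    "N \<subseteq> level E s l" "s \<in> set out \<union> C \<union> N"
    "\<And>u v. v \<in> set out \<Longrightarrow> (v, u) \<in> E \<Longrightarrow> u \<in> set out \<union> C \<union> N \<union> set pend"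
    "\<And>v. v \<in> set pend \<Longrightarrow> \<exists>i\<le>l. v \<in> level E s i"
  shows "bfs_inv E s l out C N pend"
  unfolding bfs_inv_def by (intro conjI allI ballI impI assms)

lemma bfs_invD:
  assumes "bfs_inv E s l out C N pend"
  shows "distinct out"
    "sorted_wrt (\<lambda>u v. \<exists>i j. u \<in> level E s i \<and> v \<in> level E s j \<and> i \<le> j) out"
    "v \<in> set out \<union> C \<longleftrightarrow> (\<exists>i<l. v \<in> level E s i)" "set out \<inter> C = {}"
    "v \<in> C \<Longrightarrow> \<exists>i. l = Suc i \<and> v \<in> level E s i"
    "N \<subseteq> level E s l" "s \<in> set out \<union> C \<union> N"
    "v \<in> set out \<Longrightarrow> (v, u) \<in> E \<Longrightarrow> u \<in> set out \<union> C \<union> N \<union> set pend"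
    "v \<in> set pend \<Longrightarrow> \<exists>i\<le>l. v \<in> level E s i"
  using assms unfolding bfs_inv_def by (simp_all del: Un_iff)

text \<open>The root starts in the next frontier while the current one is empty. The search then
  begins with an ordinary change of level, so the root needs no special case.\<close>

lemma bfs_inv_init: "bfs_inv E s 0 [] {} {s} []"
  by (simp add: bfs_inv_def level_0)

lemma bfs_inv_disjoint:
  assumes inv: "bfs_inv E s l out C N pend"
  shows "set out \<inter> C = {}" "(set out \<union> C) \<inter> N = {}"
proof -
  show "set out \<inter> C = {}" by (rule bfs_invD(4)[OF inv])
  have "v \<notin> set out \<union> C" if "v \<in> N" for v
  proof -
    have "v \<in> level E s l" using bfs_invD(6)[OF inv] that by blast
    then have "\<not> (\<exists>i<l. v \<in> level E s i)" using level_unique[of v E s l] by blast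
    then show ?thesis using bfs_invD(3)[OF inv] by simp
  qed
  then show "(set out \<union> C) \<inter> N = {}" by blast
qed

lemma bfs_inv_visit:
  assumes inv: "bfs_inv E s l out C N []" and v: "v \<in> C" and pend: "set pend = E `` {v}"
  shows "bfs_inv E s l (out @ [v]) (C - {v}) N pend"
proof (rule bfs_invI)
  note D = bfs_invD[OF inv]
  from v obtain k where k: "l = Suc k" "v \<in> level E s k" using D(5) by blast
  have "\<exists>i. u \<in> level E s i \<and> i \<le> k" if "u \<in> set out" for u
  proof -
    have "\<exists>i<l. u \<in> level E s i" using D(3)[of u] that by blast
    then show ?thesis using k(1) by auto
  qed
  then show "sorted_wrt (\<lambda>u v. \<exists>i j. u \<in> level E s i \<and> v \<in> level E s j \<and> i \<le> j) (out @ [v])"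
    using D(2) k(2) unfolding sorted_wrt_append by (simp, meson)
  show "\<exists>i\<le>l. u \<in> level E s i" if "u \<in> set pend" for u
    using level_step[OF k(2)] that pend k(1) by (metis Image_singleton_iff)
  have *: "set (out @ [v]) \<union> (C - {v}) = set out \<union> C" using v by auto
  show "u \<in> set (out @ [v]) \<union> (C - {v}) \<longleftrightarrow> (\<exists>i<l. u \<in> level E s i)" for u
    unfolding * by (rule D(3))
  show "distinct (out @ [v])" "set (out @ [v]) \<inter> (C - {v}) = {}"
    using D(1,4) v by auto
  show "u \<in> set (out @ [v]) \<union> (C - {v}) \<union> N \<union> set pend"
    if "x \<in> set (out @ [v])" "(x, u) \<in> E" for x u
    unfolding * using D(8)[of x u] that pend by auto
  show "\<exists>i. l = Suc i \<and> x \<in> level E s i" if "x \<in> C - {v}" for x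
    using D(5)[of x] that by blast
  show "s \<in> set (out @ [v]) \<union> (C - {v}) \<union> N" unfolding * by (rule D(7))
qed (rule bfs_invD(6)[OF inv])

lemma bfs_inv_skip:
  assumes inv: "bfs_inv E s l out C N (u # pend)" and u: "u \<in> set out \<union> C \<union> N"
  shows "bfs_inv E s l out C N pend"
proof -
  note D = bfs_invD[OF inv]
  show ?thesis
  proof (rule bfs_invI)
    show "x \<in> set out \<union> C \<union> N \<union> set pend" if "v \<in> set out" "(v, x) \<in> E" for v x
      using D(8)[OF that] u by auto
  qed (use D in auto)
qed

text \<open>A pending vertex has level at most \<open>l\<close>, and all vertices of lower level are
  already in \<open>out\<close> or \<open>C\<close>; a new one therefore has level exactly
  \<open>l\<close>.\<close>

lemma bfs_inv_add:
  assumes inv: "bfs_inv E s l out C N (u # pend)" and u: "u \<notin> set out \<union> C \<union> N"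
  shows "bfs_inv E s l out C (insert u N) pend"
proof -
  note D = bfs_invD[OF inv]
  have "\<exists>i\<le>l. u \<in> level E s i" "\<not> (\<exists>i<l. u \<in> level E s i)"
    using D(9)[of u] D(3)[of u] u by (simp, blast)
  then have "u \<in> level E s l" by (auto simp: le_less)
  show ?thesis
  proof (rule bfs_invI)
    show "x \<in> set out \<union> C \<union> insert u N \<union> set pend" if "v \<in> set out" "(v, x) \<in> E" for v x
      using D(8)[OF that] by auto
    show "insert u N \<subseteq> level E s l" using D(6) \<open>u \<in> level E s l\<close> by blast
  qed (use D in auto)
qed

text \<open>The point is that \<open>N\<close> is now the whole level \<open>l\<close>: a vertex of
  it has a predecessor in level \<open>l - 1\<close>, which has been output with nothing pending, so
  the vertex was found, and it is too far from \<open>s\<close> to be in \<open>out\<close>.\<close>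

lemma bfs_inv_next_level:
  assumes inv: "bfs_inv E s l out {} N []"
  shows "bfs_inv E s (Suc l) out N {} []"
proof -
  note D = bfs_invD[OF inv]
  have out: "v \<in> set out \<longleftrightarrow> (\<exists>i<l. v \<in> level E s i)" for v
    using D(3) by simp
  have succ: "u \<in> set out \<or> u \<in> N" if "v \<in> set out" "(v, u) \<in> E" for u v
    using D(8)[OF that] by simp
  have "v \<in> N" if v: "v \<in> level E s l" for v
  proof -
    have "\<not> (\<exists>i<l. v \<in> level E s i)" using level_unique[of v E s l] v by blast
    then have "v \<notin> set out" using out by simp
    moreover have "v \<in> set out \<or> v \<in> N"
    proof (cases l)
      \<comment> \<open>Level 0 has no predecessors. Its only vertex is \<open>s\<close>, which the
        invariant keeps among the vertices found.\<close>
      case 0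
      then show ?thesis using v D(7) by (simp add: level_0)
    next
      case (Suc k)
      with v obtain u where u: "u \<in> level E s k" "(u, v) \<in> E" using level_Suc_pred by metis
      then have "u \<in> set out" unfolding out using Suc by blast
      then show ?thesis using u(2) by (rule succ)
    qed
    ultimately show "v \<in> N" by simp
  qed
  then have N: "N = level E s l" using D(6) by blast
  show ?thesis
  proof (rule bfs_invI)
    show "v \<in> set out \<union> N \<longleftrightarrow> (\<exists>i<Suc l. v \<in> level E s i)" for v
      using out N by (auto simp: less_Suc_eq)
    show "set out \<inter> N = {}" using bfs_inv_disjoint(2)[OF inv] by simp
  qed (use D(1,2,7) N succ in auto)
qed

text \<open>With both frontiers empty and nothing pending, \<open>out\<close> contains
  \<open>s\<close> and is closed under \<open>E\<close>.\<close>

lemma bfs_inv_final: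
  assumes inv: "bfs_inv E s l out {} {} []"
  shows "set out = E\<^sup>* `` {s}"
proof
  note D = bfs_invD[OF inv]
  have "v \<in> (\<Union>i. level E s i)" if "v \<in> set out" for v
    using D(3)[of v] that by blast
  then show "set out \<subseteq> E\<^sup>* `` {s}"
    unfolding Un_level by blast
  have "v \<in> set out" if "(s, v) \<in> E\<^sup>*" for v
    using that
  proof induction
    case base
    then show ?case using D(7) by simp
  next
    case (step v u)
    show ?case using D(8)[OF step.IH step.hyps(2)] by simp
  qed
  then show "E\<^sup>* `` {s} \<subseteq> set out" by auto
qed

section \<open>Levels are distances of the graph library\<close>

context pair_wf_digraph
begin

lemma relpow_imp_awalk:
  "u \<in> pverts G \<Longrightarrow> (u, v) \<in> parcs G ^^ i \<Longrightarrow> \<exists>p. awalk u p v \<and> length p = i"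
proof (induction i arbitrary: v)
  case 0
  then show ?case by (auto intro!: exI[of _ "[]"] simp: awalk_Nil_iff)
next
  case (Suc i)
  then obtain x where x: "(u, x) \<in> parcs G ^^ i" "(x, v) \<in> parcs G" by auto
  with Suc obtain p where p: "awalk u p x" "length p = i" by blast
  have "awalk x [(x, v)] v"
    using x(2) wellformed' by (auto simp: awalk_def)
  then have "awalk u (p @ [(x, v)]) v" using p(1) by simp
  then show ?case using p(2) by (intro exI[of _ "p @ [(x, v)]"]) simp
qed

lemma awalk_imp_relpow: "awalk u p v \<Longrightarrow> (u, v) \<in> parcs G ^^ length p"
proof (induction p arbitrary: u)
  case Nil
  then show ?case by (auto simp: awalk_Nil_iff)
next
  case (Cons e p)
  then have "(u, snd e) \<in> parcs G" "(snd e, v) \<in> parcs G ^^ length p"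
    by (auto simp: awalk_Cons_iff)
  then show ?case by (metis relpow_Suc_I2 length_Cons)
qed

lemma distance_level:
  assumes "s \<in> pverts G" "v \<in> level (parcs G) s i"
  shows "distance G s v = ereal (real i)"
proof -
  have cost: "awalk_cost (\<lambda>_. 1) p = real (length p)" for p
    by (induction p) auto
  obtain p where p: "awalk s p v" "length p = i"
    using relpow_imp_awalk[OF assms(1), of v i] assms(2) unfolding level_def by blast
  have le: "i \<le> length p'" if "awalk s p' v" for p'
    using awalk_imp_relpow[OF that] assms(2) by (auto simp: level_def not_less[symmetric])
  have "(INF p\<in>{p. awalk s p v}. ereal (real (length p))) = ereal (real i)"
    using p le by (intro INF_eqI) auto
  then show ?thesis unfolding distance_def \<mu>_def cost .
qed

lemma bfs_inv_bfs_order: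
  assumes "s \<in> pverts G" "bfs_inv (parcs G) s l out {} {} []"
  shows "bfs_order G s out"
proof -
  have "v \<in> pverts G" if "(s, v) \<in> (parcs G)\<^sup>*" for v
    using that by induction (use assms wellformed' in auto)
  then have *: "s \<rightarrow>\<^sup>*\<^bsub>with_proj G\<^esub> v \<longleftrightarrow> (s, v) \<in> (parcs G)\<^sup>*" for v
    using assms(1) by (auto simp: reachable_conv)
  have "sorted_wrt (\<lambda>u v. distance G s u \<le> distance G s v) out"
    using assms(2) unfolding bfs_inv_def
    by (auto intro: sorted_wrt_mono_rel[rotated] simp: distance_level[OF assms(1)])
  moreover have "set out = {v. s \<rightarrow>\<^sup>*\<^bsub>with_proj G\<^esub> v}"
    unfolding * bfs_inv_final[OF assms(2)] by auto
  ultimately show ?thesis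
    using assms(2) by (simp add: bfs_order_def bfs_inv_def)
qed

end

text \<open>A vertex not yet output holds one unit for its own output and one for each outgoing arc.
  The output spends the first unit and turns the others into pending list cells.\<close>

definition bfs_work :: "'a rel \<Rightarrow> 'a set \<Rightarrow> 'a list \<Rightarrow> 'a list \<Rightarrow> nat" where
  "bfs_work E V out pend = (\<Sum>v\<in>V - set out. card (E `` {v}) + 1) + length pend"

lemma bfs_work_visit:
  assumes "finite V" "v \<in> V" "v \<notin> set out" "distinct pend" "set pend = E `` {v}"
  shows "bfs_work E V out [] = Suc (bfs_work E V (out @ [v]) pend)"
proof -
  let ?f = "\<lambda>v. card (E `` {v}) + 1"
  have "sum ?f (V - set out) = ?f v + sum ?f (V - set out - {v})"
    using assms by (intro sum.remove) auto
  moreover have "V - set out - {v} = V - set (out @ [v])" by auto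
  moreover have "card (E `` {v}) = length pend" using assms(4,5) distinct_card by metis
  ultimately show ?thesis by (simp only: bfs_work_def list.size add_0_right)
qed

section \<open>Frontier sets\<close>

definition lsb :: "nat \<Rightarrow> nat" where
  "lsb x = (LEAST j. bit x j)"

lemma bit_lsb: "x \<noteq> 0 \<Longrightarrow> bit x (lsb x)"
  unfolding lsb_def by (metis LeastI bit_eqI bit_0_eq bot_apply bot_bool_def)

lemma lsb_odd: "odd x \<Longrightarrow> lsb x = 0"
  unfolding lsb_def by (simp add: bit_0)

text \<open>The recurrence by which the lookup table is filled in time linear in its size.\<close>

lemma lsb_double: "x \<noteq> 0 \<Longrightarrow> lsb (2 * x) = Suc (lsb x)"
  unfolding lsb_def
  using bit_lsb[of x] by (subst Least_Suc[of _ "Suc (lsb x)"]) (simp_all add: bit_0 bit_double_iff)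

lemma bit_less_width: "bit x j \<Longrightarrow> x < 2 ^ t \<Longrightarrow> j < t" for x :: nat
  by (metis bit_take_bit_iff take_bit_nat_eq_self)

lemma lsb_less: "x \<noteq> 0 \<Longrightarrow> x < 2 ^ t \<Longrightarrow> lsb x < t"
  by (meson bit_lsb bit_less_width)

lemma bit_xor_power: "bit (xor x (2 ^ j)) i \<longleftrightarrow> (bit x i \<longleftrightarrow> i \<noteq> j)" for x :: nat
  by (auto simp: bit_xor_iff bit_exp_iff)

text \<open>
  \<open>X\<close>: bitmaps of chunks of \<open>t\<close> vertices; \<open>Y\<close>: for each superblock of \<open>t\<close> chunks, a bitmap of the
  chunks that may meet the frontier \<open>F\<close>; \<open>Z\<close>: a stack of \<open>c\<close> superblocks. The vertices in \<open>D\<close> are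
  done; they are marked in the bitmaps of both frontiers, so that two bits per vertex distinguish
  unvisited vertices, the two frontiers, and the vertices that are done.
\<close>

definition frontier :: "nat \<Rightarrow> nat \<Rightarrow> (nat \<Rightarrow> nat) \<Rightarrow> (nat \<Rightarrow> nat) \<Rightarrow> (nat \<Rightarrow> nat) \<Rightarrow> nat \<Rightarrow>
    nat set \<Rightarrow> nat set \<Rightarrow> bool" where
  "frontier t NS X Y Z c F D \<longleftrightarrow>
     (\<forall>v<NS * t * t. bit (X (v div t)) (v mod t) \<longleftrightarrow> v \<in> F \<union> D) \<and>
     F \<subseteq> {..<NS * t * t} \<and>
     (\<forall>S<NS. Y S < 2 ^ t) \<and>
     (\<forall>v\<in>F. bit (Y (v div t div t)) (v div t mod t)) \<and>
     (\<forall>S<NS. Y S \<noteq> 0 \<longrightarrow> S \<in> Z ` {..<c}) \<and>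
     inj_on Z {..<c} \<and> Z ` {..<c} \<subseteq> {..<NS}"

text \<open>Not a part of \<open>frontier\<close>, because it holds only for the frontier that is
  being filled; in the one being emptied, a summary may become zero while its superblock is still on
  the stack. It turns the test \<open>Y S = 0\<close> into a test for absence from the
  stack.\<close>

definition nonempty_stack :: "(nat \<Rightarrow> nat) \<Rightarrow> (nat \<Rightarrow> nat) \<Rightarrow> nat \<Rightarrow> bool" where
  "nonempty_stack Y Z c \<longleftrightarrow> (\<forall>i<c. Y (Z i) \<noteq> 0)"

definition summary :: "nat \<Rightarrow> nat \<Rightarrow> (nat \<Rightarrow> nat) \<Rightarrow> nat set" where
  "summary t NS Y = {ch. ch < NS * t \<and> bit (Y (ch div t)) (ch mod t)}"

lemma frontierD:
  assumes "frontier t NS X Y Z c F D"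
  shows "v < NS * t * t \<Longrightarrow> bit (X (v div t)) (v mod t) \<longleftrightarrow> v \<in> F \<or> v \<in> D"
    "v \<in> F \<Longrightarrow> v < NS * t * t" "S < NS \<Longrightarrow> Y S < 2 ^ t"
    "v \<in> F \<Longrightarrow> bit (Y (v div t div t)) (v div t mod t)"
    "S < NS \<Longrightarrow> Y S \<noteq> 0 \<Longrightarrow> S \<in> Z ` {..<c}" "inj_on Z {..<c}" "i < c \<Longrightarrow> Z i < NS"
  using assms unfolding frontier_def by blast+

lemma frontierI:
  assumes "\<And>v. v < NS * t * t \<Longrightarrow> bit (X (v div t)) (v mod t) \<longleftrightarrow> v \<in> F \<or> v \<in> D"
    "\<And>v. v \<in> F \<Longrightarrow> v < NS * t * t" "\<And>S. S < NS \<Longrightarrow> Y S < 2 ^ t"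
    "\<And>v. v \<in> F \<Longrightarrow> bit (Y (v div t div t)) (v div t mod t)"
    "\<And>S. S < NS \<Longrightarrow> Y S \<noteq> 0 \<Longrightarrow> S \<in> Z ` {..<c}" "inj_on Z {..<c}" "\<And>i. i < c \<Longrightarrow> Z i < NS"
  shows "frontier t NS X Y Z c F D"
  using assms unfolding frontier_def by blast

lemma frontier_stack_le:
  assumes "frontier t NS X Y Z c F D"
  shows "c \<le> NS"
proof -
  have "card (Z ` {..<c}) \<le> card {..<NS}"
    using frontierD(7)[OF assms] by (intro card_mono) auto
  then show ?thesis using frontierD(6)[OF assms] by (simp add: card_image)
qed

text \<open>A superblock with zero summary is not on the stack, and stack entries are distinct, so
  there is room for one more.\<close>

lemma frontier_stack_less:
  assumes f: "frontier t NS X Y Z c F D" and "nonempty_stack Y Z c" and "S < NS" "Y S = 0"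
  shows "c < NS"
proof -
  have "S \<notin> Z ` {..<c}" using assms by (auto simp: nonempty_stack_def)
  then have "Z ` {..<c} \<subset> {..<NS}" using frontierD(7)[OF f] \<open>S < NS\<close> by auto
  then have "card (Z ` {..<c}) < card {..<NS}" by (intro psubset_card_mono) auto
  then show ?thesis using frontierD(6)[OF f] by (simp add: card_image)
qed

lemma chunk_less: "v < NS * t * t \<Longrightarrow> v div t < NS * t" for v NS t :: nat
  by (simp add: less_mult_imp_div_less)

lemma superblock_less: "v < NS * t * t \<Longrightarrow> v div t div t < NS" for v NS t :: nat
  by (simp add: less_mult_imp_div_less)

lemma nat_eq_if_div_mod_eq: "u div t = v div t \<Longrightarrow> u mod t = v mod t \<Longrightarrow> u = v" for u v t :: nat
  by (metis div_mult_mod_eq)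

lemma bit_xor_power_upd:
  fixes X :: "nat \<Rightarrow> nat"
  shows "bit ((X(u div t := xor (X (u div t)) (2 ^ (u mod t)))) (v div t)) (v mod t) \<longleftrightarrow>
    (bit (X (v div t)) (v mod t) \<longleftrightarrow> v \<noteq> u)"
  using nat_eq_if_div_mod_eq[of u t v] by (auto simp: bit_xor_power)

lemma finite_summary: "finite (summary t NS Y)"
  by (simp add: summary_def)

lemma summary_insert:
  "summary t NS (Y(ch div t := xor (Y (ch div t)) (2 ^ (ch mod t)))) =
    (if bit (Y (ch div t)) (ch mod t) then summary t NS Y - {ch}
     else summary t NS Y \<union> ({ch} \<inter> {..<NS * t}))"
  unfolding summary_def using bit_xor_power_upd[of Y ch t] by auto

text \<open>The case distinctions are the tests of \<open>mark\<close>: the superblock is pushed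
  exactly if its old summary is zero, so no superblock occurs twice. A summary bit that is already
  set, possibly a stale one, must not be flipped.\<close>

lemma frontier_insert:
  fixes t NS u :: nat
  defines "ch \<equiv> u div t"
  defines "S \<equiv> ch div t"
  assumes "0 < t" and f: "frontier t NS X Y Z c F D" and "nonempty_stack Y Z c"
    and u: "u < NS * t * t" "u \<notin> F" "u \<notin> D"
    and X': "X' = X(ch := xor (X ch) (2 ^ (u mod t)))"
    and Y': "Y' = (if bit (Y S) (ch mod t) then Y else Y(S := xor (Y S) (2 ^ (ch mod t))))"
    and Z': "Z' = (if Y S = 0 then Z(c := S) else Z)"
    and c': "c' = (if Y S = 0 then Suc c else c)"
  shows "frontier t NS X' Y' Z' c' (insert u F) D" "nonempty_stack Y' Z' c'"
    "card (summary t NS Y') \<le> Suc (card (summary t NS Y))"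
proof -
  have S: "S < NS" using u(1) superblock_less by (simp add: S_def ch_def)
  have Y'_bit: "bit (Y' (x div t)) (x mod t) \<longleftrightarrow> bit (Y (x div t)) (x mod t) \<or> x = ch" for x
    using bit_xor_power_upd[of Y ch t x] unfolding Y' S_def by auto
  have "bit (Y' S) (ch mod t)" using Y'_bit[of ch] by (simp add: S_def)
  then have Y'S: "Y' S \<noteq> 0" by (cases "Y' S = 0") simp_all
  have Y'_other: "Y' x = Y x" if "x \<noteq> S" for x using that by (simp add: Y')
  have notin: "S \<notin> Z ` {..<c}" if "Y S = 0"
    using assms(5) that by (auto simp: nonempty_stack_def)
  show "frontier t NS X' Y' Z' c' (insert u F) D"
  proof (rule frontierI)
    fix v assume "v < NS * t * t"
    then show "bit (X' (v div t)) (v mod t) \<longleftrightarrow> v \<in> insert u F \<or> v \<in> D"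
      using frontierD(1)[OF f, of v] u bit_xor_power_upd[of X u t v]
      by (auto simp: X' ch_def)
  next
    show "Y' x < 2 ^ t" if "x < NS" for x
      using frontierD(3)[OF f that] \<open>0 < t\<close> by (auto simp: Y' intro: xor_less_power)
    show "bit (Y' (v div t div t)) (v div t mod t)" if "v \<in> insert u F" for v
      using that frontierD(4)[OF f, of v] Y'_bit[of "v div t"] by (auto simp: ch_def)
    show "x \<in> Z' ` {..<c'}" if "x < NS" "Y' x \<noteq> 0" for x
    proof (cases "x = S \<and> Y S = 0")
      case True
      then have "Z' c = x" "c < c'" by (simp_all add: Z' c')
      then show ?thesis by force
    next
      case False
      then have "Y x \<noteq> 0" using that Y'_other by metis
      then obtain i where "i < c" "Z i = x" using frontierD(5)[OF f \<open>x < NS\<close>] by auto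
      then have "Z' i = x" "i < c'" by (simp_all add: Z' c')
      then show ?thesis by force
    qed
    show "inj_on Z' {..<c'}"
      using frontierD(6)[OF f] notin
      by (auto simp: Z' c' lessThan_Suc inj_on_insert inj_on_fun_updI intro!: inj_on_fun_updI)
    show "Z' i < NS" if "i < c'" for i
      using that frontierD(7)[OF f] S by (auto simp: Z' c' less_Suc_eq)
    show "v < NS * t * t" if "v \<in> insert u F" for v
      using that u frontierD(2)[OF f] by auto
  qed
  show "nonempty_stack Y' Z' c'"
    using assms(5) Y'S Y'_other unfolding nonempty_stack_def
    by (auto simp: Z' c' less_Suc_eq) metis+
  show "card (summary t NS Y') \<le> Suc (card (summary t NS Y))"
  proof -
    have "summary t NS Y' \<subseteq> insert ch (summary t NS Y)"
      using Y'_bit by (auto simp: summary_def)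
    then have "card (summary t NS Y') \<le> card (insert ch (summary t NS Y))"
      by (intro card_mono) (simp_all add: finite_summary)
    also have "\<dots> \<le> Suc (card (summary t NS Y))" by (simp add: card_insert_if finite_summary)
    finally show ?thesis .
  qed
qed

text \<open>The bitmap encodes only \<open>F \<union> D\<close>, so moving \<open>v\<close> from
  \<open>F\<close> to \<open>D\<close> changes none of its bits.\<close>

lemma frontier_done:
  "frontier t NS X Y Z c F D \<Longrightarrow> v \<in> F \<Longrightarrow> frontier t NS X Y Z c (F - {v}) (insert v D)"
  unfolding frontier_def by auto

text \<open>The other bitmap must receive the bit of \<open>v\<close>. Its summary and stack stay as
  they are, since they have to cover only \<open>F\<close>.\<close>

lemma frontier_done_other:
  assumes f: "frontier t NS X Y Z c F D" and "v \<notin> F" "v \<notin> D"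
  shows "frontier t NS (X(v div t := xor (X (v div t)) (2 ^ (v mod t)))) Y Z c F (insert v D)"
proof (rule frontierI)
  fix x assume "x < NS * t * t"
  then show "bit ((X(v div t := xor (X (v div t)) (2 ^ (v mod t)))) (x div t)) (x mod t) \<longleftrightarrow>
      x \<in> F \<or> x \<in> insert v D"
    unfolding bit_xor_power_upd using frontierD(1)[OF f] assms by auto
qed (use frontierD[OF f] in auto)

text \<open>A lookup that finds the chunk \<open>ch\<close> empty removes exactly one summary bit,
  which pays for the lookup.\<close>

lemma frontier_clear:
  assumes f: "frontier t NS X Y Z c F D" and "0 < t" "ch < NS * t"
    and bit: "bit (Y (ch div t)) (ch mod t)" and empty: "\<And>v. v \<in> F \<Longrightarrow> v div t \<noteq> ch"
  defines "Y' \<equiv> Y(ch div t := xor (Y (ch div t)) (2 ^ (ch mod t)))"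
  shows "frontier t NS X Y' Z c F D" "Suc (card (summary t NS Y')) = card (summary t NS Y)"
proof -
  have Y': "bit (Y' (x div t)) (x mod t) \<longleftrightarrow> (bit (Y (x div t)) (x mod t) \<longleftrightarrow> x \<noteq> ch)" for x
    unfolding Y'_def by (rule bit_xor_power_upd)
  show "frontier t NS X Y' Z c F D"
  proof (rule frontierI)
    show "Y' S < 2 ^ t" if "S < NS" for S
      using frontierD(3)[OF f that] \<open>0 < t\<close> by (auto simp: Y'_def intro: xor_less_power)
    show "bit (Y' (v div t div t)) (v div t mod t)" if "v \<in> F" for v
      using frontierD(4)[OF f that] empty[OF that] Y' by simp
    show "S \<in> Z ` {..<c}" if "S < NS" "Y' S \<noteq> 0" for S
    proof (rule frontierD(5)[OF f that(1)])
      show "Y S \<noteq> 0"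
      proof (cases "S = ch div t")
        case True
        then show ?thesis using bit by (cases "Y S = 0") simp_all
      next
        case False
        then show ?thesis using that(2) by (simp add: Y'_def)
      qed
    qed
  qed (use frontierD[OF f] in auto)
  have "ch \<in> summary t NS Y" using bit \<open>ch < NS * t\<close> by (simp add: summary_def)
  moreover have "summary t NS Y' = summary t NS Y - {ch}"
    unfolding Y'_def summary_insert using bit by simp
  ultimately show "Suc (card (summary t NS Y')) = card (summary t NS Y)"
    using finite_summary by (metis card_Suc_Diff1)
qed

lemma frontier_pop:
  assumes f: "frontier t NS X Y Z (Suc c) F D" and "Y (Z c) = 0"
  shows "frontier t NS X Y Z c F D"
proof (rule frontierI)
  show "S \<in> Z ` {..<c}" if "S < NS" "Y S \<noteq> 0" for S
    using frontierD(5)[OF f that] that assms by (auto simp: less_Suc_eq)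
qed (use frontierD[OF f] in \<open>auto simp: inj_on_def\<close>)

text \<open>A vertex in \<open>F\<close> would make a summary nonzero, and superblocks with nonzero
  summary are on the stack.\<close>

lemma frontier_empty:
  assumes f: "frontier t NS X Y Z 0 F D"
  shows "F = {}" "nonempty_stack Y Z 0"
  using frontierD(4,5)[OF f] superblock_less[OF frontierD(2)[OF f]]
  by (fastforce simp: nonempty_stack_def)+

text \<open>The bits of \<open>xor x (and x x')\<close> are those of \<open>x\<close> outside \<open>x'\<close>.\<close>

lemma frontier_chunk:
  assumes f: "frontier t NS X Y Z c F D" and f': "frontier t NS X' Y' Z' c' F' D"
    and disj: "F \<inter> F' = {}" "F \<inter> D = {}" and "ch < NS * t" "j < t"
  shows "bit (xor (X ch) (Bit_Operations.and (X ch) (X' ch))) j \<longleftrightarrow> ch * t + j \<in> F"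
proof -
  have "ch * t + j < Suc ch * t" using \<open>j < t\<close> by simp
  also have "\<dots> \<le> NS * t * t" using \<open>ch < NS * t\<close> by (intro mult_right_mono) auto
  finally have v: "ch * t + j < NS * t * t" .
  have "(ch * t + j) div t = ch" "(ch * t + j) mod t = j" using \<open>j < t\<close> by simp_all
  then show ?thesis
    using frontierD(1)[OF f v] frontierD(1)[OF f' v] disj by (auto simp: bit_simps)
qed

section \<open>The search program\<close>

abbreviation (input) "ADD a b c \<equiv> Do (Arith Plus a b c)"
abbreviation (input) "SUB a b c \<equiv> Do (Arith Minus a b c)"
abbreviation (input) "MUL a b c \<equiv> Do (Arith Times a b c)"
abbreviation (input) "DIV a b c \<equiv> Do (Arith Quot a b c)"
abbreviation (input) "MOD a b c \<equiv> Do (Arith Rem a b c)"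
abbreviation (input) "AND a b c \<equiv> Do (Arith BAnd a b c)"
abbreviation (input) "OR a b c \<equiv> Do (Arith BOr a b c)"
abbreviation (input) "XOR a b c \<equiv> Do (Arith BXor a b c)"
abbreviation (input) "SHL a b c \<equiv> Do (Arith ShiftL a b c)"
abbreviation (input) "SHR a b c \<equiv> Do (Arith ShiftR a b c)"

text \<open>Registers from 23 on are scratch registers.\<close>

abbreviation (input) "rZ \<equiv> 2 :: nat"
abbreviation (input) "r1 \<equiv> 3 :: nat"
abbreviation (input) "r2 \<equiv> 4 :: nat"
abbreviation (input) "r4 \<equiv> 5 :: nat"
abbreviation (input) "rN \<equiv> 6 :: nat"
abbreviation (input) "rS \<equiv> 7 :: nat"
abbreviation (input) "rK \<equiv> 8 :: nat"
abbreviation (input) "rT \<equiv> 9 :: nat"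
abbreviation (input) "rQA \<equiv> 10 :: nat"
abbreviation (input) "rMA \<equiv> 11 :: nat"
abbreviation (input) "rQB \<equiv> 12 :: nat"
abbreviation (input) "rMB \<equiv> 13 :: nat"
abbreviation (input) "rB \<equiv> 14 :: nat"
abbreviation (input) "rTab \<equiv> 15 :: nat"
abbreviation (input) "rCur \<equiv> 16 :: nat"
abbreviation (input) "rNxt \<equiv> 17 :: nat"
abbreviation (input) "rCntC \<equiv> 18 :: nat"
abbreviation (input) "rCntN \<equiv> 19 :: nat"
abbreviation (input) "rPtr \<equiv> 20 :: nat"
abbreviation (input) "rGo \<equiv> 21 :: nat"
abbreviation (input) "rU \<equiv> 22 :: nat"

definition skip :: com where
  "skip = Do (Const 23 0)"

definition get_fld :: "nat \<Rightarrow> nat \<Rightarrow> nat \<Rightarrow> nat \<Rightarrow> nat \<Rightarrow> nat \<Rightarrow> com" where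
  "get_fld a i rb rq rd rm =
     DIV 23 i rq ;; ADD 23 23 rb ;; Do (Load 23 23) ;;
     MOD 24 i rq ;; MUL 24 24 rd ;; SHR 23 23 24 ;; AND a 23 rm"

definition put_fld :: "nat \<Rightarrow> nat \<Rightarrow> nat \<Rightarrow> nat \<Rightarrow> nat \<Rightarrow> com" where
  "put_fld i v rb rq rd =
     DIV 23 i rq ;; ADD 23 23 rb ;;
     MOD 24 i rq ;; MUL 24 24 rd ;; SHL 24 v 24 ;;
     Do (Load 25 23) ;; XOR 24 25 24 ;; Do (Store 23 24)"

definition "getA a i = get_fld a i rZ rQA rT rMA"
definition "getB a i = get_fld a i rB rQB rK rMB"
definition "xorA i v = put_fld i v rZ rQA rT"
definition "xorB i v = put_fld i v rB rQB rK"

text \<open>Registers 26 and 27 hold the chunk of the vertex and its bit in the chunk, later the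
  superblock and the bit of the chunk in it. The disjunction of the two bitmaps tells whether the
  vertex has been found. The old summary, in register 30, decides about the push before its bit is
  set. The stack slot may contain a stale value \<open>x\<close>; it is overwritten by xor with
  \<open>xor x S\<close>, where \<open>S\<close> is the superblock.\<close>

definition mark :: com where
  "mark =
     DIV 26 rU rT ;; MOD 27 rU rT ;; SHL 27 r1 27 ;;
     MUL 28 26 r2 ;; ADD 29 28 rNxt ;; ADD 28 28 rCur ;;
     getA 30 28 ;; getA 31 29 ;; OR 30 30 31 ;; AND 30 30 27 ;;
     Branch (Eq 30 rZ)
       (xorA 29 27 ;;
        MOD 27 26 rT ;; SHL 27 r1 27 ;; DIV 26 26 rT ;;
        MUL 28 26 r4 ;; ADD 28 28 rNxt ;; getB 30 28 ;;
        Branch (Eq 30 rZ)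
          (MUL 29 rCntN r4 ;; ADD 29 29 r2 ;; ADD 29 29 rNxt ;;
           getB 31 29 ;; XOR 31 31 26 ;; xorB 29 31 ;; ADD rCntN rCntN r1)
          skip ;;
        AND 30 30 27 ;;
        Branch (Eq 30 rZ) (xorB 28 27) skip)
       skip"

text \<open>Each call performs one action: exchange the frontiers, pop a superblock with zero
  summary, delete the summary bit of an empty chunk, or output a vertex. The output vertex gets its
  bit in the bitmap of the next frontier, at index 27, and thereby becomes done. After an exchange
  \<open>rGo\<close> is the size of the new current stack, so the search stops if that is
  empty.\<close>

definition pick :: com where
  "pick =
     Branch (Eq rCntC rZ)
       (ADD 26 rCur rZ ;; ADD rCur rNxt rZ ;; ADD rNxt 26 rZ ;;
        ADD rCntC rCntN rZ ;; ADD rCntN rZ rZ ;; ADD rGo rCntC rZ)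
       (SUB 26 rCntC r1 ;; MUL 27 26 r4 ;; ADD 27 27 r2 ;; ADD 27 27 rCur ;; getB 28 27 ;;
        MUL 29 28 r4 ;; ADD 29 29 rCur ;; getB 30 29 ;;
        Branch (Eq 30 rZ)
          (ADD rCntC 26 rZ)
          (ADD 31 30 rTab ;; getB 31 31 ;; SHL 30 r1 31 ;; MUL 28 28 rT ;; ADD 28 28 31 ;;
           MUL 27 28 r2 ;; ADD 26 27 rCur ;; ADD 27 27 rNxt ;;
           getA 26 26 ;; getA 31 27 ;; AND 31 26 31 ;; XOR 26 26 31 ;;
           Branch (Eq 26 rZ)
             (xorB 29 30)
             (ADD 31 26 rTab ;; getB 31 31 ;; SHL 30 r1 31 ;; xorA 27 30 ;;
              MUL 28 28 rT ;; ADD 28 28 31 ;; Do (Write 28) ;;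
              ADD 28 28 r2 ;; Do (Read rPtr 28))))"

definition search_body :: com where
  "search_body =
     Branch (Eq rPtr rZ) pick
       (Do (Read rU rPtr) ;; ADD rPtr rPtr r1 ;; Do (Read rPtr rPtr) ;; mark)"

text \<open>The scratch registers have arbitrary contents in the continuation, so callers need not
  follow the address computation.\<close>

lemma get_fld_wp:
  assumes "R rb = b" "R rq = q" "R rd = d" "R rm = 2 ^ d - 1"
    and "i \<notin> {23, 24}" "rb \<notin> {23, 24}" "rq \<notin> {23, 24}" "rd \<notin> {23, 24}" "rm \<notin> {23, 24}"
    and "0 < q" "q * d \<le> w" "b + R i div q < length M" "length M \<le> 2 ^ w"
    and Q: "\<And>x y. P (R(23 := x, 24 := y, a := fld M b q d (R i)), M, out)"
  shows "wp w inp (get_fld a i rb rq rd rm) P (R, M, out)"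
proof -
  have 1: "(R i div q + b) mod 2 ^ w = b + R i div q" using assms by simp
  have 2: "R i mod q * d mod 2 ^ w = R i mod q * d"
    using fld_shift_less(1)[OF \<open>q * d \<le> w\<close> \<open>0 < q\<close>, of 0] by simp
  have twist: "R(24 := y, 23 := x) = R(23 := x, 24 := y)" for x y
    by auto
  have 3: "Bit_Operations.and x (2 ^ d - Suc 0) = take_bit d x" for x :: nat
    by (simp add: take_bit_eq_mask mask_eq_exp_minus_1)
  show ?thesis
    using assms(1-9,12) Q[of _ "R i mod q * d"]
    unfolding get_fld_def fld_def by (simp add: 1 2 3 twist)
qed

lemma put_fld_wp:
  assumes "R rb = b" "R rq = q" "R rd = d"
    and "i \<notin> {23, 24, 25}" "rb \<notin> {23, 24}" "rq \<notin> {23, 24}" "rd \<notin> {23, 24}" "v \<notin> {23, 24, 25}"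
    and "0 < q" "q * d \<le> w" "b + R i div q < length M" "length M \<le> 2 ^ w" "R v < 2 ^ d"
    and Q: "\<And>x y z. P (R(23 := x, 24 := y, 25 := z), xor_fld M b q d (R i) (R v), out)"
  shows "wp w inp (put_fld i v rb rq rd) P (R, M, out)"
proof -
  have 1: "(R i div q + b) mod 2 ^ w = b + R i div q" using assms by simp
  have 2: "R i mod q * d mod 2 ^ w = R i mod q * d"
    using fld_shift_less(1)[OF \<open>q * d \<le> w\<close> \<open>0 < q\<close>, of 0] by simp
  have 3: "push_bit (R i mod q * d) (R v) mod 2 ^ w = push_bit (R i mod q * d) (R v)"
    using fld_shift_less(3)[OF \<open>q * d \<le> w\<close> \<open>0 < q\<close> \<open>R v < 2 ^ d\<close>] by simp
  have twist: "R(23 := x, 24 := y', 25 := z, 24 := y) = R(23 := x, 24 := y, 25 := z)" for x y z y'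
    by auto
  show ?thesis
    using assms(1-8,11) Q
    unfolding put_fld_def xor_fld_def by (simp add: 1 2 3 twist)
qed

text \<open>From address 0 on, words hold \<open>q\<close> fields of \<open>t\<close> bits for the
  bitmaps; from address \<open>b\<close> on, \<open>Q\<close> fields of \<open>k\<close> bits for
  the \<open>NS\<close> superblocks' summaries and stacks and, from field \<open>tb\<close> on, for
  the lookup table. The bounds \<open>fit\<close> keep indices and vertex addresses within a
  word.\<close>

locale layout =
  fixes w n k t q Q NS b tb len :: nat
  assumes t: "0 < t" "t \<le> k" and n: "n < 2 ^ k" "n \<le> NS * t * t"
    and q: "0 < q" "q * t \<le> w" and Q: "0 < Q" "Q * k \<le> w"
    and NS: "NS < 2 ^ k" and b: "2 * (NS * t) div q < b" and tb: "tb = 4 * NS"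
    and len: "b + (tb + 2 ^ t) div Q < len" "len \<le> 2 ^ w"
    and fit: "2 * (NS * t) < 2 ^ w" "tb + 2 ^ t \<le> 2 ^ w" "n + 2 \<le> 2 ^ w"
begin

lemma kw: "k \<le> w"
proof -
  have "k \<le> Q * k" using Q(1) by (cases Q) auto
  then show ?thesis using Q(2) by (rule order_trans)
qed

lemma fld_le_word: "x < 2 ^ k \<Longrightarrow> x < 2 ^ w" for x :: nat
  by (meson kw le_less_trans less_le_trans one_le_numeral power_increasing)

text \<open>The default 0 beyond the bitmaps hides the words of the second array. Thus writing to
  that array leaves \<open>A\<close> unchanged as a function (\<open>A_wrB\<close>), not only on
  valid indices.\<close>

definition "A M i = (if i < 2 * (NS * t) then fld M 0 q t i else 0)"
definition "B M = fld M b Q k"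

text \<open>The two bitmaps are interleaved in one array; the two summaries and the two stacks are interleaved
  in a second one, in front of the table.\<close>

definition "X M p c = A M (2 * c + p)"
definition "Y M p S = B M (4 * S + p)"
definition "Z M p i = B M (4 * i + 2 + p)"
definition "Tab M x = B M (tb + x)"

abbreviation "wrA M i z \<equiv> xor_fld M 0 q t i z"
abbreviation "wrB M i z \<equiv> xor_fld M b Q k i z"

definition const_regs :: "(nat \<Rightarrow> nat) \<Rightarrow> bool" where
  "const_regs R \<longleftrightarrow> R rZ = 0 \<and> R r1 = 1 \<and> R r2 = 2 \<and> R r4 = 4 \<and> R rK = k \<and> R rT = t \<and>
     R rQA = q \<and> R rMA = 2 ^ t - 1 \<and> R rQB = Q \<and> R rMB = 2 ^ k - 1 \<and> R rB = b \<and> R rTab = tb"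

lemma const_regs_upd [simp]:
  "a \<notin> {rZ, r1, r2, r4, rK, rT, rQA, rMA, rQB, rMB, rB, rTab} \<Longrightarrow>
    const_regs (R(a := x)) = const_regs R"
  unfolding const_regs_def by simp

lemma const_regsD:
  assumes "const_regs R"
  shows "R rZ = 0" "R r1 = 1" "R r2 = 2" "R r4 = 4" "R rK = k" "R rT = t"
    "R rQA = q" "R rMA = 2 ^ t - 1" "R rQB = Q" "R rMB = 2 ^ k - 1" "R rB = b" "R rTab = tb"
  using assms by (simp_all add: const_regs_def)

lemma addrA: "i < 2 * (NS * t) \<Longrightarrow> i div q < b"
  using b by (meson div_le_mono le_less_trans less_imp_le)

lemma addrA_len: "i < 2 * (NS * t) \<Longrightarrow> i div q < len"
  using addrA len by fastforce

lemma addrB_len: "i < tb + 2 ^ t \<Longrightarrow> b + i div Q < len"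
  using len by (meson div_le_mono le_less_trans less_imp_le nat_add_left_cancel_le)

lemma getA_wp:
  assumes "const_regs R" "length M = len" "R i < 2 * (NS * t)" "i \<notin> {23, 24}"
    and "\<And>x y. P (R(23 := x, 24 := y, a := A M (R i)), M, out)"
  shows "wp w inp (getA a i) P (R, M, out)"
  unfolding getA_def
  by (rule get_fld_wp[of R rZ 0 rQA q rT t])
    (use assms const_regsD[OF assms(1)] q len(2) addrA_len in \<open>simp_all add: A_def\<close>)

lemma getB_wp:
  assumes "const_regs R" "length M = len" "R i < tb + 2 ^ t" "i \<notin> {23, 24}"
    and "\<And>x y. P (R(23 := x, 24 := y, a := B M (R i)), M, out)"
  shows "wp w inp (getB a i) P (R, M, out)"
  unfolding getB_def
  by (rule get_fld_wp[of R rB b rQB Q rK k])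
    (use assms const_regsD[OF assms(1)] Q len(2) addrB_len in \<open>simp_all add: B_def\<close>)

lemma xorA_wp:
  assumes "const_regs R" "length M = len" "R i < 2 * (NS * t)" "R v < 2 ^ t"
    "i \<notin> {23, 24, 25}" "v \<notin> {23, 24, 25}"
    and "\<And>x y z. P (R(23 := x, 24 := y, 25 := z), wrA M (R i) (R v), out)"
  shows "wp w inp (xorA i v) P (R, M, out)"
  unfolding xorA_def
  by (rule put_fld_wp[of R rZ 0 rQA q rT t])
    (use assms const_regsD[OF assms(1)] q len(2) addrA_len in \<open>simp_all\<close>)

lemma xorB_wp:
  assumes "const_regs R" "length M = len" "R i < tb + 2 ^ t" "R v < 2 ^ k"
    "i \<notin> {23, 24, 25}" "v \<notin> {23, 24, 25}"
    and "\<And>x y z. P (R(23 := x, 24 := y, 25 := z), wrB M (R i) (R v), out)"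
  shows "wp w inp (xorB i v) P (R, M, out)"
  unfolding xorB_def
  by (rule put_fld_wp[of R rB b rQB Q rK k])
    (use assms const_regsD[OF assms(1)] Q len(2) addrB_len in \<open>simp_all\<close>)

lemma A_wrA:
  assumes "length M = len" "i < 2 * (NS * t)" "z < 2 ^ t"
  shows "A (wrA M i z) = (A M)(i := xor (A M i) z)"
  using fld_xor_fld[OF assms(3), of 0 i q M] addrA_len[OF assms(2)] assms
  by (auto simp: A_def fun_eq_iff)

lemma B_wrB:
  assumes "length M = len" "i < tb + 2 ^ t" "z < 2 ^ k"
  shows "B (wrB M i z) = (B M)(i := xor (B M i) z)"
  using fld_xor_fld[OF assms(3), of b i Q M] addrB_len[OF assms(2)] assms
  by (auto simp: B_def)

lemma B_wrA: "i < 2 * (NS * t) \<Longrightarrow> B (wrA M i z) = B M"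
  using addrA[of i] by (auto simp: B_def fld_xor_fld_other)

lemma A_wrB: "A (wrB M i z) = A M"
  using addrA by (fastforce simp: A_def fld_xor_fld_other fun_eq_iff)

lemma indexX: "c < NS * t \<Longrightarrow> p < 2 \<Longrightarrow> 2 * c + p < 2 * (NS * t)"
  by linarith

lemma indexY: "S < NS \<Longrightarrow> p < 2 \<Longrightarrow> 4 * S + p < tb"
  using tb by linarith

lemma indexZ: "i < NS \<Longrightarrow> p < 2 \<Longrightarrow> 4 * i + 2 + p < tb"
  using tb by linarith

lemma X_wrX:
  assumes "length M = len" "c < NS * t" "p < 2" "z < 2 ^ t" "p' < 2"
  shows "X (wrA M (2 * c + p) z) p' = (if p' = p then (X M p)(c := xor (X M p c) z) else X M p')"
proof -
  have "2 * x + p' = 2 * c + p \<longleftrightarrow> x = c \<and> p' = p" for x using assms by presburger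
  then show ?thesis
    unfolding X_def A_wrA[OF assms(1) indexX[OF assms(2,3)] assms(4)] by (auto simp: fun_eq_iff)
qed

lemma wrX_other:
  assumes "c < NS * t" "p < 2"
  shows "Y (wrA M (2 * c + p) z) = Y M" "Z (wrA M (2 * c + p) z) = Z M"
    "Tab (wrA M (2 * c + p) z) = Tab M"
  using B_wrA[OF indexX[OF assms]] by (auto simp: Y_def Z_def Tab_def fun_eq_iff)

lemma wrB_X: "X (wrB M i z) = X M"
  by (auto simp: X_def A_wrB fun_eq_iff)

lemma Y_wrY:
  assumes "length M = len" "S < NS" "p < 2" "z < 2 ^ k" "p' < 2"
  shows "Y (wrB M (4 * S + p) z) p' = (if p' = p then (Y M p)(S := xor (Y M p S) z) else Y M p')"
    "Z (wrB M (4 * S + p) z) p' = Z M p'"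
    "Tab (wrB M (4 * S + p) z) = Tab M"
proof -
  have B: "B (wrB M (4 * S + p) z) = (B M)(4 * S + p := xor (B M (4 * S + p)) z)"
    using assms indexY[of S p] by (intro B_wrB) auto
  have "4 * x + p' = 4 * S + p \<longleftrightarrow> x = S \<and> p' = p" for x using assms by presburger
  then show "Y (wrB M (4 * S + p) z) p' = (if p' = p then (Y M p)(S := xor (Y M p S) z) else Y M p')"
    unfolding Y_def B by (auto simp: fun_eq_iff)
  have "4 * x + 2 + p' \<noteq> 4 * S + p" for x using assms by presburger
  then show "Z (wrB M (4 * S + p) z) p' = Z M p'"
    unfolding Z_def B by (auto simp: fun_eq_iff)
  show "Tab (wrB M (4 * S + p) z) = Tab M"
    using indexY[of S p] assms unfolding Tab_def B by (auto simp: fun_eq_iff)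
qed

lemma Z_wrZ:
  assumes "length M = len" "i < NS" "p < 2" "z < 2 ^ k" "p' < 2"
  shows "Z (wrB M (4 * i + 2 + p) z) p' = (if p' = p then (Z M p)(i := xor (Z M p i) z) else Z M p')"
    "Y (wrB M (4 * i + 2 + p) z) p' = Y M p'"
    "Tab (wrB M (4 * i + 2 + p) z) = Tab M"
proof -
  have B: "B (wrB M (4 * i + 2 + p) z) = (B M)(4 * i + 2 + p := xor (B M (4 * i + 2 + p)) z)"
    using assms indexZ[of i p] by (intro B_wrB) auto
  have "4 * x + 2 + p' = 4 * i + 2 + p \<longleftrightarrow> x = i \<and> p' = p" for x using assms by presburger
  then show "Z (wrB M (4 * i + 2 + p) z) p' = (if p' = p then (Z M p)(i := xor (Z M p i) z) else Z M p')"
    unfolding Z_def B by (auto simp: fun_eq_iff)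
  have "4 * x + p' \<noteq> 4 * i + 2 + p" for x using assms by presburger
  then show "Y (wrB M (4 * i + 2 + p) z) p' = Y M p'"
    unfolding Y_def B by (auto simp: fun_eq_iff)
  show "Tab (wrB M (4 * i + 2 + p) z) = Tab M"
    using indexZ[of i p] assms unfolding Tab_def B by (auto simp: fun_eq_iff)
qed

lemma X_less: "X M p c < 2 ^ t"
  by (simp add: X_def A_def fld_less)

lemma B_less: "B M i < 2 ^ k"
  by (simp add: B_def fld_less)

definition table_ok :: "nat list \<Rightarrow> bool" where
  "table_ok M \<longleftrightarrow> (\<forall>x. 0 < x \<longrightarrow> x < 2 ^ t \<longrightarrow> Tab M x = lsb x)"

text \<open>The frontier \<open>F\<close> of the current level has parity \<open>p\<close>, the frontier \<open>F'\<close> of the next level \<open>p'\<close>.\<close>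

definition store :: "(nat \<Rightarrow> nat) \<Rightarrow> nat list \<Rightarrow> nat \<Rightarrow> nat \<Rightarrow> nat \<Rightarrow> nat \<Rightarrow>
    nat set \<Rightarrow> nat set \<Rightarrow> nat set \<Rightarrow> bool" where
  "store R M p p' c c' F F' D \<longleftrightarrow>
     const_regs R \<and> length M = len \<and> table_ok M \<and> p + p' = 1 \<and>
     R rCur = p \<and> R rNxt = p' \<and> R rCntC = c \<and> R rCntN = c' \<and>
     frontier t NS (X M p) (Y M p) (Z M p) c F D \<and>
     frontier t NS (X M p') (Y M p') (Z M p') c' F' D \<and>
     nonempty_stack (Y M p') (Z M p') c' \<and>
     F \<inter> F' = {} \<and> F \<inter> D = {} \<and> F' \<inter> D = {} \<and> F \<union> F' \<union> D \<subseteq> {..<n}"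

lemma storeD:
  assumes "store R M p p' c c' F F' D"
  shows "const_regs R" "length M = len" "table_ok M" "p + p' = 1" "R rCur = p" "R rNxt = p'"
    "R rCntC = c" "R rCntN = c'"
    "frontier t NS (X M p) (Y M p) (Z M p) c F D"
    "frontier t NS (X M p') (Y M p') (Z M p') c' F' D"
    "nonempty_stack (Y M p') (Z M p') c'"
    "F \<inter> F' = {}" "F \<inter> D = {}" "F' \<inter> D = {}" "F \<union> F' \<union> D \<subseteq> {..<n}"
  using assms unfolding store_def by blast+

definition pot :: "nat list \<Rightarrow> nat \<Rightarrow> nat \<Rightarrow> nat \<Rightarrow> nat \<Rightarrow> nat" where
  "pot M p p' c c' = card (summary t NS (Y M p)) + card (summary t NS (Y M p')) + c + 2 * c'"

end

section \<open>Inserting a neighbour into the next frontier\<close>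

context layout
begin

lemma skip_wp: "P (R(23 := 0), M, out) \<Longrightarrow> wp w inp skip P (R, M, out)"
  by (simp add: skip_def)

lemma power_le_k: "j < t \<Longrightarrow> (2::nat) ^ j < 2 ^ k"
  using t by (meson less_le_trans one_less_numeral_iff power_strict_increasing semiring_norm(76))

lemma shift_one: "j < t \<Longrightarrow> (2::nat) ^ j mod 2 ^ w = 2 ^ j"
  using fld_le_word[OF power_le_k] by simp

lemma and_power_eq_0: "Bit_Operations.and x (2 ^ j) = 0 \<longleftrightarrow> \<not> bit x j" for x :: nat
  by (rule and_exp_eq_0_iff_not_bit)

lemma xor_cancel: "xor x (xor x y) = y" for x y :: nat
  by (auto simp: bit_eq_iff bit_xor_iff)

lemma store_upd [simp]:
  assumes "a \<notin> {rZ, r1, r2, r4, rK, rT, rQA, rMA, rQB, rMB, rB, rTab, rCur, rNxt, rCntC, rCntN}"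
  shows "store (R(a := x)) M p p' c c' F F' D = store R M p p' c c' F F' D"
  using assms unfolding store_def by simp

text \<open>\<open>M1\<close>, \<open>M2\<close>, \<open>M3\<close> are the memories after the
  writes of \<open>mark\<close> to bitmap, stack and summary. The potential grows by at most 3: one
  summary bit, and one stack entry of weight 2.\<close>

lemma store_mark:
  fixes u c' p' :: nat and M M1 M2 M3 :: "nat list"
  assumes st: "store R M p p' c c' F F' D" and u: "u < n" "u \<notin> F \<union> F' \<union> D"
  defines "ch \<equiv> u div t"
  defines "S \<equiv> ch div t"
  defines "M1 \<equiv> wrA M (2 * ch + p') (2 ^ (u mod t))"
  defines "M2 \<equiv> if Y M p' S = 0
    then wrB M1 (4 * c' + 2 + p') (xor (B M (4 * c' + 2 + p')) S) else M1"
  defines "M3 \<equiv> if bit (Y M p' S) (ch mod t) then M2 else wrB M2 (4 * S + p') (2 ^ (ch mod t))"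
  defines "c'' \<equiv> if Y M p' S = 0 then Suc c' else c'"
  shows "store (R(rCntN := c'')) M3 p p' c c'' F (insert u F') D"
    and "pot M3 p p' c c'' \<le> pot M p p' c c' + 3"
    and "Y M p' S = 0 \<Longrightarrow> c' < NS"
proof -
  note D = storeD[OF st]
  have pp: "p < 2" "p' < 2" "p \<noteq> p'" using D(4) by presburger+
  have uN: "u < NS * t * t" using u n by simp
  have ch: "ch < NS * t" using chunk_less[OF uN] by (simp add: ch_def)
  have S: "S < NS" using superblock_less[OF uN] by (simp add: S_def ch_def)
  have j: "u mod t < t" "ch mod t < t" using t by simp_all
  note pj = power_le_k[OF j(1)] power_le_k[OF j(2)]
  show c': "c' < NS" if "Y M p' S = 0"
    using frontier_stack_less[OF D(10,11) S that] .
  have "S < 2 ^ k" using S NS by simp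
  have z: "xor (B M (4 * c' + 2 + p')) S < 2 ^ k"
    by (rule xor_less_power[OF B_less \<open>S < 2 ^ k\<close>])
  have l1: "length M1 = len" and l2: "length M2 = len" and l3: "length M3 = len"
    using D(2) by (simp_all add: M1_def M2_def M3_def)
  have XA: "X M1 a = (if a = p' then (X M p')(ch := xor (X M p' ch) (2 ^ (u mod t))) else X M a)"
    if "a < 2" for a
    unfolding M1_def using D(2) ch pp(2) that j(1) by (intro X_wrX) simp_all
  note YA = wrX_other[OF ch pp(2), of M "2 ^ (u mod t)", folded M1_def]
  have B1: "B M1 = B M" unfolding M1_def by (rule B_wrA[OF indexX[OF ch pp(2)]])
  have Z1: "xor (Z M p' c') (xor (B M (4 * c' + 2 + p')) S) = S" by (simp add: Z_def xor_cancel)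
  have X2: "X M2 = X M1" by (simp add: M2_def wrB_X)
  have Y2: "Y M2 a = Y M a" and
    Z2: "Z M2 a = (if a = p' \<and> Y M p' S = 0 then (Z M p')(c' := S) else Z M a)" and
    T2: "Tab M2 = Tab M" if "a < 2" for a
    using Z_wrZ[OF l1 c' pp(2) z that] that YA z Z1
    by (auto simp: M2_def)
  have X3: "X M3 = X M1" by (simp add: M3_def X2 wrB_X)
  have Y3: "Y M3 a = (if a = p' \<and> \<not> bit (Y M p' S) (ch mod t)
      then (Y M p')(S := xor (Y M p' S) (2 ^ (ch mod t))) else Y M a)" and
    Z3: "Z M3 a = Z M2 a" and
    T3: "Tab M3 = Tab M" if "a < 2" for a
    using Y_wrY[OF l2 S pp(2) pj(2) that] that Y2 T2
    by (auto simp: M3_def)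
  have ins: "frontier t NS (X M3 p') (Y M3 p') (Z M3 p') c'' (insert u F') D"
    "nonempty_stack (Y M3 p') (Z M3 p') c''"
    "card (summary t NS (Y M3 p')) \<le> Suc (card (summary t NS (Y M p')))"
    by (rule frontier_insert[OF t(1) D(10,11) uN,
          where X' = "X M3 p'" and Y' = "Y M3 p'" and Z' = "Z M3 p'" and c' = c''];
        use u pp in \<open>simp add: X3 XA Y3 Z3 Z2 c''_def S_def ch_def\<close>)+
  have p3: "X M3 p = X M p" "Y M3 p = Y M p" "Z M3 p = Z M p"
    using pp by (simp_all add: X3 XA Y3 Z3 Z2)
  have "table_ok M3" using D(3) T3[of p] pp by (simp add: table_ok_def)
  then show "store (R(rCntN := c'')) M3 p p' c c'' F (insert u F') D"
    using D ins l3 u unfolding store_def p3 by simp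
  show "pot M3 p p' c c'' \<le> pot M p p' c c' + 3"
    using ins(3) unfolding pot_def p3 c''_def by simp
qed

lemma store_regs:
  assumes "store R M p p' c c' F F' D"
    and "\<forall>a\<in>{rZ, r1, r2, r4, rK, rT, rQA, rMA, rQB, rMB, rB, rTab, rCur, rNxt, rCntC, rCntN}. R' a = R a"
  shows "store R' M p p' c c' F F' D"
  using assms unfolding store_def const_regs_def by simp

lemma mark_wp:
  assumes st: "store R M p p' c c' F F' D" and u: "R rU = u" "u < n"
    and P: "\<And>R' M' c''. store R' M' p p' c c'' F (if u \<in> F \<union> F' \<union> D then F' else insert u F') D \<Longrightarrow>
      R' rPtr = R rPtr \<Longrightarrow> R' rGo = R rGo \<Longrightarrow>
      pot M' p p' c c'' \<le> pot M p p' c c' + (if u \<in> F \<union> F' \<union> D then 0 else 3) \<Longrightarrow> P (R', M', out)"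
  shows "wp w inp mark P (R, M, out)"
proof -
  note D = storeD[OF st]
  note C = const_regsD[OF D(1)]
  have pp: "p < 2" "p' < 2" "p \<noteq> p'" using D(4) by presburger+
  define ch where "ch = u div t"
  define S where "S = ch div t"
  have uN: "u < NS * t * t" using u n by simp
  have ch: "ch < NS * t" using chunk_less[OF uN] by (simp add: ch_def)
  have S: "S < NS" using superblock_less[OF uN] by (simp add: S_def ch_def)
  have j: "u mod t < t" "ch mod t < t" using t by simp_all
  have i1: "2 * ch + p < 2 * (NS * t)" "2 * ch + p' < 2 * (NS * t)"
    using indexX[OF ch] pp by simp_all
  have w1: "ch * 2 mod 2 ^ w = 2 * ch" "(2 * ch + p) mod 2 ^ w = 2 * ch + p"
    "(2 * ch + p') mod 2 ^ w = 2 * ch + p'"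
    using i1 fit(1) by auto
  have i2: "4 * S + p' < tb + 2 ^ t" using indexY[OF S pp(2)] by simp
  have w2: "S * 4 mod 2 ^ w = 4 * S" "(4 * S + p') mod 2 ^ w = 4 * S + p'"
    using i2 fit(2) by auto
  note sh = shift_one[OF j(1)] shift_one[OF j(2)]
  have pj: "(2::nat) ^ (u mod t) < 2 ^ t" "(2::nat) ^ (ch mod t) < 2 ^ k"
    using j power_le_k by simp_all
  have visited: "Bit_Operations.and (or (A M (2 * ch + p)) (A M (2 * ch + p'))) (2 ^ (u mod t)) = 0
      \<longleftrightarrow> u \<notin> F \<union> F' \<union> D"
    using frontierD(1)[OF D(9) uN] frontierD(1)[OF D(10) uN]
    unfolding and_power_eq_0 bit_or_iff by (auto simp: X_def ch_def)
  show ?thesis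
  proof (cases "u \<in> F \<union> F' \<union> D")
    case True
    show ?thesis
      unfolding mark_def
      apply (simp add: u C D(5,6) ch_def[symmetric] w1 sh del: One_nat_def)
      apply (rule getA_wp)
          apply (simp_all add: D C i1)
      apply (rule getA_wp)
          apply (simp_all add: D C i1)
      using True visited apply simp
      apply (rule skip_wp)
      apply (rule P[of _ _ c'])
         apply (simp_all add: st)
      done
  next
    case False
    define M1 where "M1 = wrA M (2 * ch + p') (2 ^ (u mod t))"
    define M2 where "M2 = (if Y M p' S = 0
      then wrB M1 (4 * c' + 2 + p') (xor (B M (4 * c' + 2 + p')) S) else M1)"
    define M3 where "M3 = (if bit (Y M p' S) (ch mod t) then M2 else wrB M2 (4 * S + p') (2 ^ (ch mod t)))"
    define c'' where "c'' = (if Y M p' S = 0 then Suc c' else c')"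
    note M = store_mark[OF st u(2) False, folded ch_def, folded S_def, folded M1_def,
        folded M2_def c''_def, folded M3_def]
    have len: "length M1 = len" "length M2 = len"
      using D(2) by (simp_all add: M1_def M2_def)
    have YB: "B M (4 * S + p') = Y M p' S" by (simp add: Y_def)
    have B1: "B M1 = B M" unfolding M1_def by (rule B_wrA[OF i1(2)])
    \<comment> \<open>The code after the optional push is common to both cases; it is treated once,
      for all register contents that agree on the values still in use.\<close>
    have tail: "wp w inp (AND 30 30 27 ;; Branch (Eq 30 rZ) (xorB 28 27) skip) P (R2, M2, out)"
      if R2: "\<forall>a\<in>{rZ, r1, r2, r4, rK, rT, rQA, rMA, rQB, rMB, rB, rTab, rCur, rNxt, rCntC, rPtr, rGo}. R2 a = R a"
        "R2 rCntN = c''" "R2 27 = 2 ^ (ch mod t)" "R2 28 = 4 * S + p'" "R2 30 = Y M p' S" for R2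
    proof -
      have st2: "store R2 M3 p p' c c'' F (insert u F') D"
        by (rule store_regs[OF M(1)]) (use R2 in simp)
      note C2 = storeD(1)[OF st2] const_regsD[OF storeD(1)[OF st2]] R2(2-5)
      have v: "R2 rPtr = R rPtr" "R2 rGo = R rGo" using R2(1) by simp_all
      show ?thesis
      proof (cases "bit (Y M p' S) (ch mod t)")
        case True
        then have M3: "M3 = M2" by (simp add: M3_def)
        show ?thesis
          apply (simp add: True C2 and_power_eq_0)
          apply (rule skip_wp)
          apply (rule P[of _ _ c''])
             apply (use False v st2[unfolded M3] M(2)[unfolded M3] in simp_all)
          done
      next
        case bit: False
        then have M3: "M3 = wrB M2 (4 * S + p') (2 ^ (ch mod t))" by (simp add: M3_def)
        show ?thesis
          apply (simp add: bit C2 and_power_eq_0)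
          apply (rule xorB_wp)
                apply (simp_all add: C2 len i2 pj M3[symmetric])
          apply (rule P[of _ _ c''])
             apply (use False v st2 M(2) in simp_all)
          done
      qed
    qed
    show ?thesis
    proof (cases "Y M p' S = 0")
      case True
      have c': "c' < NS" by (rule M(3)[OF True])
      have i3: "4 * c' + 2 + p' < tb + 2 ^ t" using indexZ[OF c' pp(2)] by simp
      have w3: "c' * 4 mod 2 ^ w = 4 * c'" "Suc (Suc (4 * c')) mod 2 ^ w = Suc (Suc (4 * c'))"
        "(Suc (Suc (4 * c')) + p') mod 2 ^ w = Suc (Suc (4 * c' + p'))"
        "Suc (Suc (4 * c' + p')) mod 2 ^ w = Suc (Suc (4 * c' + p'))"
        "Suc c' mod 2 ^ w = Suc c'"
        using i3 fit(2) by auto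
      have z: "xor (B M (Suc (Suc (4 * c' + p')))) S < 2 ^ k"
        using S NS by (intro xor_less_power B_less) simp
      have M2: "wrB M1 (Suc (Suc (4 * c' + p'))) (xor (B M (Suc (Suc (4 * c' + p')))) S) = M2"
        using True by (simp add: M2_def)
      have c'': "c'' = Suc c'" using True by (simp add: c''_def)
      show ?thesis
        unfolding mark_def
        apply (simp add: u C D(5,6) ch_def[symmetric] w1 sh del: One_nat_def)
        apply (rule getA_wp)
            apply (simp_all add: D C i1)
        apply (rule getA_wp)
            apply (simp_all add: D C i1)
        using False visited apply simp
        apply (rule xorA_wp)
              apply (simp_all add: D C i1 pj S_def[symmetric] sh w2 M1_def[symmetric] del: One_nat_def)
        apply (rule getB_wp)
            apply (simp_all add: D C i2 YB B1 True w3 len)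
        apply (rule getB_wp)
            apply (use i3 in \<open>simp_all add: D C B1 len\<close>)
        apply (rule xorB_wp)
              apply (use i3 in \<open>simp_all add: D C len z M2 w3 del: wp.simps\<close>)
        apply (simp add: D C w3 del: wp.simps(2,3))
        apply (rule tail)
            apply (simp_all add: c'' True)
        done
    next
      case False
      then have M2: "M2 = M1" and c'': "c'' = c'" by (simp_all add: M2_def c''_def)
      note tail = tail[unfolded M2 c'']
      show ?thesis
        unfolding mark_def
        apply (simp add: u C D(5,6) ch_def[symmetric] w1 sh del: One_nat_def)
        apply (rule getA_wp)
            apply (simp_all add: D C i1)
        apply (rule getA_wp)
            apply (simp_all add: D C i1)
        using \<open>u \<notin> F \<union> F' \<union> D\<close> visited apply simp
        apply (rule xorA_wp)
              apply (simp_all add: D C i1 pj S_def[symmetric] sh w2 M1_def[symmetric] del: One_nat_def)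
        apply (rule getB_wp)
            apply (simp_all add: D C i2 YB B1 False len)
        apply (rule skip_wp)
        apply (rule tail)
            apply (simp_all add: D)
        done
    qed
  qed
qed

end

lemma linked_list_0: "linked_list inp 0 xs \<longleftrightarrow> xs = []"
  by (auto elim: linked_list.cases intro: linked_list.nil)

lemma linked_list_Cons:
  assumes "linked_list inp p xs" "p \<noteq> 0"
  obtains ys where "xs = inp ! p # ys" "Suc p < length inp" "linked_list inp (inp ! Suc p) ys"
  using assms by (auto elim: linked_list.cases)

section \<open>Taking a vertex from the current frontier\<close>

context layout
begin

text \<open>The stack entries of the next frontier drop from weight 2 to weight 1, which releases
  \<open>c'\<close> units. If \<open>c' = 0\<close>, nothing is released; then \<open>rGo\<close>
  becomes 0, and the unit that \<open>search_inv\<close> grants to a nonzero \<open>rGo\<close>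
  pays.\<close>

lemma store_swap:
  assumes st: "store R M p p' 0 c' F F' D"
    and R': "\<forall>a\<in>{rZ, r1, r2, r4, rK, rT, rQA, rMA, rQB, rMB, rB, rTab}. R' a = R a"
      "R' rCur = p'" "R' rNxt = p" "R' rCntC = c'" "R' rCntN = 0"
  shows "store R' M p' p c' 0 F' {} D" "F = {}" "pot M p' p c' 0 + c' = pot M p p' 0 c'"
proof -
  note D = storeD[OF st]
  note e = frontier_empty[OF D(9)]
  show "store R' M p' p c' 0 F' {} D"
    using D(2-4,9-15) e R' D(1) unfolding store_def const_regs_def by auto
  show "F = {}" by (rule e(1))
  show "pot M p' p c' 0 + c' = pot M p p' 0 c'" by (simp add: pot_def)
qed

lemma store_pop:
  assumes st: "store R M p p' (Suc i) c' F F' D" and "Y M p (Z M p i) = 0"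
    and R': "\<forall>a\<in>{rZ, r1, r2, r4, rK, rT, rQA, rMA, rQB, rMB, rB, rTab, rCur, rNxt, rCntN}. R' a = R a"
      "R' rCntC = i"
  shows "store R' M p p' i c' F F' D"
  using storeD[OF st] frontier_pop[OF storeD(9)[OF st] assms(2)] R'
  unfolding store_def const_regs_def by auto

lemma store_clear:
  assumes st: "store R M p p' c c' F F' D" and "ch < NS * t"
    and "bit (Y M p (ch div t)) (ch mod t)" "\<And>v. v \<in> F \<Longrightarrow> v div t \<noteq> ch"
  defines "M1 \<equiv> wrB M (4 * (ch div t) + p) (2 ^ (ch mod t))"
  shows "store R M1 p p' c c' F F' D" "Suc (pot M1 p p' c c') = pot M p p' c c'"
proof -
  note D = storeD[OF st]
  have pp: "p < 2" "p' < 2" "p \<noteq> p'" using D(4) by presburger+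
  have S: "ch div t < NS" using assms(2) by (simp add: less_mult_imp_div_less)
  have pj: "(2::nat) ^ (ch mod t) < 2 ^ k" using t by (intro power_le_k) simp
  note W = Y_wrY[OF D(2) S pp(1) pj, folded M1_def]
  have X1: "X M1 = X M" by (simp add: M1_def wrB_X)
  note cl = frontier_clear[OF D(9) t(1) assms(2-4)]
  have "table_ok M1" using D(3) W(3)[OF pp(1)] by (simp add: table_ok_def)
  moreover have "length M1 = len" using D(2) by (simp add: M1_def)
  ultimately show "store R M1 p p' c c' F F' D"
    using D(1,4-15) cl(1) pp W(1,2) unfolding store_def X1 by simp
  show "Suc (pot M1 p p' c c') = pot M p p' c c'"
    using cl(2) pp W(1) by (simp add: pot_def)
qed

text \<open>Only one bit of the other bitmap changes, so the potential is constant; the visit is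
  paid for by \<open>bfs_work\<close> instead.\<close>

lemma store_visit:
  assumes st: "store R M p p' c c' F F' D" and v: "v \<in> F"
  defines "M1 \<equiv> wrA M (2 * (v div t) + p') (2 ^ (v mod t))"
  shows "store R M1 p p' c c' (F - {v}) F' (insert v D)" "pot M1 p p' c c' = pot M p p' c c'"
proof -
  note D = storeD[OF st]
  have pp: "p < 2" "p' < 2" "p \<noteq> p'" using D(4) by presburger+
  have ch: "v div t < NS * t" using chunk_less[OF frontierD(2)[OF D(9) v]] .
  have pj: "(2::nat) ^ (v mod t) < 2 ^ t" using t by simp
  note W = X_wrX[OF D(2) ch pp(2) pj, folded M1_def] wrX_other[OF ch pp(2), of M, folded M1_def]
  have W2: "Y M1 = Y M" "Z M1 = Z M" "Tab M1 = Tab M"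
    using wrX_other[OF ch pp(2), of M "2 ^ (v mod t)"] by (simp_all add: M1_def)
  have "v \<notin> F'" "v \<notin> D" using v D(12,13) by auto
  then have "frontier t NS (X M1 p') (Y M1 p') (Z M1 p') c' F' (insert v D)"
    using frontier_done_other[OF D(10), of v] W(1)[OF pp(2)] W2 by simp
  moreover have "frontier t NS (X M1 p) (Y M1 p) (Z M1 p) c (F - {v}) (insert v D)"
    using frontier_done[OF D(9) v] W(1)[OF pp(1)] W2 pp by simp
  moreover have "length M1 = len" "table_ok M1" using D(2,3) W2 by (simp_all add: M1_def table_ok_def)
  ultimately show "store R M1 p p' c c' (F - {v}) F' (insert v D)"
    using D(1,4-8,11-15) v W2 unfolding store_def by auto
  show "pot M1 p p' c c' = pot M p p' c c'" using W2 by (simp add: pot_def)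
qed

lemma table_lookup:
  assumes "table_ok M" "z \<noteq> 0" "z < 2 ^ t"
  shows "B M (z + tb) = lsb z"
proof -
  have "Tab M z = lsb z" using assms by (simp add: table_ok_def)
  then show ?thesis by (simp only: Tab_def add.commute)
qed

text \<open>\<open>advance\<close> covers both kinds of cleaning up, a pop and the deletion of a
  summary bit: each keeps \<open>F\<close> and costs exactly one unit of potential.\<close>

lemma pick_wp:
  assumes st: "store R M p p' c c' F F' D" and n_inp: "n + 2 \<le> length inp"
    and swap: "\<And>R'. c = 0 \<Longrightarrow> store R' M p' p c' 0 F' {} D \<Longrightarrow> F = {} \<Longrightarrow>
      pot M p' p c' 0 + c' = pot M p p' 0 c' \<Longrightarrow> R' rPtr = R rPtr \<Longrightarrow> R' rGo = c' \<Longrightarrow> P (R', M, out)"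
    and advance: "\<And>R' M' i. store R' M' p p' i c' F F' D \<Longrightarrow>
      Suc (pot M' p p' i c') = pot M p p' c c' \<Longrightarrow>
      R' rPtr = R rPtr \<Longrightarrow> R' rGo = R rGo \<Longrightarrow> P (R', M', out)"
    and visit: "\<And>R' M' v. v \<in> F \<Longrightarrow> store R' M' p p' c c' (F - {v}) F' (insert v D) \<Longrightarrow>
      pot M' p p' c c' = pot M p p' c c' \<Longrightarrow>
      R' rPtr = inp ! (v + 2) \<Longrightarrow> R' rGo = R rGo \<Longrightarrow> P (R', M', out @ [v])"
  shows "wp w inp pick P (R, M, out)"
proof (cases c)
  case 0
  note D = storeD[OF st[unfolded 0]]
  note C = const_regsD[OF D(1)]
  have c': "c' < 2 ^ w" "p < 2 ^ w" "p' < 2 ^ w"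
  proof -
    have "c' \<le> NS" using frontier_stack_le[OF D(10)] .
    then show "c' < 2 ^ w" using fld_le_word[OF NS] by simp
    have "1 < (2::nat) ^ w" using fit(3) by (meson add_lessD1 less_le_trans one_less_numeral_iff semiring_norm(76) le_add2)
    then show "p < 2 ^ w" "p' < 2 ^ w" using D(4) by linarith+
  qed
  show ?thesis
    unfolding pick_def
    apply (simp add: D C c')
    apply (rule swap)
         apply (rule 0)
        apply (rule store_swap(1)[OF st[unfolded 0]])
            apply (simp_all add: D C c' frontier_empty(1)[OF D(9)] pot_def)
    done
next
  case (Suc i)
  note D = storeD[OF st[unfolded Suc]]
  note C = const_regsD[OF D(1)]
  have pp: "p < 2" "p' < 2" "p \<noteq> p'" using D(4) by presburger+
  define S where "S = Z M p i"
  define y where "y = Y M p S"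
  have i: "i < NS" using frontier_stack_le[OF D(9)] by simp
  have S: "S < NS" unfolding S_def by (rule frontierD(7)[OF D(9)]) simp
  have y: "y < 2 ^ t" unfolding y_def by (rule frontierD(3)[OF D(9) S])
  have i1: "4 * i + 2 + p < tb + 2 ^ t" "4 * S + p < tb + 2 ^ t" "y + tb < tb + 2 ^ t"
    using indexZ[OF i pp(1)] indexY[OF S pp(1)] y by simp_all
  have w1: "i mod 2 ^ w = i" "i * 4 mod 2 ^ w = 4 * i"
      "Suc (Suc (4 * i)) mod 2 ^ w = Suc (Suc (4 * i))"
      "(Suc (Suc (4 * i)) + p) mod 2 ^ w = Suc (Suc (4 * i + p))"
      "Suc (Suc (4 * i + p)) mod 2 ^ w = Suc (Suc (4 * i + p))"
      "S * 4 mod 2 ^ w = 4 * S" "(4 * S + p) mod 2 ^ w = 4 * S + p"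
      "(y + tb) mod 2 ^ w = y + tb"
    using i1 fit(2) by auto
  have BZ: "B M (Suc (Suc (4 * i + p))) = S" by (simp add: S_def Z_def)
  have BY: "B M (4 * S + p) = y" by (simp add: y_def Y_def)
  show ?thesis
  proof (cases "y = 0")
    case True
    show ?thesis
      unfolding pick_def
      apply (simp add: D C w1)
      apply (rule getB_wp)
          apply (use i1 in \<open>simp_all add: D C BZ w1\<close>)
      apply (rule getB_wp)
          apply (use i1 in \<open>simp_all add: D C BY w1 True\<close>)
      apply (rule advance)
         apply (rule store_pop[OF st[unfolded Suc] True[unfolded y_def S_def]])
          apply (simp_all add: Suc pot_def)
      done
  next
    case False
    define ch where "ch = S * t + lsb y"
    have j: "lsb y < t" by (rule lsb_less[OF False y])
    have chS: "ch div t = S" "ch mod t = lsb y" using j by (simp_all add: ch_def)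
    have ch: "ch < NS * t"
    proof -
      have "ch < Suc S * t" using j by (simp add: ch_def)
      also have "\<dots> \<le> NS * t" using S by (intro mult_right_mono) auto
      finally show ?thesis .
    qed
    have Ty: "B M (y + tb) = lsb y"
      by (rule table_lookup[OF D(3) False y])
    define x where "x = xor (X M p ch) (Bit_Operations.and (X M p ch) (X M p' ch))"
    have x: "bit x m \<longleftrightarrow> ch * t + m \<in> F" if "m < t" for m
      unfolding x_def using D(9,10,12,13) ch that by (rule frontier_chunk)
    have x_less: "x < 2 ^ t"
      unfolding x_def using X_less[of M p ch] X_less[of M p' ch]
      by (simp flip: take_bit_nat_eq_self_iff)
    have i2: "2 * ch + p < 2 * (NS * t)" "2 * ch + p' < 2 * (NS * t)" "x + tb < tb + 2 ^ t"
      using indexX[OF ch] pp x_less by simp_all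
    have w2: "S * t mod 2 ^ w = S * t" "(S * t + lsb y) mod 2 ^ w = ch" "ch * 2 mod 2 ^ w = 2 * ch"
        "(2 * ch + p) mod 2 ^ w = 2 * ch + p" "(2 * ch + p') mod 2 ^ w = 2 * ch + p'"
        "(x + tb) mod 2 ^ w = x + tb"
      using i2 fit(1,2) ch by (auto simp: ch_def)
    have pj: "(2::nat) ^ lsb y < 2 ^ k" by (rule power_le_k[OF j])
    have AX: "A M (2 * ch + p) = X M p ch" "A M (2 * ch + p') = X M p' ch" by (simp_all add: X_def)
    note sim = D C BZ BY Ty w1 w2 AX pj shift_one[OF j] x_def[symmetric]
    show ?thesis
    proof (cases "x = 0")
      case x0: True
      have no: "v div t \<noteq> ch" if "v \<in> F" for v
      proof
        assume "v div t = ch"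
        then have "ch * t + v mod t \<in> F" using that by (metis div_mult_mod_eq)
        then show False using x[of "v mod t"] t x0 by simp
      qed
      have "bit (Y M p (ch div t)) (ch mod t)"
        using bit_lsb[OF False] by (simp add: chS y_def)
      note cl = store_clear[OF st ch this no, unfolded chS]
      show ?thesis
        unfolding pick_def
        apply (simp add: sim)
        apply (rule getB_wp)
            apply (use i1 in \<open>simp_all add: sim\<close>)
        apply (rule getB_wp)
            apply (use i1 in \<open>simp_all add: sim False\<close>)
        apply (rule getB_wp)
            apply (use i1 in \<open>simp_all add: sim\<close>)
        apply (rule getA_wp)
            apply (use i2 in \<open>simp_all add: sim\<close>)
        apply (rule getA_wp)
            apply (use i2 in \<open>simp_all add: sim x0\<close>)
        apply (rule xorB_wp)
              apply (use i1 in \<open>simp_all add: sim\<close>)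
        apply (rule advance[of _ _ c])
           apply (use cl in simp_all)
        done
    next
      case x0: False
      define v where "v = ch * t + lsb x"
      have j2: "lsb x < t" by (rule lsb_less[OF x0 x_less])
      have v: "v \<in> F" using x[OF j2] bit_lsb[OF x0] by (simp add: v_def)
      then have "v < n" using D(15) by auto
      have vch: "v div t = ch" "v mod t = lsb x" using j2 by (simp_all add: v_def)
      have w3: "ch * t mod 2 ^ w = ch * t" "(ch * t + lsb x) mod 2 ^ w = v"
          "Suc (Suc v) mod 2 ^ w = Suc (Suc v)" "v mod 2 ^ w = v"
        using \<open>v < n\<close> fit(3) by (auto simp: v_def)
      have Tx: "B M (x + tb) = lsb x"
        by (rule table_lookup[OF D(3) x0 x_less])
      note vi = store_visit[OF st v, unfolded vch]
      show ?thesis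
        unfolding pick_def
        apply (simp add: sim)
        apply (rule getB_wp)
            apply (use i1 in \<open>simp_all add: sim\<close>)
        apply (rule getB_wp)
            apply (use i1 in \<open>simp_all add: sim False\<close>)
        apply (rule getB_wp)
            apply (use i1 in \<open>simp_all add: sim\<close>)
        apply (rule getA_wp)
            apply (use i2 in \<open>simp_all add: sim\<close>)
        apply (rule getA_wp)
            apply (use i2 in \<open>simp_all add: sim x0\<close>)
        apply (rule getB_wp)
            apply (use i2 in \<open>simp_all add: sim Tx shift_one[OF j2]\<close>)
        apply (rule xorA_wp)
              apply (use i2 j2 \<open>v < n\<close> n_inp in \<open>simp_all add: sim w3\<close>)
        apply (rule visit[OF v])
           apply (use vi in simp_all)
        done
    qed
  qed
qed

end

section \<open>The main loop and its measure\<close>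

definition adjacency :: "nat list \<Rightarrow> nat \<Rightarrow> nat rel \<Rightarrow> bool" where
  "adjacency inp n E \<longleftrightarrow> n + 2 \<le> length inp \<and> E \<subseteq> {..<n} \<times> {..<n} \<and>
     (\<forall>v<n. \<exists>xs. linked_list inp (inp ! (v + 2)) xs \<and> distinct xs \<and> set xs = E `` {v})"

lemma bfs_work_init:
  assumes "E \<subseteq> {..<n} \<times> {..<n}"
  shows "bfs_work E {..<n} [] [] = card E + n"
proof -
  have "E = (SIGMA v:{..<n}. E `` {v})" using assms by auto
  moreover have "finite (E `` {v})" for v
    by (rule finite_subset[of _ "{..<n}"]) (use assms in auto)
  ultimately have "card E = (\<Sum>v<n. card (E `` {v}))"
    by (metis card_SigmaI finite_lessThan)
  then show ?thesis by (simp only: bfs_work_def sum.distrib) simp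
qed

context layout
begin

text \<open>
  A new frontier vertex adds at most one summary bit and one stack entry, which counts twice in
  \<open>pot\<close> as long as it belongs to the next level, because it pays for the change of level. The weight
  4 of the unvisited vertices covers this.
\<close>

definition search_inv :: "nat list \<Rightarrow> nat rel \<Rightarrow> nat \<Rightarrow> nat \<Rightarrow> state \<Rightarrow> bool" where
  "search_inv inp E s N \<sigma> \<longleftrightarrow> (\<exists>R M out l p p' c c' F F' pend. \<sigma> = (R, M, out) \<and>
     store R M p p' c c' F F' (set out) \<and> bfs_inv E s l out F F' pend \<and>
     linked_list inp (R rPtr) pend \<and> set pend \<subseteq> {..<n} \<and>
     (R rGo = 0 \<longrightarrow> F = {} \<and> F' = {} \<and> pend = []) \<and>
     N = bfs_work E {..<n} out pend + 4 * card ({..<n} - (F \<union> F' \<union> set out)) + pot M p p' c c' +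
       (if R rGo = 0 then 0 else 1))"

lemma search_invI:
  assumes "store R M p p' c c' F F' (set out)" "bfs_inv E s l out F F' pend"
    "linked_list inp (R rPtr) pend" "set pend \<subseteq> {..<n}"
    "R rGo = 0 \<Longrightarrow> F = {} \<and> F' = {} \<and> pend = []"
    "bfs_work E {..<n} out pend + 4 * card ({..<n} - (F \<union> F' \<union> set out)) + pot M p p' c c' +
       (if R rGo = 0 then 0 else 1) < N"
  shows "\<exists>N'<N. search_inv inp E s N' (R, M, out)"
  unfolding search_inv_def
  by (rule exI, rule conjI, rule assms(6), intro exI, rule conjI, rule refl, rule conjI,
      rule assms(1), rule conjI, rule assms(2), rule conjI, rule assms(3), rule conjI,
      rule assms(4), rule conjI, rule impI, erule assms(5), rule refl)

text \<open>Reading a list cell shortens \<open>pend\<close>, and a new vertex trades 4 units for at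
  most 3 of potential. A visit lowers \<open>bfs_work\<close>, cleaning up lowers
  \<open>pot\<close>, and a change of level releases stack weight or resets
  \<open>rGo\<close>.\<close>

lemma search_body_wp:
  assumes inv: "search_inv inp E s N \<sigma>" and go: "holds (Lt rZ rGo) \<sigma>"
    and adj: "adjacency inp n E" and inp: "length inp \<le> 2 ^ w"
  shows "wp w inp search_body (\<lambda>\<sigma>'. \<exists>N'<N. search_inv inp E s N' \<sigma>') \<sigma>"
proof -
  let ?I = "\<lambda>\<sigma>'. \<exists>N'<N. search_inv inp E s N' \<sigma>'"
  from inv obtain R M out l p p' c c' F F' pend where \<sigma>: "\<sigma> = (R, M, out)"
    and st: "store R M p p' c c' F F' (set out)" and bfs: "bfs_inv E s l out F F' pend"
    and ptr: "linked_list inp (R rPtr) pend" and pend: "set pend \<subseteq> {..<n}"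
    and N: "N = bfs_work E {..<n} out pend + 4 * card ({..<n} - (F \<union> F' \<union> set out)) +
      pot M p p' c c' + (if R rGo = 0 then 0 else 1)"
    unfolding search_inv_def by blast
  note D = storeD[OF st]
  note C = const_regsD[OF D(1)]
  have go': "R rGo \<noteq> 0" using go by (simp add: \<sigma> C)
  show ?thesis
  proof (cases "R rPtr = 0")
    case True
    with ptr have [simp]: "pend = []" by (simp add: linked_list_0)
    have "n + 2 \<le> length inp" using adj by (simp add: adjacency_def)
    have "wp w inp pick ?I (R, M, out)"
    proof (rule pick_wp[OF st \<open>n + 2 \<le> length inp\<close>])
      fix R' assume a: "c = 0" "store R' M p' p c' 0 F' {} (set out)" "F = {}"
        "pot M p' p c' 0 + c' = pot M p p' 0 c'" "R' rPtr = R rPtr" "R' rGo = c'"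
      show "?I (R', M, out)"
      proof (rule search_invI)
        show "bfs_inv E s (Suc l) out F' {} []" using bfs a(3) bfs_inv_next_level by simp
        show "F' = {} \<and> {} = {} \<and> [] = []" if "R' rGo = 0"
          \<comment> \<open>\<open>rGo\<close> equals the size of the stack of \<open>F'\<close>,
            and an empty stack means an empty frontier.\<close>
          using frontier_empty(1)[OF storeD(10)[OF st[unfolded a(6)[symmetric] that]]] by simp
      qed (use a go' True in \<open>auto simp: N linked_list_0 Un_ac\<close>)
    next
      fix R' M' i assume a: "store R' M' p p' i c' F F' (set out)"
        "Suc (pot M' p p' i c') = pot M p p' c c'" "R' rPtr = R rPtr" "R' rGo = R rGo"
      show "?I (R', M', out)"
        by (rule search_invI[OF a(1) bfs]) (use a(2-4) go' ptr pend in \<open>simp_all add: N\<close>)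
    next
      fix R' M' v assume a: "v \<in> F" "store R' M' p p' c c' (F - {v}) F' (insert v (set out))"
        "pot M' p p' c c' = pot M p p' c c'" "R' rPtr = inp ! (v + 2)" "R' rGo = R rGo"
      have v: "v < n" "v \<notin> set out" using D(13,15) a(1) by auto
      obtain xs where xs: "linked_list inp (inp ! (v + 2)) xs" "distinct xs" "set xs = E `` {v}"
        using adj v(1) unfolding adjacency_def by blast
      show "?I (R', M', out @ [v])"
      proof (rule search_invI)
        show "store R' M' p p' c c' (F - {v}) F' (set (out @ [v]))" using a(2) by simp
        show "bfs_inv E s l (out @ [v]) (F - {v}) F' xs"
          using bfs a(1) xs(3) by (intro bfs_inv_visit) simp_all
        show "linked_list inp (R' rPtr) xs" using xs(1) a(4) by simp
        show "set xs \<subseteq> {..<n}" using adj xs(3) by (auto simp: adjacency_def)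
        have "F - {v} \<union> F' \<union> set (out @ [v]) = F \<union> F' \<union> set out" using a(1) by auto
        then show "bfs_work E {..<n} (out @ [v]) xs +
            4 * card ({..<n} - (F - {v} \<union> F' \<union> set (out @ [v]))) + pot M' p p' c c' +
            (if R' rGo = 0 then 0 else 1) < N"
          using bfs_work_visit[of "{..<n}" v out xs E] v xs a(3,5) by (simp add: N)
      qed (use a(5) go' in simp)
    qed
    then show ?thesis by (simp add: search_body_def \<sigma> True C)
  next
    case False
    with ptr obtain ys where ys: "pend = inp ! R rPtr # ys" "Suc (R rPtr) < length inp"
        "linked_list inp (inp ! Suc (R rPtr)) ys" by (rule linked_list_Cons)
    define u where "u = inp ! R rPtr"
    have u: "u < n" using pend ys(1) by (simp add: u_def)
    define R1 where "R1 = R(rU := u, rPtr := inp ! Suc (R rPtr))"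
    have R1: "R1 rU = u" "R1 rPtr = inp ! Suc (R rPtr)" "R1 rGo = R rGo" by (simp_all add: R1_def)
    have st1: "store R1 M p p' c c' F F' (set out)" using st by (simp add: R1_def)
    have work: "bfs_work E {..<n} out pend = Suc (bfs_work E {..<n} out ys)"
      by (simp add: ys(1) bfs_work_def)
    note b = bfs[unfolded ys(1), folded u_def]
    have "wp w inp mark ?I (R1, M, out)"
    proof (rule mark_wp[OF st1 R1(1) u])
      fix R' M' c''
      assume a: "store R' M' p p' c c'' F (if u \<in> F \<union> F' \<union> set out then F' else insert u F') (set out)"
        "R' rPtr = R1 rPtr" "R' rGo = R1 rGo"
        "pot M' p p' c c'' \<le> pot M p p' c c' + (if u \<in> F \<union> F' \<union> set out then 0 else 3)"
      show "?I (R', M', out)"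
      proof (rule search_invI[OF a(1)])
        show "bfs_inv E s l out F (if u \<in> F \<union> F' \<union> set out then F' else insert u F') ys"
        proof (cases "u \<in> F \<union> F' \<union> set out")
          case True
          then show ?thesis using bfs_inv_skip[OF b] by auto
        next
          case False
          then show ?thesis using bfs_inv_add[OF b] by auto
        qed
        show "linked_list inp (R' rPtr) ys" using a(2) R1(2) ys(3) by simp
        show "set ys \<subseteq> {..<n}" using pend ys(1) by simp
        show "bfs_work E {..<n} out ys +
            4 * card ({..<n} - (F \<union> (if u \<in> F \<union> F' \<union> set out then F' else insert u F') \<union> set out)) +
            pot M' p p' c c'' + (if R' rGo = 0 then 0 else 1) < N"
        proof (cases "u \<in> F \<union> F' \<union> set out")
          case True
          then show ?thesis using a(3,4) R1(3) go' work by (simp add: N)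
        next
          case False
          let ?W = "{..<n} - (F \<union> insert u F' \<union> set out)"
          have "{..<n} - (F \<union> F' \<union> set out) = insert u ?W"
            using False u by auto
          moreover have "card (insert u ?W) = Suc (card ?W)"
            by (rule card_insert_disjoint) auto
          ultimately have "card ({..<n} - (F \<union> F' \<union> set out)) =
              Suc (card ?W)" by (simp only:)
          then show ?thesis using False a(3,4) R1(3) go' work by (simp add: N)
        qed
      qed (use a(3) R1(3) go' in simp)
    qed
    moreover have "Suc (R rPtr) mod 2 ^ w = Suc (R rPtr)" using ys(2) inp by simp
    ultimately show ?thesis
      using False ys(2) by (simp add: search_body_def \<sigma> C R1_def u_def fun_upd_twist)
  qed
qed

lemma search_loop_runs:
  assumes "search_inv inp E s N \<sigma>" "adjacency inp n E" "length inp \<le> 2 ^ w"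
  shows "runs w inp (Loop (Lt rZ rGo) search_body) (N * (csize search_body + 2) + 2)
    (\<lambda>(R, M, out). \<exists>l. bfs_inv E s l out {} {} []) \<sigma>"
proof (rule runs_Loop[where I = "search_inv inp E s"])
  show "runs w inp search_body (csize search_body) (\<lambda>\<sigma>'. \<exists>N'<N. search_inv inp E s N' \<sigma>') \<sigma>"
    if "search_inv inp E s N \<sigma>" "holds (Lt rZ rGo) \<sigma>" for N \<sigma>
    using that assms(2,3) by (intro runs_wp search_body_wp)
  show "case \<sigma> of (R, M, out) \<Rightarrow> \<exists>l. bfs_inv E s l out {} {} []"
    if "search_inv inp E s N \<sigma>" "\<not> holds (Lt rZ rGo) \<sigma>" for N \<sigma>
    using that const_regsD(1)[OF storeD(1)] unfolding search_inv_def by fastforce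
qed (rule assms(1))

end

section \<open>Small graphs\<close>

text \<open>
  If \<open>n\<close> is small, \<open>2 ^ w\<close> addresses may be too few for the data structure above; then a plain queue
  in \<open>n\<close> words, which also serves as the set of visited vertices, is enough.
\<close>

definition member :: com where
  "member = Loop (Lt 28 rCntN)
     (Do (Load 29 28) ;; Branch (Eq 29 rU) (ADD 27 r1 rZ) skip ;; ADD 28 28 r1)"

text \<open>\<open>rCntC\<close>, \<open>rCur\<close> and \<open>rCntN\<close> are the head of the
  queue, the end of the current level and the end of the queue. Recording the boundary between
  levels allows \<open>bfs_inv\<close> to be used again.\<close>

definition queue_body :: com where
  "queue_body =
     Branch (Eq rPtr rZ)
       (Branch (Eq rCntC rCur)
         (ADD rCur rCntN rZ ;; Branch (Eq rCntC rCntN) (ADD rGo rZ rZ) skip)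
         (Do (Load 26 rCntC) ;; ADD rCntC rCntC r1 ;; Do (Write 26) ;;
          ADD 26 26 r1 ;; ADD 26 26 r1 ;; Do (Read rPtr 26)))
       ((Do (Read rU rPtr) ;; ADD rPtr rPtr r1 ;; Do (Read rPtr rPtr) ;;
         ADD 27 rZ rZ ;; ADD 28 rZ rZ) ;;
        member ;;
        Branch (Eq 27 rZ) (Do (Store rCntN rU) ;; ADD rCntN rCntN r1) skip)"

lemma member_runs:
  assumes regs: "R rZ = 0" "R r1 = 1" "R 27 = 0" "R 28 = 0" "R rCntN \<le> length M" "length M < 2 ^ w"
  shows "runs w inp member (R rCntN * 9 + 2)
    (\<lambda>(R', M', out'). M' = M \<and> out' = out \<and> (\<forall>a. a \<notin> {23, 27, 28, 29} \<longrightarrow> R' a = R a) \<and>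
      (R' 27 = 0 \<longleftrightarrow> R rU \<notin> set (take (R rCntN) M))) (R, M, out)"
proof -
  let ?J = "\<lambda>R'. (\<forall>a. a \<notin> {23, 27, 28, 29} \<longrightarrow> R' a = R a) \<and> R' 28 \<le> R rCntN \<and>
    (R' 27 = 0 \<longleftrightarrow> R rU \<notin> set (take (R' 28) M))"
  let ?I = "\<lambda>N (R', M', out'). M' = M \<and> out' = out \<and> ?J R' \<and> N = R rCntN - R' 28"
  have "runs w inp member (R rCntN * (7 + 2) + 2)
    (\<lambda>(R', M', out'). M' = M \<and> out' = out \<and> (\<forall>a. a \<notin> {23, 27, 28, 29} \<longrightarrow> R' a = R a) \<and>
      (R' 27 = 0 \<longleftrightarrow> R rU \<notin> set (take (R rCntN) M))) (R, M, out)"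
    unfolding member_def
  proof (rule runs_Loop[where I = ?I])
    show "?I (R rCntN) (R, M, out)" using regs by simp
  next
    fix N \<sigma> assume I: "?I N \<sigma>" and h: "holds (Lt 28 rCntN) \<sigma>"
    obtain R' where \<sigma>: "\<sigma> = (R', M, out)" and J: "?J R'" and N: "N = R rCntN - R' 28"
      using I by (cases \<sigma>) auto
    have e: "R' rCntN = R rCntN" "R' rZ = 0" "R' r1 = 1" "R' rU = R rU" using J regs by simp_all
    have i: "R' 28 < R rCntN" using h e by (simp add: \<sigma>)
    then have "R' 28 < length M" "Suc (R' 28) < 2 ^ w"
      using regs(5,6) by linarith+
    then have im: "R' 28 < length M" "Suc (R' 28) mod 2 ^ w = Suc (R' 28)" "0 < w"
      by (simp, simp, cases "w = 0", simp_all)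
    have tk: "take (Suc (R' 28)) M = take (R' 28) M @ [M ! R' 28]"
      using im by (simp add: take_Suc_conv_app_nth)
    let ?c = "Do (Load 29 28) ;; Branch (Eq 29 rU) (ADD 27 r1 rZ) skip ;; ADD 28 28 r1"
    have "wp w inp ?c (\<lambda>\<sigma>'. \<exists>N'<N. ?I N' \<sigma>') \<sigma>"
      using J i im e unfolding \<sigma> skip_def by (auto simp: N tk)
    then have "runs w inp ?c (csize ?c) (\<lambda>\<sigma>'. \<exists>N'<N. ?I N' \<sigma>') \<sigma>" by (rule runs_wp)
    then show "runs w inp ?c 7 (\<lambda>\<sigma>'. \<exists>N'<N. ?I N' \<sigma>') \<sigma>"
      by (rule runs_weaken) (simp_all add: skip_def)
  next
    fix N \<sigma> assume I: "?I N \<sigma>" and h: "\<not> holds (Lt 28 rCntN) \<sigma>"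
    obtain R' where \<sigma>: "\<sigma> = (R', M, out)" and J: "?J R'" using I by (cases \<sigma>) auto
    have "R' rCntN = R rCntN" using J by simp
    then have "R' 28 = R rCntN" using J h by (simp add: \<sigma>)
    then show "case \<sigma> of (R', M', out') \<Rightarrow> M' = M \<and> out' = out \<and>
        (\<forall>a. a \<notin> {23, 27, 28, 29} \<longrightarrow> R' a = R a) \<and> (R' 27 = 0 \<longleftrightarrow> R rU \<notin> set (take (R rCntN) M))"
      using J by (simp add: \<sigma>)
  qed
  then show ?thesis by simp
qed

text \<open>In the measure, an undiscovered vertex passes its unit to \<open>ns\<close> when it is
  enqueued. A change of level spends the length of \<open>ns\<close>, or the unit of
  \<open>rGo\<close> if \<open>ns\<close> is empty.\<close>

definition queue_inv :: "nat \<Rightarrow> nat list \<Rightarrow> nat rel \<Rightarrow> nat \<Rightarrow> nat \<Rightarrow> state \<Rightarrow> bool" where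
  "queue_inv n inp E s N \<sigma> \<longleftrightarrow> (\<exists>R M out l cs ns pend. \<sigma> = (R, M, out) \<and>
     R rZ = 0 \<and> R r1 = 1 \<and> length M = n \<and>
     R rCntC = length out \<and> R rCur = length (out @ cs) \<and> R rCntN = length (out @ cs @ ns) \<and>
     take (R rCntN) M = out @ cs @ ns \<and> distinct (out @ cs @ ns) \<and> set (out @ cs @ ns) \<subseteq> {..<n} \<and>
     bfs_inv E s l out (set cs) (set ns) pend \<and>
     linked_list inp (R rPtr) pend \<and> set pend \<subseteq> {..<n} \<and>
     (R rGo = 0 \<longrightarrow> cs = [] \<and> ns = [] \<and> pend = []) \<and>
     N = bfs_work E {..<n} out pend + card ({..<n} - set (out @ cs @ ns)) + length ns +
       (if R rGo = 0 then 0 else 1))"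

lemma queue_invI:
  assumes "R rZ = 0" "R r1 = 1" "length M = n"
    "R rCntC = length out" "R rCur = length (out @ cs)" "R rCntN = length (out @ cs @ ns)"
    "take (R rCntN) M = out @ cs @ ns" "distinct (out @ cs @ ns)" "set (out @ cs @ ns) \<subseteq> {..<n}"
    "bfs_inv E s l out (set cs) (set ns) pend" "linked_list inp (R rPtr) pend" "set pend \<subseteq> {..<n}"
    "R rGo = 0 \<Longrightarrow> cs = [] \<and> ns = [] \<and> pend = []"
    "bfs_work E {..<n} out pend + card ({..<n} - set (out @ cs @ ns)) + length ns +
       (if R rGo = 0 then 0 else 1) < N"
  shows "\<exists>N'<N. queue_inv n inp E s N' (R, M, out)"
  unfolding queue_inv_def
  by (rule exI, rule conjI, rule assms(14), intro exI, rule conjI, rule refl,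
      rule conjI, rule assms(1), rule conjI, rule assms(2), rule conjI, rule assms(3), rule conjI, rule assms(4), rule conjI, rule assms(5), rule conjI, rule assms(6), rule conjI, rule assms(7), rule conjI, rule assms(8), rule conjI, rule assms(9), rule conjI, rule assms(10), rule conjI, rule assms(11), rule conjI, rule assms(12),
      rule conjI, rule impI, erule assms(13), rule refl)

lemma length_le_if_distinct:
  assumes "distinct xs" "set xs \<subseteq> {..<n}"
  shows "length xs \<le> n"
  using card_mono[OF _ assms(2)] distinct_card[OF assms(1)] by simp

lemma queue_body_runs:
  assumes inv: "queue_inv n inp E s N \<sigma>" and go: "holds (Lt rZ rGo) \<sigma>"
    and adj: "adjacency inp n E" and inp: "length inp \<le> 2 ^ w"
  shows "runs w inp queue_body (n * 9 + csize queue_body) (\<lambda>\<sigma>'. \<exists>N'<N. queue_inv n inp E s N' \<sigma>') \<sigma>"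
proof -
  let ?I = "\<lambda>\<sigma>'. \<exists>N'<N. queue_inv n inp E s N' \<sigma>'"
  from inv obtain R M out l cs ns pend where \<sigma>: "\<sigma> = (R, M, out)"
    and C: "R rZ = 0" "R r1 = 1" "length M = n"
      "R rCntC = length out" "R rCur = length (out @ cs)" "R rCntN = length (out @ cs @ ns)"
    and M: "take (R rCntN) M = out @ cs @ ns" "distinct (out @ cs @ ns)" "set (out @ cs @ ns) \<subseteq> {..<n}"
    and bfs: "bfs_inv E s l out (set cs) (set ns) pend"
    and ptr: "linked_list inp (R rPtr) pend" and pend: "set pend \<subseteq> {..<n}"
    and N: "N = bfs_work E {..<n} out pend + card ({..<n} - set (out @ cs @ ns)) + length ns +
      (if R rGo = 0 then 0 else 1)"
    unfolding queue_inv_def by blast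
  have go': "R rGo \<noteq> 0" using go by (simp add: \<sigma> C)
  have nw: "n + 2 \<le> length inp" "n + 2 \<le> 2 ^ w" using adj inp by (auto simp: adjacency_def)
  have len: "length (out @ cs @ ns) \<le> n" by (rule length_le_if_distinct[OF M(2,3)])
  show ?thesis
  proof (cases "R rPtr = 0")
    case ptr0: True
    with ptr have p [simp]: "pend = []" by (simp add: linked_list_0)
    let ?c1 = "Branch (Eq rCntC rCur)
         (ADD rCur rCntN rZ ;; Branch (Eq rCntC rCntN) (ADD rGo rZ rZ) skip)
         (Do (Load 26 rCntC) ;; ADD rCntC rCntC r1 ;; Do (Write 26) ;;
          ADD 26 26 r1 ;; ADD 26 26 r1 ;; Do (Read rPtr 26))"
    have "wp w inp ?c1 ?I (R, M, out)"
    proof (cases cs)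
      case Nil
      have nxt: "?I (R', M, out)" if "R' rGo = (if ns = [] then 0 else R rGo)"
        "\<forall>a\<in>{rZ, r1, rCntC, rCntN, rPtr}. R' a = R a" "R' rCur = R rCntN" for R'
      proof (rule queue_invI[where cs = ns and ns = "[]"])
        show "bfs_inv E s (Suc l) out (set ns) (set []) []"
          using bfs Nil by (simp add: bfs_inv_next_level)
      qed (use that C M Nil go' ptr in \<open>simp_all add: N split: if_splits\<close>)
      show ?thesis
      proof (cases ns)
        case Nil': Nil
        show ?thesis
          by (use len nw in \<open>simp add: C Nil Nil'\<close>) (rule nxt, simp_all add: C Nil Nil')
      next
        case (Cons a list)
        show ?thesis
          by (use len nw in \<open>simp add: C Nil Cons skip_def\<close>) (rule nxt, simp_all add: C Nil Cons)
      qed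
    next
      case (Cons v cs')
      have lo: "length out < length M" using len Cons C(3) by simp
      have v: "M ! length out = v"
      proof -
        have "M ! length out = take (R rCntN) M ! length out"
          using Cons by (simp add: C)
        then show ?thesis by (simp add: M(1) Cons)
      qed
      have vn: "v < n" "v \<notin> set out" using M Cons by auto
      obtain xs where xs: "linked_list inp (inp ! (v + 2)) xs" "distinct xs" "set xs = E `` {v}"
        using adj vn(1) unfolding adjacency_def by blast
      have visit: "?I (R', M, out @ [v])" if "\<forall>a\<in>{rZ, r1, rGo, rCur, rCntN}. R' a = R a"
        "R' rCntC = Suc (length out)" "R' rPtr = inp ! (v + 2)" for R'
      proof (rule queue_invI[where cs = cs' and ns = ns])
        have "set cs - {v} = set cs'" using M(2) Cons by auto
        then show "bfs_inv E s l (out @ [v]) (set cs') (set ns) xs"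
          using bfs_inv_visit[of E s l out "set cs" "set ns" v xs] bfs xs(3) Cons by simp
        show "linked_list inp (R' rPtr) xs" using xs(1) that(3) by simp
        show "set xs \<subseteq> {..<n}" using adj xs(3) by (auto simp: adjacency_def)
        show "bfs_work E {..<n} (out @ [v]) xs + card ({..<n} - set ((out @ [v]) @ cs' @ ns)) +
            length ns + (if R' rGo = 0 then 0 else 1) < N"
          using bfs_work_visit[of "{..<n}" v out xs E] vn xs that(1) by (simp add: N Cons)
      qed (use that C M Cons go' in simp_all)
      have "v + 2 < 2 ^ w" "v + 2 < length inp" "length out + 1 < 2 ^ w"
        using vn(1) nw lo C(3) by simp_all
      then show ?thesis
        using lo by (simp add: C Cons v) (rule visit, simp_all)
    qed
    from runs_wp[OF this] have "runs w inp ?c1 (n * 9 + csize queue_body - 2) ?I (R, M, out)"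
      by (rule runs_weaken) (simp_all add: queue_body_def skip_def)
    then have "runs w inp queue_body (n * 9 + csize queue_body - 2 + 2) ?I (R, M, out)"
      unfolding queue_body_def by (intro runs_Branch) (simp_all add: ptr0 C)
    then show ?thesis unfolding \<sigma> by (rule runs_weaken) (simp_all add: queue_body_def)
  next
    case False
    with ptr obtain ys where ys: "pend = inp ! R rPtr # ys" "Suc (R rPtr) < length inp"
        "linked_list inp (inp ! Suc (R rPtr)) ys" by (rule linked_list_Cons)
    define u where "u = inp ! R rPtr"
    have u: "u < n" using pend ys(1) by (simp add: u_def)
    have work: "bfs_work E {..<n} out pend = Suc (bfs_work E {..<n} out ys)"
      by (simp add: ys(1) bfs_work_def)
    let ?c1 = "Do (Read rU rPtr) ;; ADD rPtr rPtr r1 ;; Do (Read rPtr rPtr) ;;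
         ADD 27 rZ rZ ;; ADD 28 rZ rZ"
    let ?c2 = "Branch (Eq 27 rZ) (Do (Store rCntN rU) ;; ADD rCntN rCntN r1) skip"
    let ?R1 = "R(rU := u, rPtr := inp ! Suc (R rPtr), 27 := 0, 28 := 0)"
    have c2: "wp w inp ?c2 ?I (R2, M, out)"
      if R2: "\<forall>a. a \<notin> {23, 27, 28, 29} \<longrightarrow> R2 a = ?R1 a"
        "R2 27 = 0 \<longleftrightarrow> u \<notin> set (out @ cs @ ns)" for R2
    proof -
      have C2: "R2 rZ = 0" "R2 r1 = 1" "R2 rCntC = length out" "R2 rCur = length (out @ cs)"
        "R2 rCntN = length (out @ cs @ ns)" "R2 rU = u" "R2 rPtr = inp ! Suc (R rPtr)"
        "R2 rGo = R rGo"
        using R2(1) C by simp_all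
      show ?thesis
      proof (cases "u \<in> set (out @ cs @ ns)")
        case True
        have "bfs_inv E s l out (set cs) (set ns) ys"
          using bfs_inv_skip[OF bfs[unfolded ys(1)]] True by (auto simp: u_def)
        from queue_invI[where R = "R2(23 := 0)", OF _ _ _ _ _ _ _ _ _ this, of M n]
        have "?I (R2(23 := 0), M, out)"
          using C C2 M ys(3) pend[unfolded ys(1)] go' work by (simp add: N)
        moreover have "R2 27 \<noteq> 0" using R2(2) True by simp
        ultimately show ?thesis by (simp add: C2 skip_def)
      next
        case new: False
        have len': "length (out @ cs @ ns @ [u]) \<le> n"
          by (rule length_le_if_distinct) (use M new u in auto)
        have card: "card ({..<n} - set (out @ cs @ ns)) = Suc (card ({..<n} - set (out @ cs @ ns @ [u])))"
        proof -
          let ?W = "{..<n} - set (out @ cs @ ns @ [u])"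
          have "{..<n} - set (out @ cs @ ns) = insert u ?W"
            using new u by auto
          moreover have "card (insert u ?W) = Suc (card ?W)"
            by (rule card_insert_disjoint) auto
          ultimately show ?thesis by (simp only:)
        qed
        let ?e = "length (out @ cs @ ns)"
        have "bfs_inv E s l out (set cs) (insert u (set ns)) ys"
          using bfs_inv_add[OF bfs[unfolded ys(1), folded u_def]] new by simp
        then have bfs': "bfs_inv E s l out (set cs) (set (ns @ [u])) ys" by simp
        have tk: "take (Suc ?e) (M[?e := u]) = out @ cs @ ns @ [u]"
          using M(1) len' by (simp add: C take_Suc_conv_app_nth)
        have "?I (R2(rCntN := Suc ?e), M[?e := u], out)"
          by (rule queue_invI[OF _ _ _ _ _ _ _ _ _ bfs'])
            (use C C2 M ys pend go' work new u tk card in \<open>simp_all add: N\<close>)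
        moreover have "R2 27 = 0" using R2(2) new by simp
        moreover have "Suc ?e mod 2 ^ w = Suc ?e" using len' nw by simp
        ultimately show ?thesis using len' C(3) by (simp add: C2)
      qed
    qed
    have "R rCntN \<le> n" using len C by simp
    have "runs w inp (member ;; ?c2) (R rCntN * 9 + 2 + csize ?c2) ?I (?R1, M, out)"
    proof (rule runs_Seq)
      have "length M < 2 ^ w" using C nw by simp
      then have "runs w inp member (?R1 rCntN * 9 + 2)
        (\<lambda>(R', M', out'). M' = M \<and> out' = out \<and> (\<forall>a. a \<notin> {23, 27, 28, 29} \<longrightarrow> R' a = ?R1 a) \<and>
          (R' 27 = 0 \<longleftrightarrow> ?R1 rU \<notin> set (take (?R1 rCntN) M))) (?R1, M, out)"
        using C len by (intro member_runs) simp_all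
      then show "runs w inp member (R rCntN * 9 + 2) (runs w inp ?c2 (csize ?c2) ?I) (?R1, M, out)"
        by (rule runs_weaken) (use c2 M(1) in \<open>auto intro!: runs_wp simp del: wp.simps csize.simps\<close>)
    qed
    moreover have "wp w inp ?c1 (\<lambda>\<sigma>'. \<sigma>' = (?R1, M, out)) (R, M, out)"
      using ys(2) inp by (simp add: C u_def fun_upd_twist)
    from runs_wp[OF this] have "runs w inp ?c1 (csize ?c1)
        (runs w inp (member ;; ?c2) (R rCntN * 9 + 2 + csize ?c2) ?I) (R, M, out)"
      by (rule runs_weaken) (use calculation in simp_all)
    then have "runs w inp (?c1 ;; member ;; ?c2) (csize ?c1 + (R rCntN * 9 + 2 + csize ?c2)) ?I (R, M, out)"
      by (rule runs_Seq)
    then have "runs w inp (?c1 ;; member ;; ?c2) (n * 9 + csize queue_body - 2) ?I (R, M, out)"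
      by (rule runs_weaken) (use \<open>R rCntN \<le> n\<close> in \<open>simp_all add: queue_body_def member_def\<close>)
    then have "runs w inp queue_body (n * 9 + csize queue_body - 2 + 2) ?I (R, M, out)"
      unfolding queue_body_def by (intro runs_Branch) (simp_all add: False C)
    then show ?thesis unfolding \<sigma> by (rule runs_weaken) (simp_all add: queue_body_def)
  qed
qed

lemma queue_loop_runs:
  assumes "queue_inv n inp E s N \<sigma>" "adjacency inp n E" "length inp \<le> 2 ^ w"
  shows "runs w inp (Loop (Lt rZ rGo) queue_body) (N * (n * 9 + csize queue_body + 2) + 2)
    (\<lambda>(R, M, out). \<exists>l. bfs_inv E s l out {} {} []) \<sigma>"
proof (rule runs_Loop[where I = "queue_inv n inp E s"])
  show "runs w inp queue_body (n * 9 + csize queue_body) (\<lambda>\<sigma>'. \<exists>N'<N. queue_inv n inp E s N' \<sigma>') \<sigma>"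
    if "queue_inv n inp E s N \<sigma>" "holds (Lt rZ rGo) \<sigma>" for N \<sigma>
    using that assms(2,3) by (intro queue_body_runs)
  show "case \<sigma> of (R, M, out) \<Rightarrow> \<exists>l. bfs_inv E s l out {} {} []"
    if "queue_inv n inp E s N \<sigma>" "\<not> holds (Lt rZ rGo) \<sigma>" for N \<sigma>
    using that unfolding queue_inv_def by fastforce
qed (rule assms(1))

section \<open>Parameters of the data structure\<close>

text \<open>For \<open>x > 0\<close> this is the integer part of \<open>log 2 x\<close> plus
  1.\<close>

definition bitlen :: "nat \<Rightarrow> nat" where
  "bitlen x = (LEAST j. x < 2 ^ j)"

lemma less_power_bitlen: "x < 2 ^ bitlen x"
  unfolding bitlen_def by (rule LeastI[of _ x]) (rule less_exp)

lemma bitlen_le: "x < 2 ^ j \<Longrightarrow> bitlen x \<le> j"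
  unfolding bitlen_def by (rule Least_le)

lemma bitlen_pos: "0 < x \<Longrightarrow> 0 < bitlen x"
  using less_power_bitlen[of x] by (cases "bitlen x") auto

lemma power_bitlen_le:
  assumes "0 < x"
  shows "2 ^ (bitlen x - 1) \<le> x"
proof (rule ccontr)
  assume "\<not> 2 ^ (bitlen x - 1) \<le> x"
  then have "bitlen x \<le> bitlen x - 1" by (intro bitlen_le) simp
  then show False using bitlen_pos[OF assms] by simp
qed

lemma bitlen_le_self: "bitlen x \<le> x"
  by (intro bitlen_le less_exp)

lemma bitlen_mask: "bitlen (2 ^ m - 1) = m"
proof (rule antisym)
  show "bitlen (2 ^ m - 1) \<le> m" by (rule bitlen_le) simp
  have "(2::nat) ^ m - 1 < 2 ^ bitlen (2 ^ m - 1)" by (rule less_power_bitlen)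
  then have "(2::nat) ^ m \<le> 2 ^ bitlen (2 ^ m - 1)" by linarith
  then show "m \<le> bitlen (2 ^ m - 1)" by simp
qed

definition bitlen_com :: "nat \<Rightarrow> nat \<Rightarrow> com" where
  "bitlen_com a x =
     (ADD a rZ rZ ;; ADD 23 x rZ) ;; Loop (Lt rZ 23) (SHR 23 23 r1 ;; ADD a a r1)"

lemma bitlen_com_runs:
  assumes a: "a \<notin> {rZ, r1, 23, x}" "x \<noteq> 23" and R: "R rZ = 0" "R r1 = 1" "R x < 2 ^ w"
    and Q: "Q (R(23 := 0, a := bitlen (R x)), M, out)"
  shows "runs w inp (bitlen_com a x) (4 * bitlen (R x) + 4) Q (R, M, out)"
proof -
  let ?L = "bitlen (R x)"
  let ?R = "\<lambda>j. R(23 := drop_bit j (R x), a := j)"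
  let ?I = "\<lambda>N \<sigma>. \<exists>j. \<sigma> = (?R j, M, out) \<and> j \<le> ?L \<and> N = ?L - j"
  let ?c = "SHR 23 23 r1 ;; ADD a a r1"
  have Lw: "?L \<le> w" by (rule bitlen_le[OF R(3)])
  have "runs w inp (Loop (Lt rZ 23) ?c) (?L * (csize ?c + 2) + 2) Q (?R 0, M, out)"
  proof (rule runs_Loop[where I = ?I])
    show "?I ?L (?R 0, M, out)" by (intro exI[of _ 0]) simp
  next
    fix N \<sigma> assume "?I N \<sigma>" and h: "holds (Lt rZ 23) \<sigma>"
    then obtain j where j: "\<sigma> = (?R j, M, out)" "j \<le> ?L" "N = ?L - j" by blast
    have "drop_bit j (R x) \<noteq> 0" using h j(1) a R by auto
    then have "\<not> R x < 2 ^ j" by (auto simp: drop_bit_eq_div)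
    then have "j \<noteq> ?L" using less_power_bitlen[of "R x"] by metis
    then have jL: "j < ?L" using j(2) by simp
    then have "Suc j < 2 ^ w" using Lw by (meson Suc_leI le_less_trans less_exp)
    then have "wp w inp ?c (\<lambda>\<sigma>'. \<sigma>' = (?R (Suc j), M, out)) \<sigma>"
      using a R j(1) by (auto simp: drop_bit_Suc drop_bit_drop_bit fun_upd_twist)
    then have "wp w inp ?c (\<lambda>\<sigma>'. \<exists>N'<N. ?I N' \<sigma>') \<sigma>"
    proof (rule wp_mono)
      fix \<sigma>' assume "\<sigma>' = (?R (Suc j), M, out)"
      then have "?I (?L - Suc j) \<sigma>'" using jL Suc_leI by blast
      moreover have "?L - Suc j < N" using jL j(3) by simp
      ultimately show "\<exists>N'<N. ?I N' \<sigma>'" by blast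
    qed
    then show "runs w inp ?c (csize ?c) (\<lambda>\<sigma>'. \<exists>N'<N. ?I N' \<sigma>') \<sigma>" by (rule runs_wp)
  next
    fix N \<sigma> assume "?I N \<sigma>" and h: "\<not> holds (Lt rZ 23) \<sigma>"
    then obtain j where j: "\<sigma> = (?R j, M, out)" "j \<le> ?L" by blast
    have d: "drop_bit j (R x) = 0" using h j(1) a R by auto
    then have "R x < 2 ^ j" by (simp add: drop_bit_eq_div div_eq_0_iff)
    then have "j = ?L" using bitlen_le j(2) by (meson antisym)
    then show "Q \<sigma>" using Q d j(1) by simp
  qed
  note loop = this
  have "wp w inp (ADD a rZ rZ ;; ADD 23 x rZ) (\<lambda>\<sigma>. \<sigma> = (?R 0, M, out)) (R, M, out)"
    using a R by (auto simp: fun_upd_twist)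
  from runs_wp[OF this] have "runs w inp (ADD a rZ rZ ;; ADD 23 x rZ) 2
      (runs w inp (Loop (Lt rZ 23) ?c) (?L * (csize ?c + 2) + 2) Q) (R, M, out)"
    by (rule runs_weaken) (use loop in simp_all)
  then have "runs w inp (bitlen_com a x) (2 + (?L * (csize ?c + 2) + 2)) Q (R, M, out)"
    unfolding bitlen_com_def by (rule runs_Seq)
  then show ?thesis by (rule runs_weaken) simp_all
qed

text \<open>With \<open>k = bitlen n\<close>, \<open>r = bitlen k\<close> and \<open>t\<close> about
  \<open>k / r\<close>, the summaries and stacks take \<open>O(n * k / t^2) = O(n * r^2 / k)\<close>
  bits. The incomplete field at the end of a bitmap word wastes less than \<open>t <= w / r\<close>
  bits of \<open>w\<close>, and \<open>2 ^ t\<close> is at most about the sixth root of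
  \<open>n\<close>. All three are negligible.\<close>

definition "chunk_size n = bitlen n div bitlen (bitlen n)"
definition "superblocks n = n div (chunk_size n * chunk_size n) + 1"
text \<open>Measuring \<open>w\<close> bit by bit takes time proportional to \<open>w\<close>, which
  may exceed \<open>n\<close>; \<open>min w n\<close> is found in \<open>O(n)\<close> steps and
  equals \<open>w\<close> if \<open>w <= n\<close>.\<close>

definition "fieldsA w n = min w n div chunk_size n"
definition "fieldsB w n = min w n div bitlen n"
definition "baseB w n = 2 * (superblocks n * chunk_size n) div fieldsA w n + 1"
definition "table_pos n = 4 * superblocks n"
definition "words w n = baseB w n + (table_pos n + 2 ^ chunk_size n) div fieldsB w n + 1"

text \<open>The induction starts with \<open>30 <= 32\<close>; the inequality fails for
  \<open>r = 5\<close>. \<open>bitlen (bitlen n) >= 6\<close> is what the threshold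
  \<open>32 <= bitlen n\<close> provides.\<close>

lemma five_mult_le_power: "6 \<le> r \<Longrightarrow> 5 * r \<le> 2 ^ (r - 1)" for r :: nat
proof (induction r rule: dec_induct)
  case (step r)
  then have "2 ^ r = 2 * (2::nat) ^ (r - 1)" by (cases r) auto
  then show ?case using step by simp
qed simp

lemma bitlen_bitlen_bounds:
  assumes "32 \<le> bitlen n"
  shows "6 \<le> bitlen (bitlen n)" "5 * bitlen (bitlen n) \<le> bitlen n"
proof -
  let ?k = "bitlen n"
  let ?r = "bitlen ?k"
  show r: "6 \<le> ?r"
  proof (rule ccontr)
    assume "\<not> 6 \<le> ?r"
    then have "(2::nat) ^ ?r \<le> 2 ^ 5" by (intro power_increasing) auto
    then show False using less_power_bitlen[of ?k] assms by simp
  qed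
  have "5 * ?r \<le> 2 ^ (?r - 1)" by (rule five_mult_le_power[OF r])
  also have "\<dots> \<le> ?k" using assms by (intro power_bitlen_le) simp
  finally show "5 * ?r \<le> ?k" .
qed

text \<open>Dividing by \<open>r >= 6\<close> gives the upper bound on \<open>t\<close>, and
  \<open>5 * r <= k\<close> the lower one. Then \<open>t + 5 <= k - 1\<close>, whence the bound on
  \<open>2 ^ t\<close>.\<close>

lemma chunk_size_bounds:
  assumes "32 \<le> bitlen n"
  shows "5 \<le> chunk_size n" "6 * chunk_size n \<le> bitlen n" "32 * 2 ^ chunk_size n \<le> n"
proof -
  let ?k = "bitlen n"
  let ?r = "bitlen ?k"
  let ?t = "chunk_size n"
  note r = bitlen_bitlen_bounds[OF assms]
  have "?t * ?r \<le> ?k" by (simp add: chunk_size_def)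
  moreover have "?t * 6 \<le> ?t * ?r" using r(1) by (intro mult_left_mono) auto
  ultimately show t6: "6 * ?t \<le> ?k" by linarith
  show "5 \<le> ?t"
    using r unfolding chunk_size_def by (subst less_eq_div_iff_mult_less_eq) auto
  have "32 * (2::nat) ^ ?t = 2 ^ (?t + 5)" by (simp add: power_add)
  also have "\<dots> \<le> 2 ^ (?k - 1)" using t6 assms by (intro power_increasing) auto
  also have "\<dots> \<le> n"
  proof (rule power_bitlen_le)
    show "0 < n" using assms bitlen_le_self[of n] by simp
  qed
  finally show "32 * 2 ^ ?t \<le> n" .
qed

lemma layout_words:
  assumes k: "32 \<le> bitlen n" and w: "n + 2 \<le> 2 ^ w"
  shows "layout w n (bitlen n) (chunk_size n) (fieldsA w n) (fieldsB w n) (superblocks n)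
      (baseB w n) (table_pos n) (words w n)"
    and "words w n \<le> n" "2 ^ chunk_size n \<le> n" "table_pos n + 2 ^ chunk_size n \<le> n"
proof -
  define k where "k = bitlen n"
  define t where "t = chunk_size n"
  define P :: nat where "P = 2 ^ t"
  define y where "y = n div (t * t)"
  note tb = chunk_size_bounds[OF assms(1), folded k_def t_def, folded P_def]
  have NS: "superblocks n = y + 1" by (simp add: superblocks_def t_def y_def)
  have tP: "t < P" by (simp add: P_def less_exp)
  have P32: "32 \<le> P" using power_increasing[OF tb(1), of "2::nat"] by (simp add: P_def)
  have yt: "y * (t * t) \<le> n" unfolding y_def by simp
  have "y * t * 5 \<le> y * t * t" using tb(1) by (intro mult_left_mono) auto
  moreover have "y * (t * t) = y * t * t" by simp
  ultimately have x5: "5 * (y * t) \<le> n" using yt by linarith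
  have "y * 25 \<le> y * (t * t)" using mult_le_mono[OF tb(1) tb(1)] by (intro mult_left_mono) auto
  then have y25: "25 * y \<le> n" using yt by linarith
  have kw: "k \<le> w" unfolding k_def by (rule bitlen_le) (use w in simp)
  have kn: "k \<le> n" unfolding k_def by (rule bitlen_le_self)
  have nk: "n < 2 ^ k" unfolding k_def by (rule less_power_bitlen)
  have kP: "0 < k" "0 < t" using k tb(1) by (simp_all add: k_def)
  have kmin: "k \<le> min w n" using kw kn by simp
  have tk: "t \<le> k" using tb(2) by simp
  have q: "0 < fieldsA w n" "fieldsA w n * t \<le> w"
  proof -
    show "0 < fieldsA w n"
      unfolding fieldsA_def t_def[symmetric] using kmin tk kP by (simp add: div_greater_zero_iff)
    have "min w n div t * t \<le> min w n" by (rule div_times_less_eq_dividend)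
    then show "fieldsA w n * t \<le> w" by (simp add: fieldsA_def t_def)
  qed
  have Q: "0 < fieldsB w n" "fieldsB w n * k \<le> w"
  proof -
    show "0 < fieldsB w n"
      unfolding fieldsB_def k_def[symmetric] using kmin kP by (simp add: div_greater_zero_iff)
    have "min w n div k * k \<le> min w n" by (rule div_times_less_eq_dividend)
    then show "fieldsB w n * k \<le> w" by (simp add: fieldsB_def k_def)
  qed
  define a where "a = 2 * ((y + 1) * t)"
  define c where "c = 4 * (y + 1) + P"
  have a: "a = 2 * (y * t) + 2 * t" by (simp add: a_def algebra_simps)
  have "a div fieldsA w n \<le> a" "c div fieldsB w n \<le> c" by simp_all
  moreover have words: "words w n = (a div fieldsA w n + 1) + c div fieldsB w n + 1"
    "baseB w n = a div fieldsA w n + 1" "table_pos n = 4 * (y + 1)"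
    by (simp_all add: words_def baseB_def table_pos_def NS a_def c_def t_def P_def)
  ultimately have bound: "words w n \<le> a + c + 2" by linarith
  have "a + c + 2 \<le> n" if "a = 2 * x + 2 * t" "5 * x \<le> n" for x
  proof -
    \<comment> \<open>800 is the least common multiple of the denominators 5, 25 and 32. The
      constants 4 and 2 in \<open>a + c + 2\<close> make up the 6, and the sum is at most
      \<open>548 * n\<close>.\<close>
    have le: "800 * x \<le> 160 * n" "800 * t \<le> 25 * n" "800 * y \<le> 32 * n" "800 * P \<le> 25 * n"
      "800 * 6 \<le> 25 * n"
      using that(2) y25 tb(3) tP P32 by linarith+
    have "800 * (2 * x + 2 * t + (4 * (y + 1) + P) + 2) =
        2 * (800 * x) + 2 * (800 * t) + 4 * (800 * y) + 800 * P + 800 * 6" by simp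
    also have "\<dots> \<le> 2 * (160 * n) + 2 * (25 * n) + 4 * (32 * n) + 25 * n + 25 * n"
      by (intro add_mono mult_left_mono le) simp_all
    finally show ?thesis using that(1) c_def by simp
  qed
  then have ac: "a + c + 2 \<le> n" using a x5 .
  show "words w n \<le> n" using bound ac by linarith
  show "2 ^ chunk_size n \<le> n" using tb(3) unfolding P_def t_def by linarith
  show "table_pos n + 2 ^ chunk_size n \<le> n" using ac by (simp add: words c_def P_def t_def)
  have nw: "n \<le> 2 ^ w" using w by linarith
  show "layout w n (bitlen n) (chunk_size n) (fieldsA w n) (fieldsB w n) (superblocks n)
      (baseB w n) (table_pos n) (words w n)"
    unfolding k_def[symmetric] t_def[symmetric]
  proof
    show "n \<le> superblocks n * t * t"
    proof -
      have "n < (y + 1) * (t * t)"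
        unfolding y_def using kP by (metis Suc_eq_plus1 dividend_less_div_times mult_Suc add.commute nat_0_less_mult_iff)
      then show ?thesis by (simp add: NS algebra_simps)
    qed
    show "superblocks n < 2 ^ k" using nk ac c_def by (simp add: NS)
    show "2 * (superblocks n * t) div fieldsA w n < baseB w n"
      by (simp add: words NS a_def)
    show "baseB w n + (table_pos n + 2 ^ t) div fieldsB w n < words w n"
      by (simp add: words c_def P_def)
    show "words w n \<le> 2 ^ w" using bound ac nw by linarith
    show "2 * (superblocks n * t) < 2 ^ w" using ac nw by (simp add: NS a_def)
    show "table_pos n + 2 ^ t \<le> 2 ^ w" using ac nw by (simp add: words c_def P_def)
  qed (use kP tk nk q Q w in \<open>simp_all add: table_pos_def\<close>)
qed

section \<open>Initialization\<close>

text \<open>The initial contents are arbitrary, whereas updates by xor presuppose known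
  ones.\<close>

definition clear :: com where
  "clear = ADD 27 rZ rZ ;; Loop (Lt 27 26) (Do (Store 27 rZ) ;; ADD 27 27 r1)"

lemma clear_runs:
  assumes R: "R rZ = 0" "R r1 = 1" "R 26 = length M" "length M < 2 ^ w"
    and Q: "Q (R(27 := length M), replicate (length M) 0, out)"
  shows "runs w inp clear (4 * length M + 3) Q (R, M, out)"
proof -
  let ?L = "length M"
  let ?S = "\<lambda>j. (R(27 := j), replicate j 0 @ drop j M, out)"
  let ?I = "\<lambda>N \<sigma>. \<exists>j. \<sigma> = ?S j \<and> j \<le> ?L \<and> N = ?L - j"
  let ?c = "Do (Store 27 rZ) ;; ADD 27 27 r1"
  have "runs w inp (Loop (Lt 27 26) ?c) (?L * (csize ?c + 2) + 2) Q (?S 0)"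
  proof (rule runs_Loop[where I = ?I])
    show "?I ?L (?S 0)" by (intro exI[of _ 0]) simp
  next
    fix N \<sigma> assume "?I N \<sigma>" and h: "holds (Lt 27 26) \<sigma>"
    then obtain j where j: "\<sigma> = ?S j" "j \<le> ?L" "N = ?L - j" by blast
    have jL: "j < ?L" using h j(1) R by simp
    then have "(replicate j 0 @ drop j M)[j := 0] = replicate (Suc j) 0 @ drop (Suc j) M"
      by (simp add: list_update_append Cons_nth_drop_Suc[symmetric] replicate_append_same[symmetric]
          del: replicate_Suc) (simp add: replicate_app_Cons_same)
    moreover have "Suc j < 2 ^ w" using jL R(4) by linarith
    ultimately have "wp w inp ?c (\<lambda>\<sigma>'. \<sigma>' = ?S (Suc j)) \<sigma>"
      using R jL j(1) by (simp del: replicate_Suc)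
    then have "wp w inp ?c (\<lambda>\<sigma>'. \<exists>N'<N. ?I N' \<sigma>') \<sigma>"
    proof (rule wp_mono)
      fix \<sigma>' assume "\<sigma>' = ?S (Suc j)"
      then have "?I (?L - Suc j) \<sigma>'" using jL Suc_leI by blast
      moreover have "?L - Suc j < N" using jL j(3) by simp
      ultimately show "\<exists>N'<N. ?I N' \<sigma>'" by blast
    qed
    then show "runs w inp ?c (csize ?c) (\<lambda>\<sigma>'. \<exists>N'<N. ?I N' \<sigma>') \<sigma>" by (rule runs_wp)
  next
    fix N \<sigma> assume "?I N \<sigma>" and h: "\<not> holds (Lt 27 26) \<sigma>"
    then obtain j where j: "\<sigma> = ?S j" "j \<le> ?L" by blast
    then have "j = ?L" using h R by simp
    then show "Q \<sigma>" using Q j(1) by simp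
  qed
  note loop = this
  have "wp w inp (ADD 27 rZ rZ) (\<lambda>\<sigma>. \<sigma> = ?S 0) (R, M, out)"
    using R by simp
  from runs_wp[OF this] have "runs w inp (ADD 27 rZ rZ) 1
      (runs w inp (Loop (Lt 27 26) ?c) (?L * (csize ?c + 2) + 2) Q) (R, M, out)"
    by (rule runs_weaken) (use loop in simp_all)
  then have "runs w inp clear (1 + (?L * (csize ?c + 2) + 2)) Q (R, M, out)"
    unfolding clear_def by (rule runs_Seq)
  then show ?thesis by (rule runs_weaken) simp_all
qed

text \<open>Entry \<open>2 * h\<close> becomes entry \<open>h\<close> plus 1. It is still 0 before,
  so xor acts as assignment; odd entries keep their correct value 0.\<close>

definition table_body :: com where
  "table_body = ADD 29 28 rTab ;; getB 30 29 ;; ADD 30 30 r1 ;; ADD 29 29 28 ;; xorB 29 30 ;; ADD 28 28 r1"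

definition table_com :: com where
  "table_com = (SUB 27 rT r1 ;; SHL 27 r1 27 ;; ADD 28 r1 rZ) ;; Loop (Lt 28 27) table_body"

context layout
begin

definition zeroed :: "nat list \<Rightarrow> bool" where
  "zeroed M \<longleftrightarrow> length M = len \<and> (\<forall>i<2 * (NS * t). A M i = 0) \<and> (\<forall>i<tb. B M i = 0)"

lemma fld_replicate: "a + i div c < m \<Longrightarrow> fld (replicate m 0) a c d i = 0"
  by (simp add: fld_def)

lemma zeroed_replicate:
  "zeroed (replicate len 0)" "x < 2 ^ t \<Longrightarrow> Tab (replicate len 0) x = 0"
  using addrA_len addrB_len by (simp_all add: zeroed_def A_def B_def Tab_def fld_replicate)

text \<open>From \<open>h\<close> to \<open>Suc h\<close> the finished part gains the entries
  \<open>2 * h\<close> and \<open>2 * h + 1\<close>; the second one is 0 already.\<close>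

lemma lsb_step: "0 < h \<Longrightarrow> (if 0 < x \<and> x < 2 * Suc h then lsb x else 0) =
    (if x = 2 * h then Suc (lsb h) else if 0 < x \<and> x < 2 * h then lsb x else 0)"
  using lsb_double[of h] lsb_odd[of x] by (auto simp: less_Suc_eq)

definition table_inv :: "nat \<Rightarrow> (nat \<Rightarrow> nat) \<Rightarrow> nat list \<Rightarrow> nat \<Rightarrow> state \<Rightarrow> bool" where
  "table_inv s R out N \<sigma> \<longleftrightarrow> (\<exists>R' M h. \<sigma> = (R', M, out) \<and>
     const_regs R' \<and> R' rS = s \<and> zeroed M \<and> R' 27 = 2 ^ (t - 1) \<and> R' 28 = h \<and>
     0 < h \<and> h \<le> 2 ^ (t - 1) \<and> N = 2 ^ (t - 1) - h \<and>
     (\<forall>x<2 ^ t. Tab M x = (if 0 < x \<and> x < 2 * h then lsb x else 0)))"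

lemma table_body_wp:
  assumes inv: "table_inv s R out N \<sigma>" and h: "holds (Lt 28 27) \<sigma>"
  shows "wp w inp table_body (\<lambda>\<sigma>'. \<exists>N'<N. table_inv s R out N' \<sigma>') \<sigma>"
proof -
  from inv obtain R' M h where \<sigma>: "\<sigma> = (R', M, out)"
    and C: "const_regs R'" "R' rS = s" "R' 27 = 2 ^ (t - 1)" "R' 28 = h"
    and M: "zeroed M" and h0: "0 < h" and N: "N = 2 ^ (t - 1) - h"
    and Tb: "\<And>x. x < 2 ^ t \<Longrightarrow> Tab M x = (if 0 < x \<and> x < 2 * h then lsb x else 0)"
    unfolding table_inv_def by blast
  note C' = const_regsD[OF C(1)]
  have hl: "h < 2 ^ (t - 1)" using h C by (simp add: \<sigma>)
  have "2 ^ t = 2 * (2::nat) ^ (t - 1)" using t(1) by (cases t) auto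
  then have h2: "2 * h < 2 ^ t" using hl by simp
  have len: "length M = len" using M by (simp add: zeroed_def)
  have "Tab M h = lsb h" using Tb[of h] h0 h2 by simp
  then have Bh: "B M (h + tb) = lsb h" by (simp add: Tab_def add.commute)
  have lsbh: "lsb h < t - 1" using h0 hl by (intro lsb_less) simp_all
  then have lt: "Suc (lsb h) < t" by simp
  also have "t < 2 ^ k" using t(2) by (meson le_less_trans less_exp)
  finally have lk: "Suc (lsb h) < 2 ^ k" .
  have w1: "(h + tb) mod 2 ^ w = h + tb" "(h + tb + h) mod 2 ^ w = tb + 2 * h"
    "Suc (lsb h) mod 2 ^ w = Suc (lsb h)" "Suc h mod 2 ^ w = Suc h"
    using fit(2) h2 fld_le_word[OF lk] h0 by auto
  have i: "h + tb < tb + 2 ^ t" "tb + 2 * h < tb + 2 ^ t" using h2 by simp_all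
  define M1 where "M1 = wrB M (tb + 2 * h) (Suc (lsb h))"
  have B1: "B M1 = (B M)(tb + 2 * h := xor (B M (tb + 2 * h)) (Suc (lsb h)))"
    unfolding M1_def by (rule B_wrB[OF len i(2) lk])
  have "Tab M (2 * h) = 0" using Tb[OF h2] by simp
  then have B0: "B M (tb + 2 * h) = 0" by (simp add: Tab_def)
  have z1: "zeroed M1"
    using M len unfolding zeroed_def B1 by (auto simp: M1_def A_wrB)
  have T1: "Tab M1 x = (if 0 < x \<and> x < 2 * Suc h then lsb x else 0)" if "x < 2 ^ t" for x
    using Tb[OF that] B0 unfolding lsb_step[OF h0] unfolding Tab_def B1 by simp
  have "\<exists>N'<N. table_inv s R out N' (R2, M1, out)"
    if "const_regs R2" "R2 rS = s" "R2 27 = 2 ^ (t - 1)" "R2 28 = Suc h" for R2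
    unfolding table_inv_def
    by (intro exI[of _ "2 ^ (t - 1) - Suc h"] conjI exI[of _ R2] exI[of _ M1] exI[of _ "Suc h"])
      (use that z1 T1 hl N in auto)
  note P = this
  show ?thesis
    unfolding table_body_def
    apply (simp add: \<sigma> C C' w1)
    apply (rule getB_wp)
        apply (use i in \<open>simp_all add: C C' len Bh w1\<close>)
    apply (rule xorB_wp)
          apply (use i lk in \<open>simp_all add: C C' len w1 M1_def[symmetric]\<close>)
    apply (rule P[simplified])
       apply (simp_all add: C)
    done
qed

lemma table_com_runs:
  assumes C: "const_regs R" and M: "zeroed M" "\<And>x. x < 2 ^ t \<Longrightarrow> Tab M x = 0"
    and Post: "\<And>R' M'. const_regs R' \<Longrightarrow> R' rS = R rS \<Longrightarrow> zeroed M' \<Longrightarrow> table_ok M' \<Longrightarrow> Post (R', M', out)"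
  shows "runs w inp table_com (2 ^ t * (csize table_body + 2) + 5) Post (R, M, out)"
proof -
  note C' = const_regsD[OF C]
  have t2: "2 ^ t = 2 * (2::nat) ^ (t - 1)" using t(1) by (cases t) auto
  let ?c = "SUB 27 rT r1 ;; SHL 27 r1 27 ;; ADD 28 r1 rZ"
  let ?I = "table_inv (R rS) R out"
  have w1: "(2 ^ w + t - Suc 0) mod 2 ^ w = t - 1" "(2::nat) ^ (t - 1) mod 2 ^ w = 2 ^ (t - 1)"
      "(1::nat) mod 2 ^ w = 1"
  proof -
    have tw: "t < 2 ^ w" using t(2) kw by (meson le_less_trans less_exp)
    have "2 ^ w + t - Suc 0 = 2 ^ w + (t - 1)" "t - 1 < 2 ^ w" using t(1) tw by simp_all
    then show "(2 ^ w + t - Suc 0) mod 2 ^ w = t - 1" by (simp only: mod_add_self1 mod_less)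
    show "(2::nat) ^ (t - 1) mod 2 ^ w = 2 ^ (t - 1)" using t(1) by (intro shift_one) simp
    have "0 < w" using t kw by simp
    then show "(1::nat) mod 2 ^ w = 1" by simp
  qed
  have "wp w inp ?c (\<lambda>\<sigma>. ?I (2 ^ (t - 1) - 1) \<sigma>) (R, M, out)"
    using C M lsb_odd[of 1] w1 unfolding table_inv_def by (auto simp: C' less_2_cases_iff)
  from runs_wp[OF this] have "runs w inp ?c 3
      (runs w inp (Loop (Lt 28 27) table_body) ((2 ^ (t - 1) - 1) * (csize table_body + 2) + 2) Post) (R, M, out)"
  proof (rule runs_weaken)
    fix \<sigma> assume "?I (2 ^ (t - 1) - 1) \<sigma>"
    then show "runs w inp (Loop (Lt 28 27) table_body) ((2 ^ (t - 1) - 1) * (csize table_body + 2) + 2) Post \<sigma>"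
    proof (rule runs_Loop[where I = ?I])
      show "runs w inp table_body (csize table_body) (\<lambda>\<sigma>'. \<exists>N'<N. ?I N' \<sigma>') \<sigma>"
        if "?I N \<sigma>" "holds (Lt 28 27) \<sigma>" for N \<sigma>
        using that by (intro runs_wp table_body_wp)
      show "Post \<sigma>" if I: "?I N \<sigma>" and h: "\<not> holds (Lt 28 27) \<sigma>" for N \<sigma>
      proof -
        from I obtain R' M' h where s: "\<sigma> = (R', M', out)" "const_regs R'" "R' rS = R rS" "zeroed M'"
          "R' 27 = 2 ^ (t - 1)" "R' 28 = h" "h \<le> 2 ^ (t - 1)"
          "\<forall>x<2 ^ t. Tab M' x = (if 0 < x \<and> x < 2 * h then lsb x else 0)"
          unfolding table_inv_def by blast
        then have "h = 2 ^ (t - 1)" using h by simp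
        then have "table_ok M'" using s(8) t2 by (simp add: table_ok_def)
        then show ?thesis using s(1-4) Post by simp
      qed
    qed
  qed simp
  then have "runs w inp table_com (3 + ((2 ^ (t - 1) - 1) * (csize table_body + 2) + 2)) Post (R, M, out)"
    unfolding table_com_def by (rule runs_Seq)
  then show ?thesis
  proof (rule runs_weaken)
    have "((2::nat) ^ (t - 1) - 1) * (csize table_body + 2) \<le> 2 ^ t * (csize table_body + 2)"
      using t2 by (intro mult_right_mono) simp_all
    then show "3 + ((2 ^ (t - 1) - 1) * (csize table_body + 2) + 2) \<le> 2 ^ t * (csize table_body + 2) + 5"
      by linarith
  qed
qed

end

definition start :: com where
  "start = ADD rCur rZ rZ ;; ADD rNxt r1 rZ ;; ADD rCntC rZ rZ ;; ADD rCntN rZ rZ ;;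
     ADD rPtr rZ rZ ;; ADD rGo r1 rZ ;; ADD rU rS rZ ;; mark"

context layout
begin

lemma start_wp:
  assumes C: "const_regs R" and M: "zeroed M" "table_ok M" and s: "R rS = s" "s < n"
    and E: "E \<subseteq> {..<n} \<times> {..<n}"
    and Post: "\<And>N \<sigma>. search_inv inp E s N \<sigma> \<Longrightarrow> N \<le> card E + 5 * n + 4 \<Longrightarrow> Post \<sigma>"
  shows "wp w inp start Post (R, M, [])"
proof -
  note C' = const_regsD[OF C]
  let ?R = "R(rCur := 0, rNxt := 1, rCntC := 0, rCntN := 0, rPtr := 0, rGo := 1, rU := s)"
  have len: "length M = len" using M(1) by (simp add: zeroed_def)
  have X0: "X M p c = 0" for p c
  proof (cases "2 * c + p < 2 * (NS * t)")
    case True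
    then show ?thesis using M(1) by (simp add: X_def zeroed_def)
  qed (simp add: X_def A_def)
  have Y0: "Y M p S = 0" if "S < NS" "p < 2" for p S
    using M(1) indexY[OF that] by (simp add: Y_def zeroed_def)
  have fr: "frontier t NS (X M p) (Y M p) (Z M p) 0 {} {}" if "p < 2" for p
    by (rule frontierI) (simp_all add: X0 Y0 that)
  have st: "store ?R M 0 1 0 0 {} {} {}"
    using C len M(2) fr[of 0] fr[of 1] unfolding store_def by (simp add: nonempty_stack_def)
  have "summary t NS (Y M p) = {}" if "p < 2" for p
    using Y0[OF _ that] by (auto simp: summary_def less_mult_imp_div_less)
  then have pot: "pot M 0 1 0 0 = 0" by (simp add: pot_def)
  have w: "s mod 2 ^ w = s" "0 < w"
  proof -
    show "s mod 2 ^ w = s" using s(2) fit(3) by simp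
    show "0 < w" using t kw by simp
  qed
  have "wp w inp mark Post (?R, M, [])"
  proof (rule mark_wp[OF st])
    fix R' M' c''
    assume a: "store R' M' 0 1 0 c'' {} (if s \<in> {} \<union> {} \<union> {} then {} else insert s {}) {}"
      "R' rPtr = ?R rPtr" "R' rGo = ?R rGo"
      "pot M' 0 1 0 c'' \<le> pot M 0 1 0 0 + (if s \<in> {} \<union> {} \<union> {} then 0 else 3)"
    \<comment> \<open>The measure starts with \<open>card E + n\<close> from
      \<open>bfs_work\<close>, \<open>4 * (n - 1)\<close> for the undiscovered vertices, at most 3
      of potential and 1 for \<open>rGo\<close>.\<close>
    let ?N = "card E + 5 * n + 5"
    have "\<exists>N<?N. search_inv inp E s N (R', M', [])"
    proof (rule search_invI)
      show "store R' M' 0 1 0 c'' {} {s} (set [])" using a(1) by simp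
      show "bfs_inv E s 0 [] {} {s} []" by (rule bfs_inv_init)
      have "card ({..<n} - ({} \<union> {s} \<union> set [])) = n - 1" using s(2) by simp
      then show "bfs_work E {..<n} [] [] + 4 * card ({..<n} - ({} \<union> {s} \<union> set [])) +
          pot M' 0 1 0 c'' + (if R' rGo = 0 then 0 else 1) < ?N"
        using a(4) pot s(2) by (auto simp: bfs_work_init[OF E])
    qed (use a in \<open>simp_all add: linked_list_0\<close>)
    then show "Post (R', M', [])" using Post by fastforce
  qed (use s in simp_all)
  then show ?thesis using s w by (simp add: start_def C' fun_upd_twist)
qed

end

text \<open>
  A program does not know its word length. For \<open>n \<ge> w\<close> the shift of 1 by \<open>n\<close> yields 0, so that after
  the subtraction register 28 contains \<open>2 ^ min w n - 1\<close>, whose bit length is \<open>min w n\<close>.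
\<close>

definition params1 :: com where
  "params1 = DIV rT rK 26 ;; SHL 28 r1 rN ;; SUB 28 28 r1"

definition params2 :: com where
  "params2 =
     DIV rQA 27 rT ;; DIV rQB 27 rK ;;
     SHL rMA r1 rT ;; SUB rMA rMA r1 ;; SHL rMB r1 rK ;; SUB rMB rMB r1 ;;
     MUL 26 rT rT ;; DIV 26 rN 26 ;; ADD 26 26 r1 ;; MUL rTab 26 r4 ;;
     MUL 26 26 rT ;; MUL 26 26 r2 ;; DIV rB 26 rQA ;; ADD rB rB r1 ;;
     SHL 26 r1 rT ;; ADD 26 rTab 26 ;; DIV 26 26 rQB ;; ADD 26 26 rB ;; ADD 26 26 r1"

definition large :: com where
  "large =
     Do (Const r4 4) ;; bitlen_com 26 rK ;; params1 ;; bitlen_com 27 28 ;; params2 ;;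
     clear ;; table_com ;; start ;; Loop (Lt rZ rGo) search_body"

definition start_queue :: com where
  "start_queue =
     Do (Store rZ rS) ;; ADD rCntC rZ rZ ;; ADD rCntN r1 rZ ;; ADD rCur rZ rZ ;;
     ADD rPtr rZ rZ ;; ADD rGo r1 rZ"

definition small :: com where
  "small = start_queue ;; Loop (Lt rZ rGo) queue_body"

definition read_input :: com where
  "read_input = Do (Const rZ 0) ;; Do (Const r1 1) ;; Do (Const r2 2) ;; Do (Read rN rZ) ;; Do (Read rS r1)"

text \<open>The test \<open>bitlen n \<ge> 32\<close> is made with constants below 4, since larger ones might not fit into a
  word.\<close>

definition bfs_com :: com where
  "bfs_com = read_input ;; bitlen_com rK rN ;; (SHR 26 rK r2 ;; SHR 26 26 r2) ;;
     Branch (Lt r1 26) large small"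

lemma mask_word: "(2 ^ w + 2 ^ m mod 2 ^ w - Suc 0) mod 2 ^ w = (2::nat) ^ min w m - Suc 0"
proof (cases "m < w")
  case True
  then have "(2::nat) ^ m < 2 ^ w" by simp
  then have "2 ^ w + 2 ^ m mod 2 ^ w - Suc 0 = 2 ^ w + (2 ^ m - Suc 0 :: nat)" "2 ^ m - Suc 0 < (2::nat) ^ w"
    by (simp, linarith)
  then have "(2 ^ w + 2 ^ m mod 2 ^ w - Suc 0) mod 2 ^ w = (2::nat) ^ m - Suc 0"
    by (simp only: mod_add_self1 mod_less)
  then show ?thesis using True by (simp add: min_def)
next
  case False
  then have "(2::nat) ^ m mod 2 ^ w = 0" by (simp add: le_imp_power_dvd)
  then show ?thesis using False by (simp add: min_def)
qed

text \<open>Stating the value of each instruction keeps the nested reductions modulo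
  \<open>2 ^ w\<close> of a long chain from piling up.\<close>

lemma wp_arith_Seq:
  assumes "arith_word w f (R b) (R c) = v" "wp w inp d P (R(a := v), M, out)"
  shows "wp w inp (Do (Arith f a b c) ;; d) P (R, M, out)"
  using assms by simp

lemma wp_arith:
  assumes "arith_word w f (R b) (R c) = v" "P (R(a := v), M, out)"
  shows "wp w inp (Do (Arith f a b c)) P (R, M, out)"
  using assms by simp

lemma params2_wp:
  fixes n w :: nat
  defines "k \<equiv> bitlen n" and "t \<equiv> chunk_size n"
  assumes k: "32 \<le> bitlen n" and w: "n + 2 \<le> 2 ^ w"
    and R: "R rZ = 0" "R r1 = 1" "R r2 = 2" "R r4 = 4" "R rN = n" "R rK = k" "R rT = t" "R 27 = min w n"
    and Post: "\<And>R'. layout.const_regs k t (fieldsA w n) (fieldsB w n) (baseB w n) (table_pos n) R' \<Longrightarrow>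
      R' 26 = words w n \<Longrightarrow> R' rS = R rS \<Longrightarrow> P (R', M, out)"
  shows "wp w inp params2 P (R, M, out)"
proof -
  note L = layout_words(1)[OF k w, folded k_def t_def]
  note wle = layout_words(2)[OF k w]
  interpret layout w n k t "fieldsA w n" "fieldsB w n" "superblocks n" "baseB w n" "table_pos n" "words w n"
    by (rule L)
  define NS where "NS = superblocks n"
  have tw: "t < w" "(2::nat) ^ t mod 2 ^ w = 2 ^ t" "min w t = t" "min w k = k"
  proof -
    have "6 * t \<le> k" using chunk_size_bounds(2)[OF k] by (simp add: k_def t_def)
    then show "t < w" using kw t(1) by linarith
    then show "(2::nat) ^ t mod 2 ^ w = 2 ^ t" "min w t = t" by simp_all
    show "min w k = k" using kw by simp
  qed
  have NS1: "Suc (n div (t * t)) = NS" by (simp add: NS_def superblocks_def t_def)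
  have le: "NS \<le> NS * t" "NS * t \<le> 2 * (NS * t)" using t(1) by simp_all
  have tt: "t * t < 2 ^ w"
  proof -
    have "t * t \<le> 2 ^ t * 2 ^ t" by (intro mult_mono) (simp_all add: less_exp less_imp_le)
    also have "\<dots> = 2 ^ (t + t)" by (simp add: power_add)
    also have "\<dots> < 2 ^ w"
      using chunk_size_bounds(2)[OF k] kw t(1) by (simp add: k_def t_def)
    finally show ?thesis .
  qed
  have lw: "words w n < 2 ^ w" using wle w by linarith
  have m: "NS * t < 2 ^ w" "2 * (NS * t) < 2 ^ w" "4 * NS < 2 ^ w" "NS < 2 ^ w" "4 * NS + 2 ^ t < 2 ^ w"
  proof -
    show "2 * (NS * t) < 2 ^ w" using fit(1) by (simp add: NS_def)
    then show "NS * t < 2 ^ w" "NS < 2 ^ w" using le by linarith+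
    show "4 * NS + 2 ^ t < 2 ^ w"
      using layout_words(4)[OF k w] w by (simp add: table_pos_def NS_def t_def)
    then show "4 * NS < 2 ^ w" by simp
  qed
  have b: "Suc (2 * (NS * t) div fieldsA w n) = baseB w n"
    by (simp add: baseB_def NS_def t_def)
  have wd: "Suc ((4 * NS + 2 ^ t) div fieldsB w n + baseB w n) = words w n"
    by (simp add: words_def table_pos_def NS_def t_def)
  have tpos: "4 * NS = table_pos n" by (simp add: table_pos_def NS_def)
  have fA: "min w n div t = fieldsA w n" "min w n div k = fieldsB w n"
    by (simp_all add: fieldsA_def fieldsB_def k_def t_def)
  have bw: "baseB w n < 2 ^ w" "(4 * NS + 2 ^ t) div fieldsB w n + baseB w n < 2 ^ w"
    using wd lw by linarith+
  show ?thesis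
    unfolding params2_def
    apply (rule wp_arith_Seq[where v = "fieldsA w n"], (simp add: R fA; fail))
    apply (rule wp_arith_Seq[where v = "fieldsB w n"], (simp add: R fA; fail))
    apply (rule wp_arith_Seq[where v = "2 ^ t"], (simp add: R tw; fail))
    apply (rule wp_arith_Seq[where v = "2 ^ t - 1"], (simp add: R mask_word[of w t, unfolded tw]; fail))
    \<comment> \<open>For \<open>k = w\<close> the shift yields 0 and the subtraction wraps around
      to the word of all ones, so the mask is right in this case as well.\<close>
    apply (rule wp_arith_Seq[where v = "2 ^ k mod 2 ^ w"], (simp add: R; fail))
    apply (rule wp_arith_Seq[where v = "2 ^ k - 1"], (simp add: R mask_word[of w k, unfolded tw]; fail))
    apply (rule wp_arith_Seq[where v = "t * t"], (simp add: R tt; fail))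
    apply (rule wp_arith_Seq[where v = "n div (t * t)"], (simp add: R; fail))
    apply (rule wp_arith_Seq[where v = "NS"], (simp add: R NS1 m; fail))
    apply (rule wp_arith_Seq[where v = "4 * NS"], (simp add: R m mult.commute[of NS 4]; fail))
    apply (rule wp_arith_Seq[where v = "NS * t"], (simp add: R m; fail))
    apply (rule wp_arith_Seq[where v = "2 * (NS * t)"], (simp add: R m mult.commute[of "NS * t" 2]; fail))
    apply (rule wp_arith_Seq[where v = "2 * (NS * t) div fieldsA w n"], (simp add: R; fail))
    apply (rule wp_arith_Seq[where v = "baseB w n"], (simp add: R b bw; fail))
    apply (rule wp_arith_Seq[where v = "2 ^ t"], (simp add: R tw; fail))
    apply (rule wp_arith_Seq[where v = "4 * NS + 2 ^ t"], (simp add: R m; fail))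
    apply (rule wp_arith_Seq[where v = "(4 * NS + 2 ^ t) div fieldsB w n"], (simp add: R; fail))
    apply (rule wp_arith_Seq[where v = "(4 * NS + 2 ^ t) div fieldsB w n + baseB w n"], (simp add: R bw; fail))
    apply (rule wp_arith[where v = "words w n"], (simp add: R wd lw; fail))
    apply (rule Post)
      apply (simp_all add: const_regs_def R tpos)
    done
qed

section \<open>Running time of the two branches\<close>

lemma large_runs:
  assumes k: "32 \<le> bitlen n" and w: "n + 2 \<le> 2 ^ w"
    and R: "R rZ = 0" "R r1 = 1" "R r2 = 2" "R rN = n" "R rS = s" "R rK = bitlen n"
    and s: "s < n" and M: "length M = words w n"
    and adj: "adjacency inp n E" and inp: "length inp \<le> 2 ^ w"
  shows "runs w inp large (100 * csize large * (card E + n))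
    (\<lambda>(R, M, out). \<exists>l. bfs_inv E s l out {} {} []) (R, M, [])"
proof -
  define k t where "k = bitlen n" and "t = chunk_size n"
  note L = layout_words[OF k w, folded k_def t_def]
  interpret layout w n k t "fieldsA w n" "fieldsB w n" "superblocks n" "baseB w n" "table_pos n" "words w n"
    by (rule L(1))
  let ?Post = "\<lambda>(R, M, out :: nat list). \<exists>l. bfs_inv E s l out {} {} []"
  let ?loop = "Loop (Lt rZ rGo) search_body"
  \<comment> \<open>The commands are composed from the last one backwards; each \<open>T\<close>
    with the next number adds one more command in front.\<close>
  define N where "N = card E + 5 * n + 4"
  define T1 where "T1 = N * (csize search_body + 2) + 2"
  have loop: "runs w inp ?loop T1 ?Post \<sigma>" if "search_inv inp E s N' \<sigma>" "N' \<le> N" for N' \<sigma>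
  proof (rule runs_weaken[OF search_loop_runs[OF that(1) adj inp]])
    have "N' * (csize search_body + 2) \<le> N * (csize search_body + 2)"
      using that(2) by (rule mult_right_mono) simp
    then show "N' * (csize search_body + 2) + 2 \<le> T1" by (simp add: T1_def)
  qed
  define T2 where "T2 = csize start + T1"
  have start: "runs w inp (start ;; ?loop) T2 ?Post (R', M', [])"
    if "const_regs R'" "zeroed M'" "table_ok M'" "R' rS = s" for R' M'
  proof -
    have "E \<subseteq> {..<n} \<times> {..<n}" using adj by (simp add: adjacency_def)
    then have "wp w inp start (runs w inp ?loop T1 ?Post) (R', M', [])"
      by (intro start_wp[OF that s]) (auto intro: loop simp: N_def)
    then show ?thesis unfolding T2_def by (intro runs_Seq runs_wp)
  qed
  define T3 where "T3 = 2 ^ t * (csize table_body + 2) + 5 + T2"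
  have table: "runs w inp (table_com ;; start ;; ?loop) T3 ?Post (R', M', [])"
    if "const_regs R'" "R' rS = s" "M' = replicate (words w n) 0" for R' M'
    unfolding T3_def
    by (intro runs_Seq table_com_runs) (use that zeroed_replicate start in auto)
  define T4 where "T4 = 4 * words w n + 3 + T3"
  have clear: "runs w inp (clear ;; table_com ;; start ;; ?loop) T4 ?Post (R', M, [])"
    if C: "const_regs R'" "R' rS = s" "R' 26 = words w n" for R'
    unfolding T4_def
  proof (rule runs_Seq)
    show "runs w inp clear (4 * words w n + 3) (runs w inp (table_com ;; start ;; ?loop) T3 ?Post) (R', M, [])"
      unfolding M[symmetric]
      by (rule clear_runs) (use C const_regsD[OF C(1)] L(2) w M table in simp_all)
  qed
  define T5 where "T5 = csize params2 + T4"
  have params2: "runs w inp (params2 ;; clear ;; table_com ;; start ;; ?loop) T5 ?Post (R', M, [])"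
    if "R' rZ = 0" "R' r1 = 1" "R' r2 = 2" "R' r4 = 4" "R' rN = n" "R' rK = k" "R' rT = t"
      "R' 27 = min w n" "R' rS = s" for R'
    unfolding T5_def
    by (intro runs_Seq runs_wp params2_wp[OF k w])
      (use that clear in \<open>auto simp: k_def t_def\<close>)
  define T6 where "T6 = 4 * min w n + 4 + T5"
  have len: "runs w inp (bitlen_com 27 28 ;; params2 ;; clear ;; table_com ;; start ;; ?loop) T6 ?Post (R', M, [])"
    if R': "R' rZ = 0" "R' r1 = 1" "R' r2 = 2" "R' r4 = 4" "R' rN = n" "R' rK = k" "R' rT = t"
      "R' 28 = 2 ^ min w n - 1" "R' rS = s" for R'
    unfolding T6_def
  proof (rule runs_Seq)
    have "(2::nat) ^ min w n \<le> 2 ^ w" by (intro power_increasing) auto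
    moreover have "(0::nat) < 2 ^ w" by simp
    ultimately have lt: "R' 28 < 2 ^ w" unfolding R'(8) by linarith
    have b: "bitlen (R' 28) = min w n" unfolding R'(8) by (rule bitlen_mask)
    show "runs w inp (bitlen_com 27 28) (4 * min w n + 4)
        (runs w inp (params2 ;; clear ;; table_com ;; start ;; ?loop) T5 ?Post) (R', M, [])"
      unfolding b[symmetric]
      by (rule bitlen_com_runs) (use R' lt b params2 in simp_all)
  qed
  define T7 where "T7 = csize params1 + T6"
  have params1: "runs w inp (params1 ;; bitlen_com 27 28 ;; params2 ;; clear ;; table_com ;; start ;; ?loop) T7 ?Post (R', M, [])"
    if R': "R' rZ = 0" "R' r1 = 1" "R' r2 = 2" "R' r4 = 4" "R' rN = n" "R' rK = k" "R' 26 = bitlen k"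
      "R' rS = s" for R'
    unfolding T7_def
  proof (intro runs_Seq runs_wp)
    have t: "k div bitlen k = t" by (simp add: k_def t_def chunk_size_def)
    show "wp w inp params1
        (runs w inp (bitlen_com 27 28 ;; params2 ;; clear ;; table_com ;; start ;; ?loop) T6 ?Post) (R', M, [])"
      unfolding params1_def
      apply (rule wp_arith_Seq[where v = t], (simp add: R' t; fail))
      apply (rule wp_arith_Seq[where v = "2 ^ n mod 2 ^ w"], (simp add: R'; fail))
      apply (rule wp_arith[where v = "2 ^ min w n - 1"], (simp add: R' mask_word; fail))
      apply (rule len)
             apply (simp_all add: R')
      done
  qed
  define T8 where "T8 = 1 + (4 * bitlen k + 4 + T7)"
  have "runs w inp large T8 ?Post (R, M, [])"
    unfolding T8_def large_def
  proof (rule runs_Seq, rule runs_Do)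
    have "bitlen n \<le> w" using w by (intro bitlen_le) simp
    then have "32 \<le> w" using k by linarith
    then have "(2::nat) ^ 32 \<le> 2 ^ w" by (intro power_increasing) simp_all
    then have "(4::nat) mod 2 ^ w = 4" by simp
    then show "effect w inp (Const r4 4) (R, M, []) = Some (R(r4 := 4), M, [])" by simp
    have kw: "k < 2 ^ w" using kw by (meson le_less_trans less_exp)
    show "runs w inp (bitlen_com 26 rK ;; params1 ;; bitlen_com 27 28 ;; params2 ;; clear ;; table_com ;; start ;; ?loop)
        (4 * bitlen k + 4 + T7) ?Post (R(r4 := 4), M, [])"
    proof (rule runs_Seq)
      have Rk: "(R(r4 := 4)) rK = k" using R by (simp add: k_def)
      show "runs w inp (bitlen_com 26 rK) (4 * bitlen k + 4)
          (runs w inp (params1 ;; bitlen_com 27 28 ;; params2 ;; clear ;; table_com ;; start ;; ?loop) T7 ?Post)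
          (R(r4 := 4), M, [])"
        unfolding Rk[symmetric]
        by (rule bitlen_com_runs) (use R kw params1 in \<open>simp_all add: k_def\<close>)
    qed
  qed
  \<comment> \<open>With \<open>c\<close> and \<open>x\<close> as below, the contributions add up to
    at most \<open>42 * (c * x)\<close>; 100 is a round number above that.\<close>
  moreover have "T8 \<le> 100 * csize large * (card E + n)"
  proof -
    define c x where "c = csize large" and "x = card E + n"
    have c: "csize params1 + csize params2 + csize start \<le> c" "csize table_body + 2 \<le> c"
        "csize search_body + 2 \<le> c" "1 \<le> c"
      by (simp_all add: c_def large_def table_com_def)
    have x: "1 \<le> x" "N \<le> 9 * x" "n \<le> x" using s by (simp_all add: x_def N_def)
    have y: "c \<le> c * x" "x \<le> c * x" using c(4) x(1) by simp_all
    have k: "bitlen k \<le> x" "min w n \<le> x" "words w n \<le> x"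
      using bitlen_le_self[of k] bitlen_le_self[of n] L(2) x(3) unfolding k_def by linarith+
    have "N * (csize search_body + 2) \<le> 9 * x * c" by (rule mult_le_mono[OF x(2) c(3)])
    then have "N * (csize search_body + 2) \<le> 9 * (c * x)" by (simp add: algebra_simps)
    moreover have "2 ^ t * (csize table_body + 2) \<le> x * c"
      by (rule mult_le_mono[OF _ c(2)]) (use L(3) x(3) in linarith)
    then have "2 ^ t * (csize table_body + 2) \<le> c * x" by (simp add: mult.commute)
    moreover have "T8 = 19 + 4 * bitlen k + 4 * min w n + 4 * words w n +
        (csize params1 + csize params2 + csize start) +
        2 ^ t * (csize table_body + 2) + N * (csize search_body + 2)"
      by (simp only: T8_def T7_def T6_def T5_def T4_def T3_def T2_def T1_def)
    ultimately have "T8 \<le> 100 * (c * x)" using c(1) k x(1) y by linarith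
    then show ?thesis by (simp add: c_def x_def mult.assoc)
  qed
  ultimately show ?thesis by (rule runs_weaken)
qed

text \<open>The additional factor \<open>n\<close> stems from scanning the queue once for each list
  cell.\<close>

lemma small_runs:
  assumes w: "n + 2 \<le> 2 ^ w" and R: "R rZ = 0" "R r1 = 1" "R rS = s"
    and s: "s < n" and M: "length M = n"
    and adj: "adjacency inp n E" and inp: "length inp \<le> 2 ^ w"
  shows "runs w inp small (100 * n * csize small * (card E + n))
    (\<lambda>(R, M, out). \<exists>l. bfs_inv E s l out {} {} []) (R, M, [])"
proof -
  let ?Post = "\<lambda>(R, M, out :: nat list). \<exists>l. bfs_inv E s l out {} {} []"
  let ?loop = "Loop (Lt rZ rGo) queue_body"
  define N where "N = card E + 2 * n + 4"
  have E: "E \<subseteq> {..<n} \<times> {..<n}" using adj by (simp add: adjacency_def)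
  have "wp w inp start_queue (\<lambda>\<sigma>. \<exists>N'<N. queue_inv n inp E s N' \<sigma>) (R, M, [])"
  proof -
    have w1: "0 < w" using w s by (cases "w = 0") auto
    have "\<exists>N'<N. queue_inv n inp E s N' (R', M[0 := s], [])"
      if R': "R' rZ = 0" "R' r1 = 1" "R' rCntC = 0" "R' rCntN = 1" "R' rCur = 0" "R' rPtr = 0" "R' rGo = 1" for R'
    proof (rule queue_invI[where cs = "[]" and ns = "[s]"])
      have "card ({..<n} - {s}) = n - 1" using s by simp
      then show "bfs_work E {..<n} [] [] + card ({..<n} - set ([] @ [] @ [s])) + length [s] +
          (if R' rGo = 0 then 0 else 1) < N"
        using s by (simp add: bfs_work_init[OF E] N_def)
      show "take (R' rCntN) (M[0 := s]) = [] @ [] @ [s]"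
        using M s R' by (cases M) auto
      show "bfs_inv E s 0 [] (set []) (set [s]) []" by (simp add: bfs_inv_init)
    qed (use R' M s in \<open>simp_all add: linked_list_0\<close>)
    then show ?thesis using R M s w1 by (simp add: start_queue_def)
  qed
  from runs_wp[OF this] have "runs w inp start_queue (csize start_queue)
      (runs w inp ?loop (N * (n * 9 + csize queue_body + 2) + 2) ?Post) (R, M, [])"
  proof (rule runs_weaken)
    fix \<sigma> assume "\<exists>N'<N. queue_inv n inp E s N' \<sigma>"
    then obtain N' where N': "N' < N" "queue_inv n inp E s N' \<sigma>" by blast
    show "runs w inp ?loop (N * (n * 9 + csize queue_body + 2) + 2) ?Post \<sigma>"
    proof (rule runs_weaken[OF queue_loop_runs[OF N'(2) adj inp]])
      have "N' * (n * 9 + csize queue_body + 2) \<le> N * (n * 9 + csize queue_body + 2)"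
        using N'(1) by (intro mult_right_mono) simp_all
      then show "N' * (n * 9 + csize queue_body + 2) + 2 \<le> N * (n * 9 + csize queue_body + 2) + 2" by simp
    qed
  qed simp
  then have "runs w inp small (csize start_queue + (N * (n * 9 + csize queue_body + 2) + 2)) ?Post (R, M, [])"
    unfolding small_def by (rule runs_Seq)
  moreover have "csize start_queue + (N * (n * 9 + csize queue_body + 2) + 2) \<le> 100 * n * csize small * (card E + n)"
  proof -
    define c x where "c = csize small" and "x = card E + n"
    have c: "csize start_queue + 2 \<le> c" "csize queue_body + 2 \<le> c" "1 \<le> c"
      by (simp_all add: c_def small_def)
    have x: "1 \<le> x" "N \<le> 6 * x" "1 \<le> n" using s by (simp_all add: x_def N_def)
    have "1 \<le> n * x" using x by simp
    have "n \<le> n * c" "c \<le> n * c" using c(3) x(3) by simp_all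
    then have "n * 9 + csize queue_body + 2 \<le> 10 * (n * c)" using c(2) by linarith
    then have "N * (n * 9 + csize queue_body + 2) \<le> 6 * x * (10 * (n * c))"
      by (rule mult_le_mono[OF x(2)])
    moreover have "6 * x * (10 * (n * c)) = 60 * (n * c * x)" by simp
    moreover have "c * 1 \<le> c * (n * x)" using \<open>1 \<le> n * x\<close> by (rule mult_le_mono2)
    then have "c \<le> n * c * x" by (simp add: algebra_simps)
    ultimately have "csize start_queue + (N * (n * 9 + csize queue_body + 2) + 2) \<le> 100 * (n * c * x)"
      using c(1) by linarith
    then show ?thesis by (simp add: c_def x_def mult.assoc)
  qed
  ultimately show ?thesis by (rule runs_weaken)
qed

definition workspace :: "nat \<Rightarrow> nat \<Rightarrow> nat" where
  "workspace w n = (if 32 \<le> bitlen n then words w n else n)"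

text \<open>\<open>2 ^ 31\<close> bounds \<open>n\<close> on the branch \<open>bitlen n < 32\<close>
  and absorbs the additional factor \<open>n\<close> of \<open>small_runs\<close>.\<close>

definition time_factor :: nat where
  "time_factor = 100 * 2 ^ 31 * csize bfs_com"

lemma bfs_com_runs:
  assumes w: "n + 2 \<le> 2 ^ w" and inp0: "inp ! 0 = n" "inp ! 1 = s"
    and s: "s < n" and M: "length M = workspace w n"
    and adj: "adjacency inp n E" and inp: "length inp \<le> 2 ^ w"
  shows "runs w inp bfs_com (2 * time_factor * (card E + n))
    (\<lambda>(R, M, out). \<exists>l. bfs_inv E s l out {} {} []) (R, M, [])"
proof -
  let ?Post = "\<lambda>(R, M, out :: nat list). \<exists>l. bfs_inv E s l out {} {} []"
  define x where "x = card E + n"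
  have x: "1 \<le> x" using s by (simp add: x_def)
  have w2: "2 \<le> w"
  proof (rule ccontr)
    assume "\<not> 2 \<le> w"
    then have "(2::nat) ^ w \<le> 2 ^ 1" by (intro power_increasing) auto
    then show False using w s by simp
  qed
  then have "(2::nat) ^ 2 \<le> 2 ^ w" by (intro power_increasing) simp_all
  then have m2: "(2::nat) mod 2 ^ w = 2" "0 < w" using w2 by simp_all
  have nw: "n < 2 ^ w" using w by simp
  have li: "n + 2 \<le> length inp" using adj by (simp add: adjacency_def)
  then have ne: "inp \<noteq> []" by auto
  define T1 where "T1 = 100 * 2 ^ 31 * (csize large + csize small) * x + 2"
  define T2 where "T2 = 2 + T1"
  let ?branch = "Branch (Lt r1 26) large small"
  let ?shift = "SHR 26 rK r2 ;; SHR 26 26 r2"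
  have br: "runs w inp ?branch T1 ?Post (R', M, [])"
    if R': "R' rZ = 0" "R' r1 = 1" "R' r2 = 2" "R' rN = n" "R' rS = s" "R' rK = bitlen n" "R' 26 = bitlen n div 16" for R'
    unfolding T1_def
  proof (rule runs_Branch)
    assume "holds (Lt r1 26) (R', M, [])"
    then have k: "32 \<le> bitlen n" using R' by simp
    then have "length M = words w n" using M by (simp add: workspace_def)
    from large_runs[OF k w R'(1-6) s this adj inp]
    show "runs w inp large (100 * 2 ^ 31 * (csize large + csize small) * x) ?Post (R', M, [])"
      by (rule runs_weaken) (simp_all add: x_def)
  next
    assume "\<not> holds (Lt r1 26) (R', M, [])"
    then have k: "\<not> 32 \<le> bitlen n" using R' by simp
    then have "length M = n" using M by (simp add: workspace_def)
    from small_runs[OF w R'(1,2,5) s this adj inp]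
    show "runs w inp small (100 * 2 ^ 31 * (csize large + csize small) * x) ?Post (R', M, [])"
    proof (rule runs_weaken)
      have "n < 2 ^ bitlen n" by (rule less_power_bitlen)
      also have "\<dots> \<le> 2 ^ 31" using k by (intro power_increasing) simp_all
      finally have "100 * n * csize small \<le> 100 * 2 ^ 31 * (csize large + csize small)"
        by (intro mult_le_mono) simp_all
      then show "100 * n * csize small * (card E + n) \<le> 100 * 2 ^ 31 * (csize large + csize small) * x"
        unfolding x_def by (rule mult_le_mono1)
    qed
  qed
  have sh: "runs w inp (?shift ;; ?branch) T2 ?Post (R', M, [])"
    if R': "R' rZ = 0" "R' r1 = 1" "R' r2 = 2" "R' rN = n" "R' rS = s" "R' rK = bitlen n" for R'
  proof -
    have "wp w inp ?shift (runs w inp ?branch T1 ?Post) (R', M, [])"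
      using R' by (simp add: drop_bit_eq_div div_mult2_eq[symmetric] br)
    from runs_Seq[OF runs_wp[OF this]] show ?thesis
      by (simp add: T2_def)
  qed
  define T3 where "T3 = 4 * bitlen n + 4 + T2"
  have rd: "runs w inp (bitlen_com rK rN ;; ?shift ;; ?branch) T3 ?Post (R', M, [])"
    if R': "R' rZ = 0" "R' r1 = 1" "R' r2 = 2" "R' rN = n" "R' rS = s" for R'
    unfolding T3_def
  proof (rule runs_Seq)
    show "runs w inp (bitlen_com rK rN) (4 * bitlen n + 4) (runs w inp (?shift ;; ?branch) T2 ?Post) (R', M, [])"
      unfolding R'(4)[symmetric]
      by (rule bitlen_com_runs) (use R' nw sh in simp_all)
  qed
  have "runs w inp bfs_com (csize read_input + T3) ?Post (R, M, [])"
    unfolding bfs_com_def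
  proof (intro runs_Seq runs_wp)
    show "wp w inp read_input (runs w inp (bitlen_com rK rN ;; ?shift ;; ?branch) T3 ?Post) (R, M, [])"
      using m2 li s inp0 ne rd by (simp add: read_input_def)
  qed
  moreover have "csize read_input + T3 \<le> 2 * time_factor * x"
  proof -
    let ?c = "100 * 2 ^ 31 * (csize large + csize small)"
    have tf: "?c + 12 \<le> time_factor" "csize read_input \<le> time_factor" "1 \<le> time_factor"
      by (simp_all add: time_factor_def bfs_com_def)
    have "(?c + 12) * x \<le> time_factor * x" using tf(1) by (rule mult_le_mono1)
    then have "?c * x + 12 * x \<le> time_factor * x" by (simp only: add_mult_distrib)
    moreover have "time_factor * 1 \<le> time_factor * x" using x by (rule mult_le_mono2)
    then have "csize read_input \<le> time_factor * x" using tf(2) by linarith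
    moreover have "bitlen n \<le> x" using bitlen_le_self[of n] by (simp add: x_def)
    moreover have "csize read_input + T3 = csize read_input + 4 * bitlen n + 8 + ?c * x"
      unfolding T3_def T2_def T1_def by linarith
    ultimately show ?thesis using x by linarith
  qed
  ultimately show ?thesis unfolding x_def by (rule runs_weaken)
qed

section \<open>Space\<close>

lemma log_bitlen:
  assumes "0 < x"
  shows "log 2 (real x) \<le> real (bitlen x)" "real (bitlen x) \<le> log 2 (real x) + 1"
proof -
  have "real x < 2 ^ bitlen x" using less_power_bitlen[of x] by (metis of_nat_less_iff of_nat_power of_nat_numeral)
  then show "log 2 (real x) \<le> real (bitlen x)"
    using assms by (simp add: log_le_iff powr_realpow less_imp_le)
  have "real (2 ^ (bitlen x - 1)) \<le> real x" using power_bitlen_le[OF assms] by (simp only: of_nat_le_iff)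
  then have "2 powr real (bitlen x - 1) \<le> real x" by (simp add: powr_realpow)
  then have "real (bitlen x - 1) \<le> log 2 (real x)" using assms by (simp add: le_log_iff)
  then show "real (bitlen x) \<le> log 2 (real x) + 1" by linarith
qed

text \<open>Extra bits per vertex: the first summand is the packing loss of the bitmaps; the second
  is for two summaries and two stack slots per superblock, with a factor 2 for their
  packing.\<close>

definition overhead1 :: "real \<Rightarrow> real" where
  "overhead1 k = 4 / log 2 k + 32 * (log 2 k + 1)\<^sup>2 / k"

text \<open>Rounding up to whole superblocks, and the lookup table. It is evaluated at
  \<open>log 2 n + 1\<close>, an upper bound of \<open>bitlen n\<close> in closed form, to which
  \<open>real_asymp\<close> applies.\<close>

definition overhead2 :: "real \<Rightarrow> real" where
  "overhead2 k = 4 * k\<^sup>2 + 8 * k + 2 * k * 2 powr (k / 6)"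

text \<open>The leading term comes from the bitmaps: \<open>2 * (y + 1) * t\<close> fields of
  \<open>t\<close> bits, with \<open>y * t^2 <= n\<close>.\<close>

lemma words_bits:
  assumes k32: "32 \<le> bitlen n" and w: "n + 2 \<le> 2 ^ w" and wn: "w \<le> n"
  shows "real (words w n * w) \<le>
    2 * real n + (real n * overhead1 (real (bitlen n)) + overhead2 (log 2 (real n) + 1)) + 2 * real w"
proof -
  define k r t where "k = bitlen n" and "r = bitlen k" and "t = chunk_size n"
  define y where "y = n div (t * t)"
  note tb = chunk_size_bounds[OF k32, folded k_def t_def]
  note rb = bitlen_bitlen_bounds[OF k32, folded k_def r_def]
  have kw: "k \<le> w" unfolding k_def by (rule bitlen_le) (use w in simp)
  have k: "32 \<le> k" "0 < k" "0 < t" using k32 tb(1) by (simp_all add: k_def)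
  have kn: "k \<le> n" unfolding k_def by (rule bitlen_le_self)
  define q Q where "q = w div t" and "Q = w div k"
  define a c where "a = 2 * ((y + 1) * t)" and "c = 4 * (y + 1) + 2 ^ t"
  have words: "words w n = a div q + c div Q + 2"
    using wn by (simp add: words_def baseB_def table_pos_def superblocks_def fieldsA_def fieldsB_def
        a_def c_def q_def Q_def t_def k_def y_def min_def)
  have Q1: "1 \<le> Q" using kw k by (simp add: Q_def Suc_le_eq div_greater_zero_iff)
  have yt: "y * (t * t) \<le> n" unfolding y_def by (rule div_times_less_eq_dividend)
  have rt: "k < r * t + r" and rt': "t * r \<le> k"
  proof -
    have t: "t = k div r" by (simp add: t_def chunk_size_def k_def r_def)
    show "t * r \<le> k" unfolding t by (rule div_times_less_eq_dividend)
    show "k < r * t + r" unfolding t using rb(1) by (metis add.commute dividend_less_times_div less_le_trans zero_less_numeral mult.commute)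
  qed
  have wq: "w < q * t + t" unfolding q_def using k by (metis add.commute dividend_less_div_times)
  have wQ: "w < Q * k + k" unfolding Q_def using k by (metis add.commute dividend_less_div_times)
  have part1: "real (a div q) * real w \<le> 2 * real n + 4 * real n / real r + 4 * (real t)\<^sup>2"
  proof -
    have "real (a div q) * real q \<le> real a"
      by (metis div_times_less_eq_dividend of_nat_le_iff of_nat_mult)
    then have "real (a div q) * real q * real t \<le> real a * real t" by (intro mult_right_mono) auto
    also have "\<dots> = 2 * (real (y * (t * t))) + 2 * (real t)\<^sup>2"
      by (simp add: a_def power2_eq_square algebra_simps)
    also have "\<dots> \<le> 2 * real n + 2 * (real t)\<^sup>2"
      by (intro add_right_mono mult_left_mono of_nat_mono yt) simp
    finally have 1: "real (a div q) * (real q * real t) \<le> 2 * real n + 2 * (real t)\<^sup>2" by (simp add: mult.assoc)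
    text \<open>Since \<open>w < (q + 1) t\<close> and \<open>r t \<le> k \<le> w\<close>, we get \<open>w (1 - 1 / r) \<le> q t\<close>.\<close>
    have 2: "real w \<le> (1 + 2 / real r) * (real q * real t)"
    proof -
      have "real t * real r \<le> real w" using rt' kw by (metis le_trans of_nat_le_iff of_nat_mult)
      then have "real t \<le> real w / real r" using rb(1) by (simp add: field_simps)
      moreover have "real w \<le> real q * real t + real t"
        using wq by (metis less_imp_le of_nat_add of_nat_le_iff of_nat_mult)
      ultimately have "real w * (1 - 1 / real r) \<le> real q * real t" by (simp add: algebra_simps)
      then have "(1 + 2 / real r) * (real w * (1 - 1 / real r)) \<le> (1 + 2 / real r) * (real q * real t)"
        by (intro mult_left_mono) auto
      \<comment> \<open>\<open>(1 + 2 / r) * (1 - 1 / r) = 1 + 1 / r - 2 / r^2\<close> is at least 1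
        as soon as \<open>r >= 2\<close>.\<close>
      moreover have "real w * 1 \<le> real w * ((1 + 2 / real r) * (1 - 1 / real r))"
        using rb(1) by (intro mult_left_mono) (auto simp: field_simps)
      moreover have "(1 + 2 / real r) * (real w * (1 - 1 / real r)) =
          real w * ((1 + 2 / real r) * (1 - 1 / real r))" by (simp only: mult_ac)
      ultimately show ?thesis by linarith
    qed
    have "real (a div q) * real w \<le> real (a div q) * ((1 + 2 / real r) * (real q * real t))"
      using 2 by (intro mult_left_mono) auto
    also have "\<dots> = (1 + 2 / real r) * (real (a div q) * (real q * real t))" by (simp only: mult_ac)
    also have "\<dots> \<le> (1 + 2 / real r) * (2 * real n + 2 * (real t)\<^sup>2)"
      using 1 by (intro mult_left_mono) auto
    also have "\<dots> = 2 * real n + 4 * real n / real r + (1 + 2 / real r) * (2 * (real t)\<^sup>2)"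
      by (simp add: algebra_simps)
    also have "(1 + 2 / real r) * (2 * (real t)\<^sup>2) \<le> 2 * (2 * (real t)\<^sup>2)"
      using rb(1) by (intro mult_right_mono) (auto simp: field_simps)
    finally show ?thesis by simp
  qed
  \<comment> \<open>\<open>Q >= 1\<close> gives \<open>w < (Q + 1) * k <= 2 * Q * k\<close>, so
    packing at most doubles the space. This loss is harmless because the second array has only
    \<open>o(n)\<close> bits.\<close>
  have part2: "real (c div Q) * real w \<le> 8 * (real y * real k) + 8 * real k + 2 * real k * 2 ^ t"
  proof -
    have "k \<le> Q * k" using Q1 by (cases Q) auto
    moreover have "Q * (2 * k) = Q * k + Q * k" by simp
    ultimately have "w \<le> Q * (2 * k)" using wQ by linarith
    then have "c div Q * w \<le> c div Q * (Q * (2 * k))" by (rule mult_le_mono2)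
    also have "\<dots> = (c div Q * Q) * (2 * k)" by simp
    also have "\<dots> \<le> c * (2 * k)" by (intro mult_le_mono1 div_times_less_eq_dividend)
    finally have "real (c div Q * w) \<le> real (c * (2 * k))" by (simp only: of_nat_le_iff)
    then show ?thesis by (simp add: c_def algebra_simps)
  qed
  have K: "real k \<le> log 2 (real n) + 1" "log 2 (real k) \<le> real r" "real r \<le> log 2 (real k) + 1"
    using log_bitlen[of n] log_bitlen[of k] k kn by (simp_all add: k_def r_def)
  have lk: "0 < log 2 (real k)" using k by simp
  \<comment> \<open>Combines \<open>k <= 2 * r * t\<close> with \<open>y * t^2 <= n\<close> to
    \<open>y * k^2 <= 4 * r^2 * n\<close>.\<close>
  have yk: "real y * real k \<le> real n * (4 * (log 2 (real k) + 1)\<^sup>2 / real k)"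
  proof -
    have "r \<le> r * t" using k by simp
    then have "k \<le> 2 * (r * t)" using rt by linarith
    then have "k * k \<le> (2 * (r * t)) * (2 * (r * t))" by (intro mult_le_mono)
    then have "y * (k * k) \<le> y * ((2 * (r * t)) * (2 * (r * t)))" by (rule mult_le_mono2)
    also have "\<dots> = 4 * (r * r) * (y * (t * t))" by (simp add: algebra_simps)
    also have "\<dots> \<le> 4 * (r * r) * n" using yt by (rule mult_le_mono2)
    finally have "real (y * (k * k)) \<le> real (4 * (r * r) * n)" by (simp only: of_nat_le_iff)
    then have "real y * real k \<le> real n * (4 * (real r)\<^sup>2 / real k)"
      using k by (simp add: field_simps power2_eq_square)
    also have "\<dots> \<le> real n * (4 * (log 2 (real k) + 1)\<^sup>2 / real k)"
      using K(3) by (intro mult_left_mono divide_right_mono power_mono) auto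
    finally show ?thesis .
  qed
  have nr: "4 * real n / real r \<le> real n * (4 / log 2 (real k))"
    using K(2) lk by (simp add: frac_le)
  have rest: "4 * (real t)\<^sup>2 + 8 * real k + 2 * real k * 2 ^ t \<le> overhead2 (log 2 (real n) + 1)"
  proof -
    let ?L = "log 2 (real n) + 1"
    have t6: "6 * real t \<le> ?L" using K(1) tb(2) by linarith
    then have "real t \<le> ?L" by linarith
    moreover have "(2::real) ^ t \<le> 2 powr (?L / 6)"
    proof -
      have "(2::real) ^ t = 2 powr real t" by (simp add: powr_realpow)
      also have "\<dots> \<le> 2 powr (?L / 6)" using t6 by (intro powr_mono) simp_all
      finally show ?thesis .
    qed
    ultimately show ?thesis
      unfolding overhead2_def using K(1) k
      by (intro add_mono mult_mono power_mono) auto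
  qed
  have "real (words w n * w) = real (a div q) * real w + real (c div Q) * real w + 2 * real w"
    by (simp add: words algebra_simps)
  moreover have "real n * overhead1 (real k) = real n * (4 / log 2 (real k)) +
      8 * (real n * (4 * (log 2 (real k) + 1)\<^sup>2 / real k))"
    by (simp add: overhead1_def distrib_left)
  ultimately show ?thesis
    unfolding k_def[symmetric] using part1 part2 yk nr rest by linarith
qed

lemma filterlim_bitlen: "filterlim (\<lambda>n. real (bitlen n)) at_top at_top"
proof (rule filterlim_at_top_mono)
  show "filterlim (\<lambda>n. log 2 (real n)) at_top at_top" by real_asymp
  show "eventually (\<lambda>n. log 2 (real n) \<le> real (bitlen n)) at_top"
    using eventually_gt_at_top[of 0] by eventually_elim (rule log_bitlen)
qed

lemma overhead_smallo:
  "(\<lambda>n. real n * overhead1 (real (bitlen n)) + overhead2 (log 2 (real n) + 1)) \<in> o(\<lambda>n. real n)"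
proof (rule sum_in_smallo)
  have "(overhead1 \<longlongrightarrow> 0) at_top" unfolding overhead1_def by real_asymp
  then have "((\<lambda>n. overhead1 (real (bitlen n))) \<longlongrightarrow> 0) at_top"
    using filterlim_bitlen by (rule filterlim_compose)
  then have "(\<lambda>n. overhead1 (real (bitlen n))) \<in> o(\<lambda>_. 1)" by (intro smalloI_tendsto) simp_all
  then have "(\<lambda>n. real n * overhead1 (real (bitlen n))) \<in> o(\<lambda>n. real n * 1)"
    by (intro landau_o.big_small_mult) simp_all
  then show "(\<lambda>n. real n * overhead1 (real (bitlen n))) \<in> o(\<lambda>n. real n)" by simp
  show "(\<lambda>n. overhead2 (log 2 (real n) + 1)) \<in> o(\<lambda>n. real n)"
    unfolding overhead2_def by real_asymp
qed

text \<open>Taking the true excess over \<open>2 * n\<close> makes the space bound immediate and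
  leaves only its growth to be proved. If \<open>n + 2 > 2 ^ W n\<close>, no valid input exists, and
  the value 0 keeps such \<open>n\<close> out of the asymptotics.\<close>

definition excess :: "nat \<Rightarrow> (nat \<Rightarrow> nat) \<Rightarrow> nat \<Rightarrow> real" where
  "excess c W n = (if n + 2 \<le> 2 ^ W n
     then max 0 (real ((c + workspace (W n) n) * W n) - 2 * real n) else 0)"

text \<open>Eventually \<open>W n <= n\<close> and \<open>32 <= bitlen n\<close>, so
  \<open>words_bits\<close> applies. The \<open>c\<close> registers and two words lost to rounding
  cost \<open>(c + 2) * W n\<close> bits, which is \<open>o(n)\<close> by assumption.\<close>

lemma excess_smallo:
  assumes W: "(\<lambda>n. real (W n)) \<in> o(\<lambda>n. real n)"
  shows "excess c W \<in> o(\<lambda>n. real n)"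
proof -
  let ?F = "\<lambda>n. (real n * overhead1 (real (bitlen n)) + overhead2 (log 2 (real n) + 1)) +
    (real c + 2) * real (W n)"
  have F: "?F \<in> o(\<lambda>n. real n)"
    by (intro sum_in_smallo overhead_smallo landau_o.small.cmult_in_iff[THEN iffD2] W) auto
  have "eventually (\<lambda>n. norm (real (W n)) \<le> 1 * norm (real n)) at_top"
    using landau_o.smallD[OF W, of 1] by simp
  moreover have "eventually (\<lambda>n. 32 \<le> real (bitlen n)) at_top"
    using filterlim_bitlen unfolding filterlim_at_top by blast
  ultimately have "eventually (\<lambda>n. norm (excess c W n) \<le> 1 * norm (?F n)) at_top"
  proof eventually_elim
    case (elim n)
    then have k: "32 \<le> bitlen n" and wn: "W n \<le> n" by simp_all
    show ?case
    proof (cases "n + 2 \<le> 2 ^ W n")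
      case True
      have "workspace (W n) n = words (W n) n" using k by (simp add: workspace_def)
      then have "real ((c + workspace (W n) n) * W n) = real c * real (W n) + real (words (W n) n * W n)"
        by (simp add: algebra_simps)
      moreover have "(real c + 2) * real (W n) = real c * real (W n) + 2 * real (W n)"
        by (simp add: algebra_simps)
      ultimately have "real ((c + workspace (W n) n) * W n) - 2 * real n \<le> ?F n"
        using words_bits[OF k True wn] by linarith
      then have "excess c W n \<le> max 0 (?F n)" using True by (simp add: excess_def)
      moreover have "0 \<le> excess c W n" by (simp add: excess_def)
      ultimately show ?thesis by (simp add: abs_if max_def split: if_splits)
    qed (simp add: excess_def)
  qed
  then have "excess c W \<in> O(?F)" by (rule landau_o.bigI[rotated]) simp
  then show ?thesis using F by (rule landau_o.big_small_trans)
qed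

section \<open>The theorem\<close>

text \<open>Forgetting the direction is injective on arcs with \<open>u <= v\<close> and on arcs
  with \<open>v <= u\<close>, and these two sets cover \<open>A\<close>.\<close>

lemma card_le_card_edges:
  fixes A :: "nat rel"
  assumes "finite A"
  shows "card A \<le> 2 * card ((\<lambda>(u, v). {u, v}) ` A)"
proof -
  let ?f = "\<lambda>(u, v). {u, v :: nat}"
  let ?B = "{(u, v) \<in> A. u \<le> v}" and ?C = "{(u, v) \<in> A. v \<le> u}"
  have "card ?B \<le> card (?f ` A)" "card ?C \<le> card (?f ` A)"
    by (rule card_inj_on_le[of ?f]; use assms in \<open>auto simp: inj_on_def doubleton_eq_iff\<close>)+
  moreover have "card A \<le> card ?B + card ?C"
  proof -
    have "A = ?B \<union> ?C" by auto
    then show ?thesis using card_Un_le[of ?B ?C] by (simp only:)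
  qed
  ultimately show ?thesis by linarith
qed

lemma graph_with_edgesD:
  assumes "graph_with_edges G m"
  shows "pair_wf_digraph G" "card (parcs G) \<le> 2 * m"
proof -
  from assms have "pair_fin_digraph G"
    unfolding graph_with_edges_def pair_pseudo_graph_def by blast
  then interpret pair_fin_digraph G .
  show "pair_wf_digraph G" ..
  show "card (parcs G) \<le> 2 * m"
    using assms card_le_card_edges[OF pair_finite_arcs] unfolding graph_with_edges_def by auto
qed

theorem theorem5:
  shows "\<exists>(P :: program) (C :: nat). \<forall>W :: nat \<Rightarrow> nat.
    (\<lambda>n. real (W n)) \<in> \<Omega>(\<lambda>n. log 2 (real n)) \<longrightarrow>
    (\<lambda>n. real (W n)) \<in> o(\<lambda>n. real n) \<longrightarrow>
    (\<exists>g :: nat \<Rightarrow> real. g \<in> o(\<lambda>n. real n) \<and>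
      (\<forall>(n :: nat) (m :: nat) (G :: nat pair_pre_digraph) (s :: nat) (inp :: nat list).
        graph_with_edges G m \<longrightarrow> pverts G = {..<n} \<longrightarrow>
        Digraph_Component.connected (with_proj G) \<longrightarrow> s < n \<longrightarrow>
        adjacency_list_input (W n) G s inp \<longrightarrow>
        (\<exists>S. real (space_bits (W n) P S) \<le> 2 * real n + g n \<and>
          computes_within (W n) inp P S (C * (m + n)) (bfs_order G s))))"
proof (intro exI allI impI conjI)
  let ?P = "compile 0 bfs_com @ [Halt]"
  let ?c = "card (\<Union>i\<in>set ?P. instr_regs i)"
  fix W :: "nat \<Rightarrow> nat"
  assume "(\<lambda>n. real (W n)) \<in> o(\<lambda>n. real n)"
  then show "excess ?c W \<in> o(\<lambda>n. real n)" by (rule excess_smallo)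
  fix n m G s inp
  assume G: "graph_with_edges G m" "pverts G = {..<n}" and s: "s < n"
    and input: "adjacency_list_input (W n) G s inp"
  interpret pair_wf_digraph G by (rule graph_with_edgesD(1)[OF G(1)])
  have adj: "adjacency inp n (parcs G)"
    using input G(2) wellformed' unfolding adjacency_list_input_def adjacency_def
    by (auto simp: Image_singleton)
  have inp: "length inp \<le> 2 ^ W n" "inp ! 0 = n" "inp ! 1 = s" "n + 2 \<le> length inp"
    using input G(2) by (simp_all add: adjacency_list_input_def)
  then have w: "n + 2 \<le> 2 ^ W n" by linarith
  show "real (space_bits (W n) ?P (workspace (W n) n)) \<le> 2 * real n + excess ?c W n"
    using w by (simp add: space_bits_def excess_def)
  show "computes_within (W n) inp ?P (workspace (W n) n) (4 * time_factor * (m + n)) (bfs_order G s)"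
    unfolding computes_within_def
  proof (intro allI impI)
    fix R :: "nat \<Rightarrow> nat" and M :: "nat list"
    assume M: "length M = workspace (W n) n"
    have "runs (W n) inp bfs_com (4 * time_factor * (m + n)) (\<lambda>(R, M, out). bfs_order G s out) (R, M, [])"
    proof (rule runs_weaken[OF bfs_com_runs[OF w inp(2,3) s M adj inp(1)]])
      \<comment> \<open>An undirected edge may stand for two arcs; this doubles the constant once
        more.\<close>
      have "card (parcs G) + n \<le> 2 * (m + n)" using graph_with_edgesD(2)[OF G(1)] by simp
      then have "2 * time_factor * (card (parcs G) + n) \<le> 2 * time_factor * (2 * (m + n))"
        by (rule mult_le_mono2)
      also have "\<dots> = 4 * time_factor * (m + n)" by simp
      finally show "2 * time_factor * (card (parcs G) + n) \<le> 4 * time_factor * (m + n)" .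
      show "case \<sigma> of (R, M, out) \<Rightarrow> bfs_order G s out"
        if "case \<sigma> of (R, M, out) \<Rightarrow> \<exists>l. bfs_inv (parcs G) s l out {} {} []" for \<sigma> :: state
        using that bfs_inv_bfs_order s G(2) by auto
    qed
    then show "\<exists>t out. t \<le> 4 * time_factor * (m + n) \<and> halts_with (W n) inp ?P R M t out \<and> bfs_order G s out"
      by (rule runs_halts_with)
  qed
qed

end
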